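(* Let $M$ be a compact connected manifold without boundary, let $(g_j)_{j\ge1}$ be a sequence of continuous Riemannian metrics on $M$, and let $g_0$ be a smooth Riemannian metric on $M$, such that $$g_j(v,v)\ge g_0(v,v)\qquad\text{for all } v\in TM \text{ and all } j,$$ and $$\operatorname{Vol}_{g_j}(M)\to\operatorname{Vol}_{g_0}(M)\quad\text{as } j\to\infty.$$ Then there exists a subsequence (not relabeled) along which $$\lim_{j\to\infty}d_j(p,q)=d_0(p,q)\qquad\text{for almost every }(p,q)\in M\times M.$$
   Context: For $j\ge 0$, $d_j(p,q)=\inf\{L_j(C): C \text{ piecewise smooth curve with } C(0)=p,\ C(1)=q\}$, where $L_j(C)=\int_0^1\sqrt{g_j(C'(s),C'(s))}\,ds$. $\operatorname{Vol}_g$ denotes the Riemannian volume of $g$. "Almost every" is with respect to the product measure $dV_{g_0}\times dV_{g_0}$ on $M\times M$, where $dV_{g_0}$ is the Riemannian volume measure of $g_0$. *)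

theory Defs
  imports "HOL-Analysis.Analysis"
begin

text \<open>
  A closed manifold is a whole type \<open>'a\<close> with its topology (compactness and connectedness are
  stated for \<open>UNIV\<close>) and a \<open>C\<^sup>\<infinity>\<close> atlas with values in \<open>real ^ 'n\<close>.  The index type is taken
  in \<open>{finite, wellorder}\<close> because the change-of-variables theorems of HOL-Analysis require this;
  the order plays no role in any definition, and the numeral types provide every
  dimension \<open>n \<ge> 1\<close>.
\<close>

primrec diff_times_on ::
  "nat \<Rightarrow> 'b::real_normed_vector set \<Rightarrow> ('b \<Rightarrow> 'c::real_normed_vector) \<Rightarrow> bool" where
  "diff_times_on 0 S f \<longleftrightarrow> continuous_on S f"
| "diff_times_on (Suc k) S f \<longleftrightarrow>
     (\<forall>x\<in>S. f differentiable (at x)) \<and>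
     (\<forall>v. diff_times_on k S (\<lambda>x. frechet_derivative f (at x) v))"

text \<open>On an open subset of a Euclidean space \<open>diff_times_on k\<close> is the class \<open>C\<^sup>k\<close>.  The notion
  below is only used for open sets.\<close>

definition smooth_on :: "'b::real_normed_vector set \<Rightarrow> ('b \<Rightarrow> 'c::real_normed_vector) \<Rightarrow> bool" where
  "smooth_on S f \<longleftrightarrow> (\<forall>k. diff_times_on k S f)"


type_synonym ('a, 'n) chart = "'a set \<times> ('a \<Rightarrow> (real, 'n) vec)"

definition topological_chart ::
  "('a::topological_space, 'n::{finite,wellorder}) chart \<Rightarrow> bool" where
  "topological_chart c \<longleftrightarrow> open (fst c) \<and> open (snd c ` fst c) \<and>
     homeomorphism (fst c) (snd c ` fst c) (snd c) (inv_into (fst c) (snd c))"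

definition chart_inv ::
  "('a, 'n::{finite,wellorder}) chart \<Rightarrow> (real, 'n) vec \<Rightarrow> 'a" where
  "chart_inv c = inv_into (fst c) (snd c)"

definition transition ::
  "('a, 'n::{finite,wellorder}) chart \<Rightarrow> ('a, 'n) chart \<Rightarrow> (real, 'n) vec \<Rightarrow> (real, 'n) vec" where
  "transition c c' = snd c' \<circ> chart_inv c"

definition smooth_atlas ::
  "('a::topological_space, 'n::{finite,wellorder}) chart set \<Rightarrow> bool" where
  "smooth_atlas A \<longleftrightarrow>
     (\<forall>c\<in>A. topological_chart c) \<and>
     (\<Union>c\<in>A. fst c) = UNIV \<and>
     (\<forall>c\<in>A. \<forall>c'\<in>A. smooth_on (snd c ` (fst c \<inter> fst c')) (transition c c'))"


text \<open>A tangent vector at \<open>p\<close> is the family of its coordinate vectors in all charts around \<open>p\<close>,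
  related by the differentials of the transition maps; the components in all other charts are
  set to zero, so that equality of functions is equality of tangent vectors and the vector space
  operations are the pointwise ones.\<close>

type_synonym ('a, 'n) tangent = "('a, 'n) chart \<Rightarrow> (real, 'n) vec"

definition charts_at :: "('a, 'n) chart set \<Rightarrow> 'a \<Rightarrow> ('a, 'n) chart set" where
  "charts_at A p = {c \<in> A. p \<in> fst c}"

definition tangent_space ::
  "('a, 'n::{finite,wellorder}) chart set \<Rightarrow> 'a \<Rightarrow> ('a, 'n) tangent set" where
  "tangent_space A p =
     {v. (\<forall>c. c \<notin> charts_at A p \<longrightarrow> v c = 0) \<and>
         (\<forall>c\<in>charts_at A p. \<forall>c'\<in>charts_at A p.
            v c' = frechet_derivative (transition c c') (at (snd c p)) (v c))}"

text \<open>The tangent vector at \<open>p\<close> whose coordinate vector in the chart \<open>c\<close> is \<open>\<xi>\<close>.\<close>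

definition coord_vector ::
  "('a, 'n::{finite,wellorder}) chart set \<Rightarrow> ('a, 'n) chart \<Rightarrow> 'a \<Rightarrow> (real, 'n) vec \<Rightarrow> ('a, 'n) tangent" where
  "coord_vector A c p \<xi> =
     (\<lambda>c'. if c' \<in> charts_at A p
           then frechet_derivative (transition c c') (at (snd c p)) \<xi> else 0)"


type_synonym ('a, 'n) metric = "'a \<Rightarrow> ('a, 'n) tangent \<Rightarrow> ('a, 'n) tangent \<Rightarrow> real"

definition pointwise_inner ::
  "('a, 'n::{finite,wellorder}) chart set \<Rightarrow> ('a, 'n) metric \<Rightarrow> bool" where
  "pointwise_inner A g \<longleftrightarrow>
     (\<forall>p. (\<forall>u\<in>tangent_space A p. \<forall>v\<in>tangent_space A p. g p u v = g p v u) \<and>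
          (\<forall>u\<in>tangent_space A p. \<forall>v\<in>tangent_space A p. \<forall>w\<in>tangent_space A p. \<forall>a b.
             g p (\<lambda>c. a *\<^sub>R u c + b *\<^sub>R v c) w = a * g p u w + b * g p v w) \<and>
          (\<forall>v\<in>tangent_space A p. v \<noteq> (\<lambda>c. 0) \<longrightarrow> 0 < g p v v))"

text \<open>The coordinate expression of \<open>g\<close> at the point with coordinates \<open>x\<close> in the chart \<open>c\<close>.\<close>

definition local_metric ::
  "('a, 'n::{finite,wellorder}) chart set \<Rightarrow> ('a, 'n) metric \<Rightarrow> ('a, 'n) chart
     \<Rightarrow> (real, 'n) vec \<Rightarrow> (real, 'n) vec \<Rightarrow> (real, 'n) vec \<Rightarrow> real" where
  "local_metric A g c x \<xi> \<eta> =
     g (chart_inv c x) (coord_vector A c (chart_inv c x) \<xi>) (coord_vector A c (chart_inv c x) \<eta>)"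

definition continuous_riemannian_metric ::
  "('a, 'n::{finite,wellorder}) chart set \<Rightarrow> ('a, 'n) metric \<Rightarrow> bool" where
  "continuous_riemannian_metric A g \<longleftrightarrow> pointwise_inner A g \<and>
     (\<forall>c\<in>A. \<forall>\<xi> \<eta>. continuous_on (snd c ` fst c) (\<lambda>x. local_metric A g c x \<xi> \<eta>))"

definition smooth_riemannian_metric ::
  "('a, 'n::{finite,wellorder}) chart set \<Rightarrow> ('a, 'n) metric \<Rightarrow> bool" where
  "smooth_riemannian_metric A g \<longleftrightarrow> pointwise_inner A g \<and>
     (\<forall>c\<in>A. \<forall>\<xi> \<eta>. smooth_on (snd c ` fst c) (\<lambda>x. local_metric A g c x \<xi> \<eta>))"


definition gram_matrix ::
  "('a, 'n::{finite,wellorder}) chart set \<Rightarrow> ('a, 'n) metric \<Rightarrow> ('a, 'n) chart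
     \<Rightarrow> (real, 'n) vec \<Rightarrow> ((real, 'n) vec, 'n) vec" where
  "gram_matrix A g c x = (\<chi> i j. local_metric A g c x (axis i 1) (axis j 1))"

text \<open>The Riemannian volume is the unique Borel measure that has density \<open>\<surd>(det g\<^sub>i\<^sub>j)\<close> with respect to
  Lebesgue measure in every chart.  (It exists by the change-of-variables formula, and is unique
  because countably many charts cover the manifold.)\<close>

definition riem_volume ::
  "('a::{t2_space,second_countable_topology}, 'n::{finite,wellorder}) chart set
     \<Rightarrow> ('a, 'n) metric \<Rightarrow> 'a measure" where
  "riem_volume A g = (THE \<mu>. sets \<mu> = sets borel \<and>
     (\<forall>c\<in>A. \<forall>B\<in>sets borel. B \<subseteq> fst c \<longrightarrow>
        emeasure \<mu> B = (\<integral>\<^sup>+x\<in>snd c ` B. ennreal (sqrt (det (gram_matrix A g c x))) \<partial>lborel)))"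


text \<open>Smoothness on the closed interval \<open>[a, b]\<close> means that the curve extends smoothly to an open
  neighbourhood of it.\<close>

definition smooth_curve_on ::
  "('a::topological_space, 'n::{finite,wellorder}) chart set \<Rightarrow> real \<Rightarrow> real \<Rightarrow> (real \<Rightarrow> 'a) \<Rightarrow> bool" where
  "smooth_curve_on A a b C \<longleftrightarrow>
     (\<exists>I \<gamma>. open I \<and> {a..b} \<subseteq> I \<and> continuous_on I \<gamma> \<and> (\<forall>s\<in>{a..b}. \<gamma> s = C s) \<and>
        (\<forall>c\<in>A. smooth_on {s\<in>I. \<gamma> s \<in> fst c} (snd c \<circ> \<gamma>)))"

definition piecewise_smooth_curve ::
  "('a::topological_space, 'n::{finite,wellorder}) chart set \<Rightarrow> (real \<Rightarrow> 'a) \<Rightarrow> bool" where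
  "piecewise_smooth_curve A C \<longleftrightarrow> continuous_on {0..1} C \<and>
     (\<exists>m t. t 0 = 0 \<and> t m = 1 \<and>
        (\<forall>i<m. t i < t (Suc i) \<and> smooth_curve_on A (t i) (t (Suc i)) C))"

text \<open>\<open>C'(s)\<close>.  At the finitely many breakpoints of a piecewise smooth curve this is an unspecified
  value, which does not affect the length integral.\<close>

definition velocity ::
  "('a, 'n::{finite,wellorder}) chart set \<Rightarrow> (real \<Rightarrow> 'a) \<Rightarrow> real \<Rightarrow> ('a, 'n) tangent" where
  "velocity A C s =
     (\<lambda>c. if c \<in> charts_at A (C s)
          then vector_derivative (snd c \<circ> C) (at s within {0..1}) else 0)"

definition riem_length ::
  "('a, 'n::{finite,wellorder}) chart set \<Rightarrow> ('a, 'n) metric \<Rightarrow> (real \<Rightarrow> 'a) \<Rightarrow> real" where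
  "riem_length A g C = integral {0..1} (\<lambda>s. sqrt (g (C s) (velocity A C s) (velocity A C s)))"

definition riem_dist ::
  "('a::topological_space, 'n::{finite,wellorder}) chart set \<Rightarrow> ('a, 'n) metric \<Rightarrow> 'a \<Rightarrow> 'a \<Rightarrow> real" where
  "riem_dist A g p q =
     Inf {riem_length A g C | C. piecewise_smooth_curve A C \<and> C 0 = p \<and> C 1 = q}"

end

theory Submission
  imports Defs
begin

text \<open>
  Since \<open>g\<^sub>j \<ge> g\<^sub>0\<close>, all eigenvalues of \<open>g\<^sub>j\<close> relative to \<open>g\<^sub>0\<close> are at least \<open>1\<close>, so the largest one is
  bounded by their product: \<open>|v|\<close> grows at most by the ratio \<open>h\<^sub>j \<ge> 1\<close> of the volume densities when
  \<open>g\<^sub>0\<close> is replaced by \<open>g\<^sub>j\<close>.  Convergence of the volumes means that \<open>h\<^sub>j \<rightarrow> 1\<close> in \<open>L\<^sup>1\<close>; along a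
  subsequence even \<open>\<Sum> (h\<^sub>j - 1)\<close> is integrable.  By Fubini, for almost all pairs \<open>x\<close>, \<open>y\<close> in a chart this
  sum is integrable along the straight segment from \<open>x\<close> to \<open>y\<close> (if the segment stays in the chart),
  and then its \<open>g\<^sub>j\<close>-lengths converge to its \<open>g\<^sub>0\<close>-length.  A curve from \<open>p\<close> to \<open>q\<close> that is almost
  minimal for \<open>g\<^sub>0\<close> is replaced by a chain of such short segments with generic vertices close to the
  curve, which hardly increases the \<open>g\<^sub>0\<close>-length.  This is possible as soon as \<open>p\<close> and \<open>q\<close> lie outside
  a null set, and it gives \<open>limsup d\<^sub>j(p, q) \<le> d\<^sub>0(p, q)\<close>; the converse inequality is immediate.
\<close>

subsection \<open>Determinants of positive definite matrices\<close>

text \<open>The bound by the volume ratio is proved without diagonalisation: for a given v, the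
  difference of the two Gram matrices splits into a rank-one part, which carries the whole growth of
  the norm of v and changes the determinant in an explicit way, and a positive semidefinite rest,
  which can only raise the determinant. Summability makes the exceptional set independent of j: one
  finite line integral controls all g_j at once. The obstacle is that p and q are prescribed, while
  Fubini speaks of almost all pairs. A point is called good if almost every second end point is
  admissible. Intermediate vertices are chosen from open sets, so they can be good and admissible
  from their predecessor at the same time. The last segment has to end exactly at q; there goodness
  of q and the symmetry of the line integral make almost every preceding vertex admissible. Hence
  the induction along the curve (\<open>reaches\<close>) must offer vertices with an arbitrary
  almost sure property. It also allows an arbitrary additive error, so that errors do not accumulate
  with the number of segments.\<close>

definition outer_prod :: "real ^ 'n \<Rightarrow> real ^ 'n \<Rightarrow> real ^ 'n ^ 'n" where
  "outer_prod u l = (\<chi> i j. u $ i * l $ j)"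

definition psd_matrix :: "real ^ 'n ^ 'n \<Rightarrow> bool" where
  "psd_matrix P \<longleftrightarrow> transpose P = P \<and> (\<forall>v. 0 \<le> v \<bullet> (P *v v))"

definition pd_matrix :: "real ^ 'n ^ 'n \<Rightarrow> bool" where
  "pd_matrix P \<longleftrightarrow> transpose P = P \<and> (\<forall>v. v \<noteq> 0 \<longrightarrow> 0 < v \<bullet> (P *v v))"

lemma outer_prod_mult_vec: "outer_prod u l *v w = (l \<bullet> w) *\<^sub>R u"
  by (simp add: vec_eq_iff outer_prod_def matrix_vector_mult_def inner_vec_def sum_distrib_left
      sum_distrib_right mult_ac)

lemma transpose_outer_prod: "transpose (outer_prod u l) = outer_prod l u"
  by (simp add: vec_eq_iff outer_prod_def transpose_def mult_ac)

lemma mult_outer_prod: "A ** outer_prod u l = outer_prod (A *v u) l"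
  by (simp add: matrix_eq matrix_vector_mul_assoc[symmetric] outer_prod_mult_vec matrix_vector_mult_scaleR)

lemma outer_prod_mult: "outer_prod u l ** A = outer_prod u (transpose A *v l)"
  unfolding matrix_eq
  by (simp add: matrix_vector_mul_assoc[symmetric] outer_prod_mult_vec
      dot_lmul_matrix[symmetric])

lemma matrix_mult_add_left:
  fixes A B C :: "real ^ 'n ^ 'n"
  shows "(A + B) ** C = A ** C + B ** C"
  by (simp add: matrix_eq matrix_vector_mul_assoc[symmetric] matrix_vector_mult_add_rdistrib)

text \<open>The matrix is the identity with column \<open>k\<close> replaced by
  \<open>axis k 1 + c *\<^sub>R u\<close>, so Cramer's lemma evaluates its determinant as a
  component of that vector.\<close>

lemma det_one_plus_outer_axis:
  fixes u :: "real ^ 'n"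
  shows "det (mat 1 + outer_prod u (c *\<^sub>R axis k 1)) = 1 + c * u $ k"
proof -
  have "mat 1 + outer_prod u (c *\<^sub>R axis k 1) =
    (\<chi> i j. if j = k then (mat 1 *v (axis k 1 + c *\<^sub>R u)) $ i else mat 1 $ i $ j)"
    unfolding matrix_vector_mul_lid by (simp add: vec_eq_iff mat_def outer_prod_def axis_def)
  then show ?thesis
    using cramer_lemma[of k "mat 1" "axis k 1 + c *\<^sub>R u"] by (simp add: axis_def)
qed

text \<open>An orthogonal \<open>Q\<close> that takes \<open>l\<close> to a multiple of a coordinate
  axis reduces this to the previous case: conjugation by \<open>Q\<close> preserves the determinant
  and turns \<open>outer_prod u l\<close> into \<open>outer_prod (Q *v u) (Q *v l)\<close>.\<close>

lemma det_one_plus_outer: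
  fixes u l :: "real ^ 'n"
  shows "det (mat 1 + outer_prod u l) = 1 + l \<bullet> u"
proof -
  fix k :: 'n
  have "norm l = norm (norm l *\<^sub>R (axis k 1 :: real ^ 'n))" by (simp add: norm_axis_1)
  then obtain f where f: "orthogonal_transformation f" "f l = norm l *\<^sub>R (axis k 1 :: real ^ 'n)"
    using orthogonal_transformation_exists by metis
  define Q where "Q = matrix f"
  have Q: "orthogonal_matrix Q" and lin: "linear f"
    using f orthogonal_transformation_matrix unfolding Q_def by blast+
  have Qv: "Q *v x = f x" for x using lin by (simp add: Q_def)
  have QQ: "transpose Q ** Q = mat 1" "Q ** transpose Q = mat 1"
    using Q by (auto simp: orthogonal_matrix_def)
  have eq: "Q ** (mat 1 + outer_prod u l) ** transpose Q = mat 1 + outer_prod (f u) (f l)"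
    by (simp add: matrix_add_ldistrib matrix_mult_add_left QQ mult_outer_prod outer_prod_mult Qv)
  have "det (mat 1 + outer_prod u l) = det (transpose Q ** Q) * det (mat 1 + outer_prod u l)"
    by (simp add: QQ)
  also have "\<dots> = det (Q ** (mat 1 + outer_prod u l) ** transpose Q)"
    by (simp add: det_mul)
  also have "\<dots> = 1 + norm l * (f u) $ k"
    unfolding eq f(2) by (rule det_one_plus_outer_axis)
  also have "norm l * (f u) $ k = f l \<bullet> f u"
    by (simp add: f(2) inner_axis' )
  also have "\<dots> = l \<bullet> u" using f(1) by (simp add: orthogonal_transformation_def)
  finally show ?thesis .
qed

lemma symmetric_matrix_inner:
  fixes P :: "real ^ 'n ^ 'n"
  assumes "transpose P = P"
  shows "u \<bullet> (P *v v) = (P *v u) \<bullet> v"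
  using assms by (metis dot_lmul_matrix transpose_matrix_vector)

lemma psd_cauchy_schwarz:
  fixes P :: "real ^ 'n ^ 'n"
  assumes "psd_matrix P"
  shows "(u \<bullet> (P *v v))\<^sup>2 \<le> (u \<bullet> (P *v u)) * (v \<bullet> (P *v v))"
proof -
  have sym: "transpose P = P" and pos: "\<And>v. 0 \<le> v \<bullet> (P *v v)"
    using assms by (auto simp: psd_matrix_def)
  let ?a = "u \<bullet> (P *v u)" and ?b = "u \<bullet> (P *v v)" and ?c = "v \<bullet> (P *v v)"
  have vu: "v \<bullet> (P *v u) = ?b" using symmetric_matrix_inner[OF sym, of v u] by (simp add: inner_commute)
  have q: "0 \<le> s\<^sup>2 * ?a + 2 * s * t * ?b + t\<^sup>2 * ?c" for s t
  proof -
    have "(s *\<^sub>R u + t *\<^sub>R v) \<bullet> (P *v (s *\<^sub>R u + t *\<^sub>R v)) = s\<^sup>2 * ?a + 2 * s * t * ?b + t\<^sup>2 * ?c"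
      by (simp add: matrix_vector_right_distrib matrix_vector_mult_scaleR inner_add_left inner_add_right
          vu power2_eq_square algebra_simps)
    then show ?thesis using pos by metis
  qed
  show ?thesis
  proof (cases "?c = 0")
    case True
    have "?b = 0"
    proof (rule ccontr)
      assume b: "?b \<noteq> 0"
      \<comment> \<open>Here the form is affine in \<open>t\<close>, and this \<open>t\<close> would
        give it the value -1.\<close>
      have "0 \<le> ?a + 2 * (- (?a + 1) / (2 * ?b)) * ?b" using q[of 1 "- (?a + 1) / (2 * ?b)"] True by simp
      also have "\<dots> = -1" using b by (simp add: field_simps)
      finally show False by simp
    qed
    then show ?thesis using True by simp
  next
    case False
    then have c: "?c > 0" using pos[of v] by linarith
    \<comment> \<open>The minimising ratio \<open>t / s = - ?b / ?c\<close>, with the denominator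
      cleared.\<close>
    have "0 \<le> ?c\<^sup>2 * ?a + 2 * ?c * (- ?b) * ?b + (- ?b)\<^sup>2 * ?c" by (rule q)
    also have "\<dots> = ?c * (?a * ?c - ?b\<^sup>2)" by (simp add: power2_eq_square algebra_simps)
    finally show ?thesis using c by (simp add: zero_le_mult_iff)
  qed
qed

lemma pd_imp_psd: "pd_matrix P \<Longrightarrow> psd_matrix P"
  unfolding pd_matrix_def psd_matrix_def by (metis inner_zero_left less_eq_real_def)

lemma pd_plus_psd: "pd_matrix B \<Longrightarrow> psd_matrix P \<Longrightarrow> pd_matrix (B + P)"
  by (simp add: pd_matrix_def psd_matrix_def transpose_def vec_eq_iff matrix_vector_mult_add_rdistrib
      inner_add_right add_pos_nonneg)

lemma psd_outer: "0 \<le> c \<Longrightarrow> psd_matrix (outer_prod (c *\<^sub>R u) u)"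
  unfolding psd_matrix_def outer_prod_mult_vec transpose_outer_prod
  by (auto simp: outer_prod_def inner_commute mult_ac)

lemma pd_inverse_vector:
  fixes B :: "real ^ 'n ^ 'n"
  assumes "pd_matrix B"
  obtains w where "B *v w = l"
proof -
  have "inj ((*v) B)"
  proof (rule injI)
    fix x y assume "B *v x = B *v y"
    then have "B *v (x - y) = 0" by (simp add: matrix_vector_mult_diff_distrib)
    then have "(x - y) \<bullet> (B *v (x - y)) = 0" by simp
    then show "x = y" using assms unfolding pd_matrix_def by (metis less_irrefl right_minus_eq)
  qed
  then have "surj ((*v) B)"
    by (intro linear_injective_imp_surjective) auto
  then show thesis using that by (metis surjD)
qed

text \<open>With \<open>B *v w = l\<close> the update is \<open>B\<close> times a rank-one
  perturbation of the identity, so the determinant is multiplied by exactly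
  \<open>1 + c * (l \<bullet> w)\<close>. Cauchy-Schwarz for \<open>B\<close>, applied to
  \<open>v\<close> and \<open>w\<close>, shows that the quadratic form at \<open>v\<close> grows by
  at most the same factor.\<close>

lemma det_rank_one_update:
  fixes B :: "real ^ 'n ^ 'n"
  assumes B: "pd_matrix B" and c: "0 \<le> c" and det: "0 \<le> det B"
  shows "det B * (v \<bullet> (B *v v) + c * (l \<bullet> v)\<^sup>2) \<le> det (B + outer_prod (c *\<^sub>R l) l) * (v \<bullet> (B *v v))"
    and "det B \<le> det (B + outer_prod (c *\<^sub>R l) l)"
proof -
  obtain w where w: "B *v w = l" using pd_inverse_vector[OF B] .
  have "B + outer_prod (c *\<^sub>R l) l = B ** (mat 1 + outer_prod (c *\<^sub>R w) l)"
    by (simp add: matrix_add_ldistrib mult_outer_prod w matrix_vector_mult_scaleR)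
  then have eq: "det (B + outer_prod (c *\<^sub>R l) l) = det B * (1 + c * (l \<bullet> w))"
    by (simp add: det_mul det_one_plus_outer)
  have lw: "0 \<le> l \<bullet> w" using pd_imp_psd[OF B] w by (metis inner_commute psd_matrix_def)
  show "det B \<le> det (B + outer_prod (c *\<^sub>R l) l)"
    unfolding eq using det c lw by (simp add: mult_le_cancel_left1 mult_left_mono algebra_simps)
  have "(l \<bullet> v)\<^sup>2 \<le> (v \<bullet> (B *v v)) * (l \<bullet> w)"
    using psd_cauchy_schwarz[OF pd_imp_psd[OF B], of v w] w by (simp add: inner_commute)
  then have "c * (l \<bullet> v)\<^sup>2 \<le> c * ((v \<bullet> (B *v v)) * (l \<bullet> w))"
    using c by (intro mult_left_mono) auto
  then have "v \<bullet> (B *v v) + c * (l \<bullet> v)\<^sup>2 \<le> (1 + c * (l \<bullet> w)) * (v \<bullet> (B *v v))"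
    by (simp add: algebra_simps)
  from mult_left_mono[OF this det]
  show "det B * (v \<bullet> (B *v v) + c * (l \<bullet> v)\<^sup>2) \<le> det (B + outer_prod (c *\<^sub>R l) l) * (v \<bullet> (B *v v))"
    unfolding eq by (simp add: mult_ac)
qed

text \<open>Cauchy-Schwarz with \<open>u = P *v v\<close> bounds the fourth power of the norm of
  \<open>P *v v\<close> by 0.\<close>

lemma psd_kernel:
  assumes "psd_matrix P" "v \<bullet> (P *v v) = 0"
  shows "P *v v = 0"
  using psd_cauchy_schwarz[OF assms(1), of "P *v v" v] assms(2) by simp

text \<open>One step of symmetric Gaussian elimination: the subtracted form at \<open>u\<close> is
  the square of \<open>v \<bullet> (P *v u)\<close> divided by \<open>v \<bullet> (P *v v)\<close>,
  which Cauchy-Schwarz bounds by the form of \<open>P\<close>. The direction \<open>v\<close> joins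
  the kernel and no old kernel direction is lost.\<close>

lemma psd_peel:
  fixes P :: "real ^ 'n ^ 'n"
  assumes P: "psd_matrix P" and v: "0 < v \<bullet> (P *v v)"
  defines "c \<equiv> 1 / (v \<bullet> (P *v v))" and "l \<equiv> P *v v"
  shows "psd_matrix (P - outer_prod (c *\<^sub>R l) l)"
    and "(P - outer_prod (c *\<^sub>R l) l) *v v = 0"
    and "\<And>u. P *v u = 0 \<Longrightarrow> (P - outer_prod (c *\<^sub>R l) l) *v u = 0"
proof -
  have sym: "transpose P = P" using P by (simp add: psd_matrix_def)
  have lu: "l \<bullet> u = v \<bullet> (P *v u)" for u
    unfolding l_def using symmetric_matrix_inner[OF sym, of v u] by simp
  have mul: "(P - outer_prod (c *\<^sub>R l) l) *v u = P *v u - ((l \<bullet> u) * c) *\<^sub>R l" for u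
    by (simp add: matrix_vector_mult_diff_rdistrib outer_prod_mult_vec)
  have "0 \<le> u \<bullet> (P *v u) - ((l \<bullet> u) * c) * (u \<bullet> l)" for u
  proof -
    have "(v \<bullet> (P *v u))\<^sup>2 \<le> (v \<bullet> (P *v v)) * (u \<bullet> (P *v u))" by (rule psd_cauchy_schwarz[OF P])
    then have "(v \<bullet> (P *v u))\<^sup>2 * c \<le> u \<bullet> (P *v u)"
      using v unfolding c_def by (simp add: pos_divide_le_eq mult.commute)
    then show ?thesis by (simp add: inner_commute[of u l] lu power2_eq_square mult_ac)
  qed
  moreover have "transpose (P - outer_prod (c *\<^sub>R l) l) = P - outer_prod (c *\<^sub>R l) l"
    using sym by (simp add: transpose_def vec_eq_iff outer_prod_def mult_ac)
  ultimately show "psd_matrix (P - outer_prod (c *\<^sub>R l) l)"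
    by (simp add: psd_matrix_def mul inner_diff_right)
  show "(P - outer_prod (c *\<^sub>R l) l) *v v = 0"
    using v unfolding mul lu by (simp add: c_def l_def)
  show "(P - outer_prod (c *\<^sub>R l) l) *v u = 0" if "P *v u = 0" for u
    using that unfolding mul lu by simp
qed

text \<open>\<open>P\<close> is peeled off along one coordinate axis at a time, and every peeled
  part is a rank-one update; \<open>S\<close> contains the axes that may still lie outside the
  kernel. The sign of \<open>det B\<close> is carried as a hypothesis because
  \<open>pd_det_pos\<close> is itself derived from this lemma.\<close>

lemma det_add_psd_aux:
  fixes B P :: "real ^ 'n ^ 'n"
  assumes "finite S" "pd_matrix B" "0 \<le> det B" "psd_matrix P" "\<And>i. i \<notin> S \<Longrightarrow> P *v axis i 1 = 0"
  shows "det B \<le> det (B + P)"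
  using assms
proof (induction S arbitrary: B P rule: finite_induct)
  case empty
  then have "P = 0"
    by (simp add: vec_eq_iff matrix_vector_mul_component inner_axis)
  then show ?case by simp
next
  case (insert k S)
  show ?case
  proof (cases "axis k 1 \<bullet> (P *v axis k 1) = 0")
    case True
    then have "P *v axis k 1 = 0" using psd_kernel insert by blast
    then have "P *v axis i 1 = 0" if "i \<notin> S" for i using insert that by (cases "i = k") auto
    then show ?thesis using insert by blast
  next
    case False
    then have pos: "0 < axis k 1 \<bullet> (P *v axis k 1)"
      using insert.prems(3) unfolding psd_matrix_def by (metis less_eq_real_def)
    define c l where "c = 1 / (axis k 1 \<bullet> (P *v axis k 1))" and "l = P *v axis k 1"
    define R where "R = outer_prod (c *\<^sub>R l) l"
    note peel = psd_peel[OF insert.prems(3) pos, folded c_def l_def, folded R_def]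
    have c: "0 \<le> c" using pos by (simp add: c_def)
    have B: "det B \<le> det (B + R)" unfolding R_def
      by (rule det_rank_one_update(2)[OF insert.prems(1) c insert.prems(2)])
    have "det (B + R) \<le> det ((B + R) + (P - R))"
    proof (rule insert.IH)
      show "pd_matrix (B + R)" unfolding R_def by (intro pd_plus_psd insert.prems psd_outer c)
      show "0 \<le> det (B + R)" using B insert.prems by linarith
      show "psd_matrix (P - R)" by (rule peel)
      show "(P - R) *v axis i 1 = 0" if "i \<notin> S" for i
        using that peel(2,3) insert.prems(4) by (cases "i = k") auto
    qed
    then show ?thesis using B by simp
  qed
qed

lemma det_add_psd:
  assumes "pd_matrix B" "0 \<le> det B" "psd_matrix P"
  shows "det B \<le> det (B + P)"
  using det_add_psd_aux[of UNIV B P] assms by simp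

lemma pd_matrix_lower_bound:
  fixes B :: "real ^ 'n ^ 'n"
  assumes "pd_matrix B"
  obtains e where "0 < e" "\<And>v. e * (v \<bullet> v) \<le> v \<bullet> (B *v v)"
proof -
  fix k :: 'n
  have "axis k (1::real) \<in> sphere 0 1" by (simp add: norm_axis_1)
  then have "sphere (0::real^'n) 1 \<noteq> {}" by blast
  moreover have "continuous_on (sphere (0::real^'n) 1) (\<lambda>v. v \<bullet> (B *v v))"
    by (intro continuous_intros)
  ultimately have "\<exists>x\<in>sphere 0 1. \<forall>y\<in>sphere 0 1. x \<bullet> (B *v x) \<le> y \<bullet> (B *v y)"
    by (rule continuous_attains_inf[OF compact_sphere])
  then obtain x where x: "x \<in> sphere 0 1" "\<And>y. y \<in> sphere 0 1 \<Longrightarrow> x \<bullet> (B *v x) \<le> y \<bullet> (B *v y)"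
    by blast
  show thesis
  proof
    show "0 < x \<bullet> (B *v x)" using assms x(1) unfolding pd_matrix_def by (metis mem_sphere_0 norm_zero zero_neq_one)
    fix v :: "real^'n"
    show "x \<bullet> (B *v x) * (v \<bullet> v) \<le> v \<bullet> (B *v v)"
    proof (cases "v = 0")
      case False
      then have "x \<bullet> (B *v x) \<le> (v /\<^sub>R norm v) \<bullet> (B *v (v /\<^sub>R norm v))" by (intro x) simp
      also have "\<dots> = (v \<bullet> (B *v v)) / (v \<bullet> v)"
        by (simp add: matrix_vector_mult_scaleR norm_eq_sqrt_inner divide_inverse mult.assoc[symmetric]
            inverse_mult_distrib[symmetric] mult_ac del: inverse_mult_distrib)
      finally show ?thesis using False by (simp add: field_simps)
    qed simp
  qed
qed

text \<open>\<open>B\<close> dominates a positive multiple of the identity, whose determinant is a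
  product of positive numbers; the difference is positive semidefinite, so
  \<open>det_add_psd\<close> applies.\<close>

lemma pd_det_pos:
  fixes B :: "real ^ 'n ^ 'n"
  assumes "pd_matrix B"
  shows "0 < det B"
proof -
  obtain e where e: "0 < e" "\<And>v. e * (v \<bullet> v) \<le> v \<bullet> (B *v v)"
    using pd_matrix_lower_bound[OF assms] by blast
  have E: "mat e *v v = e *\<^sub>R v" for v :: "real^'n"
    by (simp add: vec_eq_iff mat_def matrix_vector_mult_def if_distrib[where f="\<lambda>x. x * _"] cong: if_cong)
  have d: "0 < det (mat e :: real^'n^'n)"
    using e(1) by (subst det_diagonal) (auto simp: mat_def prod_pos)
  have "det (mat e :: real^'n^'n) \<le> det (mat e + (B - mat e))"
  proof (rule det_add_psd)
    show "pd_matrix (mat e :: real^'n^'n)" using e(1) by (simp add: pd_matrix_def E)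
    show "0 \<le> det (mat e :: real^'n^'n)" using d by simp
    have "transpose (B - mat e) = B - mat e"
      using assms by (auto simp: pd_matrix_def transpose_def vec_eq_iff mat_def)
    then show "psd_matrix (B - mat e)"
      using e(2) by (simp add: psd_matrix_def matrix_vector_mult_diff_rdistrib E inner_diff_right)
  qed
  then show ?thesis using d by simp
qed

text \<open>Peeling \<open>P = A - B\<close> in the direction \<open>v\<close> itself puts all of
  \<open>v \<bullet> (P *v v)\<close> into the rank-one part \<open>R\<close>. The sharp estimate
  for \<open>B + R\<close> comes from \<open>det_rank_one_update\<close>, and adding the rest
  \<open>P - R\<close> only increases the determinant.\<close>

lemma
  fixes A B :: "real ^ 'n ^ 'n"
  assumes A: "pd_matrix A" and B: "pd_matrix B" and le: "\<And>v. v \<bullet> (B *v v) \<le> v \<bullet> (A *v v)"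
  shows det_mono: "det B \<le> det A"
    and det_ratio_bound: "det B * (v \<bullet> (A *v v)) \<le> det A * (v \<bullet> (B *v v))"
proof -
  define P where "P = A - B"
  have P: "psd_matrix P"
  proof -
    have "transpose P = P" using A B by (simp add: P_def pd_matrix_def transpose_def vec_eq_iff)
    then show ?thesis using le by (simp add: P_def psd_matrix_def matrix_vector_mult_diff_rdistrib inner_diff_right)
  qed
  have dB: "0 \<le> det B" using pd_det_pos[OF B] by simp
  show mono: "det B \<le> det A" using det_add_psd[OF B dB P] by (simp add: P_def)
  have vA: "v \<bullet> (A *v v) = v \<bullet> (B *v v) + v \<bullet> (P *v v)"
    by (simp add: P_def matrix_vector_mult_diff_rdistrib inner_diff_right)
  have vB: "0 \<le> v \<bullet> (B *v v)" using pd_imp_psd[OF B] by (simp add: psd_matrix_def)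
  show "det B * (v \<bullet> (A *v v)) \<le> det A * (v \<bullet> (B *v v))"
  proof (cases "v \<bullet> (P *v v) = 0")
    case True
    then show ?thesis using mono vB by (simp add: vA mult_right_mono)
  next
    case False
    then have pos: "0 < v \<bullet> (P *v v)" using P by (metis less_eq_real_def psd_matrix_def)
    define c l where "c = 1 / (v \<bullet> (P *v v))" and "l = P *v v"
    define R where "R = outer_prod (c *\<^sub>R l) l"
    note peel = psd_peel[OF P pos, folded c_def l_def, folded R_def]
    have c: "0 \<le> c" using pos by (simp add: c_def)
    have BO: "pd_matrix (B + R)" unfolding R_def by (intro pd_plus_psd B psd_outer c)
    have "det (B + R) \<le> det ((B + R) + (P - R))"
      using det_add_psd[OF BO _ peel(1)] pd_det_pos[OF BO] by simp
    then have "det (B + R) \<le> det A" by (simp add: P_def)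
    moreover have "det B * (v \<bullet> (B *v v) + c * (l \<bullet> v)\<^sup>2) \<le> det (B + R) * (v \<bullet> (B *v v))"
      unfolding R_def by (rule det_rank_one_update(1)[OF B c dB])
    moreover have "c * (l \<bullet> v)\<^sup>2 = v \<bullet> (P *v v)"
      using pos by (simp add: c_def l_def inner_commute power2_eq_square)
    ultimately have "det B * (v \<bullet> (B *v v) + v \<bullet> (P *v v)) \<le> det (B + R) * (v \<bullet> (B *v v))"
        "det (B + R) * (v \<bullet> (B *v v)) \<le> det A * (v \<bullet> (B *v v))"
      using vB by (simp_all add: mult_right_mono)
    then show ?thesis unfolding vA by linarith
  qed
qed

subsection \<open>Change of variables and integrals along segments\<close>

text \<open>Translates between absolute integrability, in which the change of variables theorem is
  phrased, and non-negative integrals over \<open>lborel\<close>, in which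
  \<open>riem_volume\<close> is phrased.\<close>

lemma absolutely_integrable_iff_nn_integral:
  fixes h :: "'a::euclidean_space \<Rightarrow> real"
  assumes meas: "(\<lambda>x. indicator S x * h x) \<in> borel_measurable borel" and nonneg: "\<And>x. x \<in> S \<Longrightarrow> 0 \<le> h x"
  shows "h absolutely_integrable_on S \<longleftrightarrow> (\<integral>\<^sup>+x\<in>S. ennreal (h x) \<partial>lborel) < \<infinity>"
    and "h absolutely_integrable_on S \<Longrightarrow> (\<integral>\<^sup>+x\<in>S. ennreal (h x) \<partial>lborel) = ennreal (integral S h)"
proof -
  let ?h = "\<lambda>x. indicator S x * h x"
  have m: "?h \<in> borel_measurable lborel" using meas by simp
  have nn: "0 \<le> ?h x" for x using nonneg by (auto simp: indicator_def)
  have eq: "(\<integral>\<^sup>+x\<in>S. ennreal (h x) \<partial>lborel) = (\<integral>\<^sup>+x. ennreal (?h x) \<partial>lborel)"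
    by (intro nn_integral_cong) (auto simp: indicator_def)
  have i1: "h absolutely_integrable_on S \<longleftrightarrow> integrable lborel ?h"
    using integrable_completion[OF m] by (simp add: set_integrable_def)
  also have "\<dots> \<longleftrightarrow> (\<integral>\<^sup>+x. ennreal (?h x) \<partial>lborel) < \<infinity>"
    using m nn by (auto simp: integrable_iff_bounded)
  finally show "h absolutely_integrable_on S \<longleftrightarrow> (\<integral>\<^sup>+x\<in>S. ennreal (h x) \<partial>lborel) < \<infinity>"
    unfolding eq .
  assume ab: "h absolutely_integrable_on S"
  have "integral S h = integral\<^sup>L lborel ?h"
    using set_lebesgue_integral_eq_integral(2)[OF ab] integral_completion[OF m]
    by (simp add: set_lebesgue_integral_def)
  moreover have "(\<integral>\<^sup>+x. ennreal (?h x) \<partial>lborel) = ennreal (integral\<^sup>L lborel ?h)"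
    using ab i1 nn by (intro nn_integral_eq_integral) auto
  ultimately show "(\<integral>\<^sup>+x\<in>S. ennreal (h x) \<partial>lborel) = ennreal (integral S h)"
    unfolding eq by simp
qed

lemma nn_integral_change_of_variables:
  fixes f :: "real ^ 'n::{finite,wellorder} \<Rightarrow> real" and \<psi> :: "real ^ 'n::_ \<Rightarrow> real ^ 'n::_"
  assumes S: "S \<in> sets borel"
    and der: "\<And>x. x \<in> S \<Longrightarrow> (\<psi> has_derivative \<psi>' x) (at x)"
    and inj: "inj_on \<psi> S"
    and mf: "(\<lambda>y. indicator (\<psi> ` S) y * f y) \<in> borel_measurable borel"
    and mg: "(\<lambda>x. indicator S x * (\<bar>det (matrix (\<psi>' x))\<bar> * f (\<psi> x))) \<in> borel_measurable borel"
    and nonneg: "\<And>y. y \<in> \<psi> ` S \<Longrightarrow> 0 \<le> f y"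
  shows "(\<integral>\<^sup>+y\<in>\<psi> ` S. ennreal (f y) \<partial>lborel) =
    (\<integral>\<^sup>+x\<in>S. ennreal (\<bar>det (matrix (\<psi>' x))\<bar> * f (\<psi> x)) \<partial>lborel)"
proof -
  let ?g = "\<lambda>x. \<bar>det (matrix (\<psi>' x))\<bar> * f (\<psi> x)"
  have der': "(\<psi> has_derivative \<psi>' x) (at x within S)" if "x \<in> S" for x
    using der[OF that] by (rule has_derivative_at_withinI)
  have S': "S \<in> sets lebesgue" using S by simp
  \<comment> \<open>The change of variables theorem concerns vector-valued functions, so real values
    are embedded in \<open>real^1\<close>.\<close>
  have cv: "?g absolutely_integrable_on S \<and> integral S ?g = b \<longleftrightarrow>
      f absolutely_integrable_on (\<psi> ` S) \<and> integral (\<psi> ` S) f = b" for b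
    using has_absolute_integral_change_of_variables[OF S' der' inj, of "\<lambda>x. vec (f x) :: real^1" "vec b"]
    by (simp add: absolutely_integrable_on_1_iff integral_on_1_eq)
  note 1 = absolutely_integrable_iff_nn_integral[OF mf nonneg]
  have nn: "0 \<le> ?g x" if "x \<in> S" for x using nonneg that by simp
  note 2 = absolutely_integrable_iff_nn_integral[OF mg nn]
  show ?thesis
  proof (cases "f absolutely_integrable_on (\<psi> ` S)")
    case True
    then have "?g absolutely_integrable_on S" "integral S ?g = integral (\<psi> ` S) f"
      using cv[of "integral (\<psi> ` S) f"] by auto
    then show ?thesis using 1(2)[OF _ True] 2(2) by simp
  next
    case False
    \<comment> \<open>Integrability fails on both sides at once, and then both integrals are
      infinite.\<close>
    then have "\<not> ?g absolutely_integrable_on S" using cv by blast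
    then show ?thesis using 1(1) 2(1) False unfolding infinity_ennreal_def less_top[symmetric] by simp
  qed
qed

section \<open>Finiteness of integrals along almost all segments\<close>

lemma nn_integral_affine:
  fixes f :: "'a::euclidean_space \<Rightarrow> ennreal"
  assumes [measurable]: "f \<in> borel_measurable borel" and c: "c \<noteq> 0"
  shows "(\<integral>\<^sup>+x. f x \<partial>lborel) = ennreal (\<bar>c\<bar> ^ DIM('a)) * (\<integral>\<^sup>+x. f (t + c *\<^sub>R x) \<partial>lborel)"
  by (subst lborel_affine[OF c, of t])
    (simp add: nn_integral_density nn_integral_distr nn_integral_cmult)

text \<open>The factor \<open>norm (y - x)\<close> of the line element is left out; for distinct end
  points this does not affect finiteness.\<close>

definition segment_integral :: "('a::euclidean_space \<Rightarrow> ennreal) \<Rightarrow> 'a \<Rightarrow> 'a \<Rightarrow> ennreal" where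
  "segment_integral f x y = (\<integral>\<^sup>+s\<in>{0..1}. f (x + s *\<^sub>R (y - x)) \<partial>lborel)"

lemma segment_integral_commute:
  assumes [measurable]: "f \<in> borel_measurable borel"
  shows "segment_integral f x y = segment_integral f y x"
proof -
  have "segment_integral f x y =
      (\<integral>\<^sup>+s. f (x + (1 + - 1 * s) *\<^sub>R (y - x)) * indicator {0..1} (1 + - 1 * s) \<partial>lborel)"
    unfolding segment_integral_def
    by (subst nn_integral_real_affine[where c = "-1" and t = 1]) auto
  also have "\<dots> = segment_integral f y x"
    unfolding segment_integral_def
    by (intro nn_integral_cong) (auto simp: indicator_def algebra_simps)
  finally show ?thesis .
qed

text \<open>On the half of the segment nearer to \<open>y\<close>, the point on it depends on \<open>y\<close> through a dilation of
  ratio at least \<open>1/2\<close>, so already the integral over all \<open>y\<close> is finite.\<close>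

lemma half_segment_integral_finite:
  fixes f :: "'a::euclidean_space \<Rightarrow> ennreal"
  assumes [measurable]: "f \<in> borel_measurable borel" and fin: "(\<integral>\<^sup>+x. f x \<partial>lborel) < \<infinity>"
  shows "AE y in lborel. (\<integral>\<^sup>+s\<in>{1/2..1}. f (x + s *\<^sub>R (y - x)) \<partial>lborel) < \<infinity>"
proof -
  let ?I = "\<integral>\<^sup>+x. f x \<partial>lborel"
  have inner: "(\<integral>\<^sup>+y. f (x + s *\<^sub>R (y - x)) \<partial>lborel) * indicator {1/2..1} s
      \<le> ennreal (2 ^ DIM('a)) * ?I * indicator {1/2..1} s" for s :: real
  proof (cases "s \<in> {1/2..1}")
    case True
    then have s: "s \<noteq> 0" "1/2 \<le> s" by auto
    let ?J = "\<integral>\<^sup>+y. f (x + s *\<^sub>R (y - x)) \<partial>lborel"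
    have eq: "x + s *\<^sub>R (y - x) = (x - s *\<^sub>R x) + s *\<^sub>R y" for y by (simp add: algebra_simps)
    have I: "?I = ennreal (\<bar>s\<bar> ^ DIM('a)) * ?J"
      unfolding eq by (rule nn_integral_affine) (use s in auto)
    have "1 = ennreal (2 ^ DIM('a)) * ennreal ((1/2) ^ DIM('a))"
      by (simp add: ennreal_mult[symmetric] power_mult_distrib[symmetric])
    also have "\<dots> \<le> ennreal (2 ^ DIM('a)) * ennreal (\<bar>s\<bar> ^ DIM('a))"
      using s by (intro mult_left_mono ennreal_leI power_mono) auto
    finally have "1 * ?J \<le> ennreal (2 ^ DIM('a)) * ennreal (\<bar>s\<bar> ^ DIM('a)) * ?J"
      by (rule mult_right_mono) simp
    then show ?thesis using True by (simp add: I mult.assoc)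
  qed simp
  have "(\<integral>\<^sup>+y. (\<integral>\<^sup>+s\<in>{1/2..1}. f (x + s *\<^sub>R (y - x)) \<partial>lborel) \<partial>lborel) =
      (\<integral>\<^sup>+s. (\<integral>\<^sup>+y. f (x + s *\<^sub>R (y - x)) * indicator {1/2..1} s \<partial>lborel) \<partial>lborel)"
    by (rule lborel_pair.Fubini') measurable
  also have "\<dots> = (\<integral>\<^sup>+s. (\<integral>\<^sup>+y. f (x + s *\<^sub>R (y - x)) \<partial>lborel) * indicator {1/2..1} s \<partial>lborel)"
    by (intro nn_integral_cong nn_integral_multc) measurable
  also have "\<dots> \<le> (\<integral>\<^sup>+s. ennreal (2 ^ DIM('a)) * ?I * indicator {1/2..1} (s::real) \<partial>lborel)"
    by (intro nn_integral_mono inner)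
  also have "\<dots> \<le> (\<integral>\<^sup>+s. ennreal (2 ^ DIM('a)) * ?I * indicator {0..1} (s::real) \<partial>lborel)"
    by (intro nn_integral_mono mult_left_mono) (auto simp: indicator_def)
  also have "\<dots> = ennreal (2 ^ DIM('a)) * ?I"
    by (subst nn_integral_cmult_indicator) auto
  also have "\<dots> < \<infinity>" using fin by (simp add: ennreal_mult_less_top)
  finally have "(\<integral>\<^sup>+y. (\<integral>\<^sup>+s\<in>{1/2..1}. f (x + s *\<^sub>R (y - x)) \<partial>lborel) \<partial>lborel) \<noteq> \<infinity>" by simp
  from nn_integral_PInf_AE[OF _ this] show ?thesis
    by (simp add: less_top)
qed

text \<open>The half of the segment nearer to \<open>x\<close> is the far half of the reversed
  segment, so \<open>half_segment_integral_finite\<close> covers both halves once the roles of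
  \<open>x\<close> and \<open>y\<close> are exchanged.\<close>

lemma segment_integral_AE_finite:
  fixes f :: "'a::euclidean_space \<Rightarrow> ennreal"
  assumes [measurable]: "f \<in> borel_measurable borel" and fin: "(\<integral>\<^sup>+x. f x \<partial>lborel) < \<infinity>"
  shows "AE x in lborel. AE y in lborel. segment_integral f x y < \<infinity>"
proof -
  let ?H = "\<lambda>x y. \<integral>\<^sup>+s\<in>{1/2..1::real}. f (x + s *\<^sub>R (y - x)) \<partial>lborel"
  have H: "AE y in lborel. ?H x y < \<infinity>" for x
    by (rule half_segment_integral_finite[OF assms])
  \<comment> \<open>For each \<open>y\<close> the half nearer to \<open>x\<close> has a finite
    integral for almost all \<open>x\<close>; Fubini exchanges the two quantifiers.\<close>
  have "(AE x in lborel. AE y in lborel. ?H y x < \<infinity>) \<longleftrightarrow> (AE y in lborel. AE x in lborel. ?H y x < \<infinity>)"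
    by (rule lborel_pair.AE_commute) measurable
  then have "AE x in lborel. AE y in lborel. ?H y x < \<infinity>" using H by simp
  then show ?thesis
  proof eventually_elim
    case (elim x)
    from elim H[of x] show ?case
    proof eventually_elim
      case (elim y)
      have "(\<integral>\<^sup>+s\<in>{0..1/2}. f (x + s *\<^sub>R (y - x)) \<partial>lborel) =
          (\<integral>\<^sup>+s. f (x + (1 + - 1 * s) *\<^sub>R (y - x)) * indicator {0..1/2} (1 + - 1 * s) \<partial>lborel)"
        by (subst nn_integral_real_affine[where c = "-1" and t = 1]) auto
      also have "\<dots> = ?H y x"
        by (intro nn_integral_cong) (auto simp: indicator_def algebra_simps)
      finally have 1: "(\<integral>\<^sup>+s\<in>{0..1/2}. f (x + s *\<^sub>R (y - x)) \<partial>lborel) = ?H y x" .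
      have "segment_integral f x y \<le> (\<integral>\<^sup>+s. f (x + s *\<^sub>R (y - x)) * indicator {0..1/2} s
          + f (x + s *\<^sub>R (y - x)) * indicator {1/2..1} s \<partial>lborel)"
        unfolding segment_integral_def by (intro nn_integral_mono) (auto simp: indicator_def)
      also have "\<dots> = ?H y x + ?H x y"
        by (subst nn_integral_add) (auto simp: 1)
      also have "\<dots> < \<infinity>" using elim by simp
      finally show ?case .
    qed
  qed
qed

subsection \<open>Charts, tangent vectors and metrics in coordinates\<close>

text \<open>Openness of \<open>S\<close> matters: derivatives are taken at \<open>x\<close> in the
  whole space, so the values on \<open>S\<close> determine them only if \<open>S\<close> is a
  neighbourhood of \<open>x\<close>.\<close>

lemma diff_times_on_cong:
  assumes "open S" "diff_times_on k S f" "\<And>x. x \<in> S \<Longrightarrow> f x = h x"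
  shows "diff_times_on k S h"
  using assms(2,3)
proof (induction k arbitrary: f h)
  case 0
  then show ?case using continuous_on_cong[of S S f h] by simp
next
  case (Suc k)
  have d: "f differentiable (at x)" if "x \<in> S" for x using Suc.prems that by simp
  have fd: "frechet_derivative f (at x) = frechet_derivative h (at x)" if "x \<in> S" for x
    using frechet_derivative_transform_within_open[OF d[OF that] assms(1) that] Suc.prems(2) by blast
  have "h differentiable (at x)" if "x \<in> S" for x
    using d[OF that] has_derivative_transform_within_open[OF _ assms(1) that] Suc.prems(2)
    unfolding differentiable_def by blast
  moreover have "diff_times_on k S (\<lambda>x. frechet_derivative h (at x) v)" for v
    by (rule Suc.IH[of "\<lambda>x. frechet_derivative f (at x) v"]) (use Suc.prems fd in auto)
  ultimately show ?case by simp
qed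

text \<open>The derivative of the composite in direction \<open>v\<close> is the derivative of
  \<open>f\<close> in the fixed direction \<open>L v\<close>, again composed with the same affine
  map. So the induction closes without any product terms. Segments and affine changes of time
  require no more than this.\<close>

lemma diff_times_on_affine:
  assumes "bounded_linear L" "open T" "diff_times_on k S f" "\<And>s. s \<in> T \<Longrightarrow> p + L s \<in> S"
  shows "diff_times_on k T (\<lambda>s. f (p + L s))"
  using assms(3)
proof (induction k arbitrary: f)
  case 0
  have "continuous_on T (\<lambda>s. p + L s)"
    by (intro continuous_intros bounded_linear.continuous_on[OF assms(1)])
  then show ?case using 0 assms(4) by (auto intro!: continuous_on_compose2[of S f])
next
  case (Suc k)
  have L: "((\<lambda>s. p + L s) has_derivative L) (at s)" for s
    using bounded_linear.has_derivative[OF assms(1) has_derivative_ident] by (auto intro!: derivative_eq_intros)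
  have der: "((\<lambda>s. f (p + L s)) has_derivative (\<lambda>v. frechet_derivative f (at (p + L s)) (L v))) (at s)"
    if "s \<in> T" for s
  proof -
    have "f differentiable (at (p + L s))" using Suc.prems assms(4)[OF that] by simp
    then have "(f has_derivative frechet_derivative f (at (p + L s))) (at (p + L s))"
      by (simp add: frechet_derivative_works)
    from has_derivative_compose[OF L this] show ?thesis by simp
  qed
  have fd: "frechet_derivative (\<lambda>s. f (p + L s)) (at s) = (\<lambda>v. frechet_derivative f (at (p + L s)) (L v))"
    if "s \<in> T" for s using frechet_derivative_at[OF der[OF that]] by simp
  have "diff_times_on k T (\<lambda>s. frechet_derivative (\<lambda>s. f (p + L s)) (at s) v)" for v
  proof (rule diff_times_on_cong[OF assms(2)])
    show "diff_times_on k T (\<lambda>s. frechet_derivative f (at (p + L s)) (L v))"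
      by (rule Suc.IH[of "\<lambda>x. frechet_derivative f (at x) (L v)"]) (use Suc.prems in simp)
  qed (simp add: fd)
  moreover have "(\<lambda>s. f (p + L s)) differentiable (at s)" if "s \<in> T" for s
    using der[OF that] by (rule differentiableI)
  ultimately show ?case by simp
qed

lemma smooth_on_affine:
  assumes "bounded_linear L" "open T" "smooth_on S f" "\<And>s. s \<in> T \<Longrightarrow> p + L s \<in> S"
  shows "smooth_on T (\<lambda>s. f (p + L s))"
  unfolding smooth_on_def using diff_times_on_affine[OF assms(1,2) _ assms(4)] assms(3)
  unfolding smooth_on_def by blast

lemma smooth_on_imp_continuous_on: "smooth_on S f \<Longrightarrow> continuous_on S f"
  unfolding smooth_on_def using diff_times_on.simps(1) by blast

lemma smooth_on_imp_has_derivative: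
  "smooth_on S f \<Longrightarrow> x \<in> S \<Longrightarrow> (f has_derivative frechet_derivative f (at x)) (at x)"
  unfolding smooth_on_def using diff_times_on.simps(2)[of 0 S f] by (metis frechet_derivative_works)

lemma smooth_on_imp_continuous_on_derivative:
  "smooth_on S f \<Longrightarrow> continuous_on S (\<lambda>x. frechet_derivative f (at x) v)"
  unfolding smooth_on_def using diff_times_on.simps by metis

lemma continuous_on_det:
  fixes G :: "'b::topological_space \<Rightarrow> real ^ 'm ^ 'm"
  shows "continuous_on S G \<Longrightarrow> continuous_on S (\<lambda>x. det (G x))"
  unfolding det_def by (intro continuous_intros)

lemma continuous_on_matrix_vector_mult:
  fixes G :: "'b::topological_space \<Rightarrow> real ^ 'm ^ 'm"
  shows "continuous_on S G \<Longrightarrow> continuous_on S v \<Longrightarrow> continuous_on S (\<lambda>x. G x *v v x)"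
  unfolding matrix_vector_mult_def by (intro continuous_intros)

definition vol_density :: "('a, 'n::{finite,wellorder}) chart set \<Rightarrow> ('a, 'n) metric \<Rightarrow> ('a, 'n) chart
    \<Rightarrow> (real, 'n) vec \<Rightarrow> real" where
  "vol_density A g c x = sqrt (det (gram_matrix A g c x))"

definition chart_vol :: "('a, 'n::{finite,wellorder}) chart set \<Rightarrow> ('a, 'n) metric \<Rightarrow> ('a, 'n) chart
    \<Rightarrow> 'a set \<Rightarrow> ennreal" where
  "chart_vol A g c B = (\<integral>\<^sup>+x\<in>snd c ` B. ennreal (vol_density A g c x) \<partial>lborel)"

locale closed_manifold =
  fixes A :: "('a::{t2_space,second_countable_topology}, 'n::{finite,wellorder}) chart set"
  assumes atlas: "smooth_atlas A" and compact_space: "compact (UNIV :: 'a set)"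
begin

lemma topological_chart: "c \<in> A \<Longrightarrow> topological_chart c"
  using atlas by (simp add: smooth_atlas_def)

lemma chart_at: obtains c where "c \<in> A" "p \<in> fst c"
  using atlas unfolding smooth_atlas_def by blast

context
  fixes c assumes c: "c \<in> A"
begin

lemma open_chart_domain: "open (fst c)" and open_chart_image: "open (snd c ` fst c)"
  and chart_inv_chart: "p \<in> fst c \<Longrightarrow> chart_inv c (snd c p) = p"
  and chart_chart_inv: "x \<in> snd c ` fst c \<Longrightarrow> snd c (chart_inv c x) = x"
  and chart_inv_in: "x \<in> snd c ` fst c \<Longrightarrow> chart_inv c x \<in> fst c"
  and continuous_on_chart: "continuous_on (fst c) (snd c)"
  and continuous_on_chart_inv: "continuous_on (snd c ` fst c) (chart_inv c)"
  using topological_chart[OF c] unfolding topological_chart_def homeomorphism_def chart_inv_def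
  by (auto intro: f_inv_into_f inv_into_into)

lemma inj_on_chart: "inj_on (snd c) (fst c)"
  using chart_inv_chart by (metis inj_on_inverseI)

lemma chart_image_eq: "B \<subseteq> fst c \<Longrightarrow> snd c ` B = snd c ` fst c \<inter> chart_inv c -` B"
  using chart_inv_chart chart_chart_inv by (auto simp: image_iff subset_iff)

lemma open_chart_image_of: "open W \<Longrightarrow> W \<subseteq> fst c \<Longrightarrow> open (snd c ` W)"
  unfolding chart_image_eq
  by (rule continuous_open_preimage[OF continuous_on_chart_inv open_chart_image])

end

context
  fixes c c' assumes c: "c \<in> A" "c' \<in> A"
begin

lemma transition_chart: "p \<in> fst c \<Longrightarrow> transition c c' (snd c p) = snd c' p"
  by (simp add: transition_def chart_inv_chart c)

lemma smooth_on_transition: "smooth_on (snd c ` (fst c \<inter> fst c')) (transition c c')"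
  using atlas c by (simp add: smooth_atlas_def)

lemma transition_has_derivative:
  "p \<in> fst c \<Longrightarrow> p \<in> fst c' \<Longrightarrow>
    (transition c c' has_derivative frechet_derivative (transition c c') (at (snd c p))) (at (snd c p))"
  by (rule smooth_on_imp_has_derivative[OF smooth_on_transition]) auto

lemma linear_transition_derivative:
  "p \<in> fst c \<Longrightarrow> p \<in> fst c' \<Longrightarrow> linear (frechet_derivative (transition c c') (at (snd c p)))"
  using transition_has_derivative has_derivative_linear by blast

end

text \<open>The chain rule, since the composed transition maps agree with the direct one on the
  image of the triple overlap, which is open.\<close>

lemma transition_derivative_trans:
  assumes c: "c \<in> A" "c' \<in> A" "c'' \<in> A" and p: "p \<in> fst c" "p \<in> fst c'" "p \<in> fst c''"
  shows "frechet_derivative (transition c' c'') (at (snd c' p))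
      (frechet_derivative (transition c c') (at (snd c p)) \<xi>) =
    frechet_derivative (transition c c'') (at (snd c p)) \<xi>"
proof -
  let ?W = "snd c ` (fst c \<inter> fst c' \<inter> fst c'')"
  have "((\<lambda>x. transition c' c'' (transition c c' x)) has_derivative
     (\<lambda>\<xi>. frechet_derivative (transition c' c'') (at (transition c c' (snd c p)))
      (frechet_derivative (transition c c') (at (snd c p)) \<xi>))) (at (snd c p))"
    using has_derivative_compose[OF transition_has_derivative[of c c' p]]
      transition_has_derivative[of c' c'' p] c p by (simp add: transition_chart)
  moreover have "open ?W" by (rule open_chart_image_of) (auto intro!: open_Int open_chart_domain c)
  moreover have "snd c p \<in> ?W" using p by auto
  moreover have "transition c' c'' (transition c c' x) = transition c c'' x" if "x \<in> ?W" for x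
    using that c by (auto simp: transition_chart)
  ultimately have "(transition c c'' has_derivative
     (\<lambda>\<xi>. frechet_derivative (transition c' c'') (at (transition c c' (snd c p)))
      (frechet_derivative (transition c c') (at (snd c p)) \<xi>))) (at (snd c p))"
    by (rule has_derivative_transform_within_open)
  then show ?thesis using c p by (simp add: frechet_derivative_at[symmetric] transition_chart)
qed

lemma transition_derivative_refl:
  assumes c: "c \<in> A" and p: "p \<in> fst c"
  shows "frechet_derivative (transition c c) (at (snd c p)) \<xi> = \<xi>"
proof -
  have "(transition c c has_derivative (\<lambda>\<xi>. \<xi>)) (at (snd c p))"
  proof (rule has_derivative_transform_within_open[OF has_derivative_ident open_chart_image[OF c]])
    show "snd c p \<in> snd c ` fst c" using p by simp
    show "x = transition c c x" if "x \<in> snd c ` fst c" for x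
      using that by (auto simp: transition_chart c)
  qed
  then show ?thesis by (simp add: frechet_derivative_at[symmetric])
qed

lemma coord_vector_self: "c \<in> A \<Longrightarrow> p \<in> fst c \<Longrightarrow> coord_vector A c p \<xi> c = \<xi>"
  by (simp add: coord_vector_def charts_at_def transition_derivative_refl)

lemma coord_vector_in_tangent_space: "c \<in> A \<Longrightarrow> p \<in> fst c \<Longrightarrow> coord_vector A c p \<xi> \<in> tangent_space A p"
  unfolding tangent_space_def
  by (intro CollectI conjI allI ballI impI)
    (simp add: coord_vector_def, simp add: coord_vector_def charts_at_def transition_derivative_trans)

lemma tangent_vector_eq_coord_vector:
  assumes "c \<in> A" "p \<in> fst c" "v \<in> tangent_space A p"
  shows "v = coord_vector A c p (v c)"
proof
  fix c'
  have "c \<in> charts_at A p" using assms by (simp add: charts_at_def)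
  then have "c' \<in> charts_at A p \<Longrightarrow> v c' = frechet_derivative (transition c c') (at (snd c p)) (v c)"
    using assms(3) unfolding tangent_space_def by blast
  moreover have "c' \<notin> charts_at A p \<Longrightarrow> v c' = 0"
    using assms(3) unfolding tangent_space_def by blast
  ultimately show "v c' = coord_vector A c p (v c) c'"
    unfolding coord_vector_def by (cases "c' \<in> charts_at A p") (simp_all only: if_True if_False simp_thms)
qed

lemma coord_vector_change:
  "c \<in> A \<Longrightarrow> c' \<in> A \<Longrightarrow> p \<in> fst c \<Longrightarrow> p \<in> fst c' \<Longrightarrow>
    coord_vector A c p \<xi> = coord_vector A c' p (frechet_derivative (transition c c') (at (snd c p)) \<xi>)"
  by (rule ext) (simp add: coord_vector_def charts_at_def transition_derivative_trans)

lemma coord_vector_linear: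
  assumes "c \<in> A" "p \<in> fst c"
  shows "coord_vector A c p (a *\<^sub>R \<xi> + b *\<^sub>R \<eta>) =
    (\<lambda>c'. a *\<^sub>R coord_vector A c p \<xi> c' + b *\<^sub>R coord_vector A c p \<eta> c')"
proof
  fix c'
  show "coord_vector A c p (a *\<^sub>R \<xi> + b *\<^sub>R \<eta>) c' =
      a *\<^sub>R coord_vector A c p \<xi> c' + b *\<^sub>R coord_vector A c p \<eta> c'"
  proof (cases "c' \<in> charts_at A p")
    case True
    then show ?thesis using linear_transition_derivative[of c c' p] assms
      by (simp add: coord_vector_def charts_at_def linear_add linear_scale)
  qed (simp add: coord_vector_def)
qed

end

locale riemannian_metric = closed_manifold A
  for A :: "('a::{t2_space,second_countable_topology}, 'n::{finite,wellorder}) chart set" +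
  fixes g :: "('a, 'n) metric"
  assumes metric: "continuous_riemannian_metric A g"
begin

lemma g_commute: "u \<in> tangent_space A p \<Longrightarrow> v \<in> tangent_space A p \<Longrightarrow> g p u v = g p v u"
  and g_linear: "u \<in> tangent_space A p \<Longrightarrow> v \<in> tangent_space A p \<Longrightarrow> w \<in> tangent_space A p \<Longrightarrow>
    g p (\<lambda>c. a *\<^sub>R u c + b *\<^sub>R v c) w = a * g p u w + b * g p v w"
  and g_pos: "v \<in> tangent_space A p \<Longrightarrow> v \<noteq> (\<lambda>c. 0) \<Longrightarrow> 0 < g p v v"
  using metric unfolding continuous_riemannian_metric_def pointwise_inner_def by blast+

lemma continuous_on_local_metric:
  "c \<in> A \<Longrightarrow> continuous_on (snd c ` fst c) (\<lambda>x. local_metric A g c x \<xi> \<eta>)"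
  using metric unfolding continuous_riemannian_metric_def by blast

lemma continuous_on_gram_matrix: "c \<in> A \<Longrightarrow> continuous_on (snd c ` fst c) (gram_matrix A g c)"
  unfolding gram_matrix_def by (intro continuous_on_vec_lambda continuous_on_local_metric)

text \<open>Bilinearity expands both arguments in the coordinate basis. From here on the metric is a
  matrix, to which the determinant estimates apply.\<close>

lemma
  assumes c: "c \<in> A" and x: "x \<in> snd c ` fst c"
  shows local_metric_eq_gram: "local_metric A g c x \<xi> \<eta> = \<xi> \<bullet> (gram_matrix A g c x *v \<eta>)"
    and pd_gram_matrix: "pd_matrix (gram_matrix A g c x)"
proof -
  let ?B = "local_metric A g c x" and ?p = "chart_inv c x"
  have p: "?p \<in> fst c" using chart_inv_in c x by blast
  have tan: "coord_vector A c ?p \<xi> \<in> tangent_space A ?p" for \<xi>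
    by (rule coord_vector_in_tangent_space[OF c p])
  have sym: "?B \<xi> \<eta> = ?B \<eta> \<xi>" for \<xi> \<eta> unfolding local_metric_def by (intro g_commute tan)
  have lin: "?B (a *\<^sub>R \<xi> + b *\<^sub>R \<eta>) \<zeta> = a * ?B \<xi> \<zeta> + b * ?B \<eta> \<zeta>" for a b \<xi> \<eta> \<zeta>
    unfolding local_metric_def coord_vector_linear[OF c p] by (intro g_linear tan)
  have l1: "linear (\<lambda>\<xi>. ?B \<xi> \<zeta>)" for \<zeta>
    using lin[of 1 _ 1 _ \<zeta>] lin[of _ _ 0 0 \<zeta>] by (intro linearI) auto
  have ex: "\<xi> = (\<Sum>i\<in>UNIV. \<xi> $ i *\<^sub>R axis i 1)" for \<xi> :: "(real, 'n) vec"
    using basis_expansion[of \<xi>] by (simp add: scalar_mult_eq_scaleR)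
  have B1: "?B \<xi> \<zeta> = (\<Sum>i\<in>UNIV. \<xi> $ i * ?B (axis i 1) \<zeta>)" for \<xi> \<zeta>
  proof -
    have "?B \<xi> \<zeta> = ?B (\<Sum>i\<in>UNIV. \<xi> $ i *\<^sub>R axis i 1) \<zeta>" by (simp flip: ex)
    also have "\<dots> = (\<Sum>i\<in>UNIV. \<xi> $ i * ?B (axis i 1) \<zeta>)"
      by (subst linear_sum[OF l1]) (simp add: linear_scale[OF l1])
    finally show ?thesis .
  qed
  show *: "?B \<xi> \<eta> = \<xi> \<bullet> (gram_matrix A g c x *v \<eta>)" for \<xi> \<eta>
  proof -
    have "?B (axis i 1) \<eta> = (\<Sum>j\<in>UNIV. \<eta> $ j * ?B (axis i 1) (axis j 1))" for i
      using B1[of \<eta> "axis i 1"] by (simp add: sym[of _ "axis i 1"])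
    then have "?B \<xi> \<eta> = (\<Sum>i\<in>UNIV. \<xi> $ i * (\<Sum>j\<in>UNIV. \<eta> $ j * ?B (axis i 1) (axis j 1)))"
      by (simp add: B1[of \<xi>])
    then show ?thesis
      by (simp add: gram_matrix_def inner_vec_def matrix_vector_mult_def mult_ac)
  qed
  have "0 < \<xi> \<bullet> (gram_matrix A g c x *v \<xi>)" if "\<xi> \<noteq> 0" for \<xi>
  proof -
    have "coord_vector A c ?p \<xi> \<noteq> (\<lambda>c. 0)"
      using coord_vector_self[OF c p, of \<xi>] that by auto
    from g_pos[OF tan this] show ?thesis unfolding *[symmetric] local_metric_def .
  qed
  moreover have "transpose (gram_matrix A g c x) = gram_matrix A g c x"
    by (simp add: transpose_def vec_eq_iff gram_matrix_def sym)
  ultimately show "pd_matrix (gram_matrix A g c x)" by (simp add: pd_matrix_def)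
qed

lemma metric_eq_gram:
  assumes "c \<in> A" "p \<in> fst c" "u \<in> tangent_space A p" "v \<in> tangent_space A p"
  shows "g p u v = u c \<bullet> (gram_matrix A g c (snd c p) *v v c)"
  using local_metric_eq_gram[of c "snd c p" "u c" "v c"] assms
    tangent_vector_eq_coord_vector[of c p u] tangent_vector_eq_coord_vector[of c p v]
  by (simp add: local_metric_def chart_inv_chart)

lemma gram_matrix_change:
  assumes c: "c \<in> A" "c' \<in> A" and p: "p \<in> fst c" "p \<in> fst c'"
  defines "D \<equiv> matrix (frechet_derivative (transition c c') (at (snd c p)))"
  shows "gram_matrix A g c (snd c p) = transpose D ** gram_matrix A g c' (snd c' p) ** D"
proof -
  have lin: "linear (frechet_derivative (transition c c') (at (snd c p)))"
    by (rule linear_transition_derivative[OF c p])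
  have D: "D *v \<xi> = frechet_derivative (transition c c') (at (snd c p)) \<xi>" for \<xi>
    unfolding D_def using lin by simp
  have "\<xi> \<bullet> (gram_matrix A g c (snd c p) *v \<eta>) = \<xi> \<bullet> ((transpose D ** gram_matrix A g c' (snd c' p) ** D) *v \<eta>)"
    for \<xi> \<eta>
  proof -
    have "\<xi> \<bullet> (gram_matrix A g c (snd c p) *v \<eta>) = (D *v \<xi>) \<bullet> (gram_matrix A g c' (snd c' p) *v (D *v \<eta>))"
      using local_metric_eq_gram[of c "snd c p" \<xi> \<eta>]
        local_metric_eq_gram[of c' "snd c' p" "D *v \<xi>" "D *v \<eta>"] c p
        coord_vector_change[OF c p]
      by (simp add: local_metric_def chart_inv_chart D)
    also have "\<dots> = \<xi> \<bullet> (transpose D *v (gram_matrix A g c' (snd c' p) *v (D *v \<eta>)))"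
      by (metis dot_lmul_matrix transpose_transpose transpose_matrix_vector)
    finally show ?thesis by (simp add: matrix_vector_mul_assoc matrix_mul_assoc)
  qed
  then show ?thesis unfolding matrix_eq using vector_eq_ldot by blast
qed

lemma continuous_on_vol_density: "c \<in> A \<Longrightarrow> continuous_on (snd c ` fst c) (vol_density A g c)"
  unfolding vol_density_def
  by (intro continuous_on_real_sqrt continuous_on_det continuous_on_gram_matrix)

lemma vol_density_pos: "c \<in> A \<Longrightarrow> x \<in> snd c ` fst c \<Longrightarrow> 0 < vol_density A g c x"
  unfolding vol_density_def using pd_det_pos[OF pd_gram_matrix] by simp

text \<open>Congruence of the Gram matrices multiplies the determinant by the square of the Jacobian
  determinant; the square root leaves its absolute value, the factor in the change of variables
  formula.\<close>

lemma vol_density_change: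
  assumes c: "c \<in> A" "c' \<in> A" and p: "p \<in> fst c" "p \<in> fst c'"
  shows "vol_density A g c (snd c p) =
    \<bar>det (matrix (frechet_derivative (transition c c') (at (snd c p))))\<bar> * vol_density A g c' (snd c' p)"
  unfolding vol_density_def gram_matrix_change[OF assms]
  by (simp add: det_mul real_sqrt_mult power2_eq_square[symmetric] mult.commute mult.left_commute)

end

subsection \<open>The Riemannian volume\<close>

lemma continuous_on_preimage_borel:
  assumes "continuous_on S f" "open S" "B \<in> sets borel"
  shows "S \<inter> f -` B \<in> sets borel"
proof -
  have "f \<in> borel_measurable (restrict_space borel S)"
    by (rule borel_measurable_continuous_on_restrict[OF assms(1)])
  from measurable_sets[OF this assms(3)]
  have "f -` B \<inter> S \<in> sets (restrict_space borel S)" by (simp add: space_restrict_space)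
  then show ?thesis
    using assms(2) by (subst (asm) sets_restrict_space_iff) (auto simp: Int_commute)
qed

lemma suminf_commute_ennreal:
  fixes f :: "nat \<Rightarrow> nat \<Rightarrow> ennreal"
  shows "(\<Sum>i. \<Sum>k. f i k) = (\<Sum>k. \<Sum>i. f i k)"
proof -
  have "(\<Sum>i. \<Sum>k. f i k) = (\<Sum>i. \<integral>\<^sup>+k. f i k \<partial>count_space UNIV)"
    by (simp add: nn_integral_count_space_nat)
  also have "\<dots> = (\<integral>\<^sup>+k. (\<Sum>i. f i k) \<partial>count_space UNIV)"
    by (rule nn_integral_suminf[symmetric]) simp
  finally show ?thesis by (simp add: nn_integral_count_space_nat)
qed

section \<open>A Borel partition subordinate to the charts\<close>

context closed_manifold
begin

lemma chart_image_borel: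
  assumes "c \<in> A" "B \<in> sets borel" "B \<subseteq> fst c"
  shows "snd c ` B \<in> sets borel"
  unfolding chart_image_eq[OF assms(1,3)] using assms(1,2)
  by (intro continuous_on_preimage_borel continuous_on_chart_inv open_chart_image)

lemma chart_domain_borel: "c \<in> A \<Longrightarrow> fst c \<in> sets borel"
  by (intro borel_open open_chart_domain)

lemma finite_subatlas: obtains F where "finite F" "F \<subseteq> A" "(\<Union>c\<in>F. fst c) = UNIV"
proof -
  have "\<exists>F\<subseteq>A. finite F \<and> UNIV \<subseteq> (\<Union>c\<in>F. fst c)"
  proof (rule compactE_image[OF compact_space])
    show "open (fst c)" if "c \<in> A" for c using that open_chart_domain by blast
    show "UNIV \<subseteq> (\<Union>c\<in>A. fst c)" using chart_at by blast
  qed blast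
  then show thesis using that by blast
qed

text \<open>A finite subatlas is enumerated with repetitions, because \<open>disjointed\<close> acts
  on sequences.\<close>

lemma ex_countable_charts: "\<exists>cs :: nat \<Rightarrow> ('a, 'n) chart. (\<forall>k. cs k \<in> A) \<and> (\<Union>k. fst (cs k)) = UNIV"
proof -
  obtain F where F: "finite F" "F \<subseteq> A" "(\<Union>c\<in>F. fst c) = UNIV" using finite_subatlas .
  have ne: "F \<noteq> {}" using F(3) by auto
  have "range (from_nat_into F) = F"
    using range_from_nat_into[OF ne countable_finite[OF F(1)]] .
  then have "(\<Union>k. fst (from_nat_into F k)) = UNIV"
    using F(3) by (metis image_image)
  moreover have "from_nat_into F k \<in> A" for k using from_nat_into[OF ne] F(2) by blast
  ultimately show ?thesis by (intro exI[of _ "from_nat_into F"] conjI allI)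
qed

definition cover :: "nat \<Rightarrow> ('a, 'n) chart" where
  "cover = (SOME cs. (\<forall>k. cs k \<in> A) \<and> (\<Union>k. fst (cs k)) = UNIV)"

lemma cover_in: "cover k \<in> A" and cover_UN: "(\<Union>k. fst (cover k)) = UNIV"
proof -
  from someI_ex[OF ex_countable_charts] show "cover k \<in> A" "(\<Union>k. fst (cover k)) = UNIV"
    unfolding cover_def by auto
qed

definition piece :: "nat \<Rightarrow> 'a set" where
  "piece = disjointed (\<lambda>k. fst (cover k))"

lemma piece_subset: "piece k \<subseteq> fst (cover k)"
  and piece_UN: "(\<Union>k. piece k) = UNIV"
  and disjoint_pieces: "disjoint_family piece"
  and piece_borel: "piece k \<in> sets borel"
proof -
  show "piece k \<subseteq> fst (cover k)" unfolding piece_def by (rule disjointed_subset)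
  show "(\<Union>k. piece k) = UNIV" unfolding piece_def UN_disjointed_eq by (rule cover_UN)
  show "disjoint_family piece" unfolding piece_def by (rule disjoint_family_disjointed)
  have "range (\<lambda>k. fst (cover k)) \<subseteq> sets borel"
    by (intro image_subsetI chart_domain_borel cover_in)
  then show "piece k \<in> sets borel" unfolding piece_def
    using sets.range_disjointed_sets by blast
qed

end

section \<open>Existence, uniqueness, finiteness and null sets of the volume\<close>

context riemannian_metric
begin

lemma vol_density_measurable:
  assumes "c \<in> A" "S \<in> sets borel" "S \<subseteq> snd c ` fst c"
  shows "(\<lambda>x. indicator S x * vol_density A g c x) \<in> borel_measurable borel"
  using borel_measurable_continuous_on_indicator[OF assms(2)
      continuous_on_subset[OF continuous_on_vol_density[OF assms(1)] assms(3)]]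
  by simp

lemma vol_density_measurable_ennreal:
  assumes "c \<in> A" "S \<in> sets borel" "S \<subseteq> snd c ` fst c"
  shows "(\<lambda>x. ennreal (vol_density A g c x) * indicator S x) \<in> borel_measurable lborel"
proof -
  have "(\<lambda>x. ennreal (vol_density A g c x) * indicator S x) =
      (\<lambda>x. ennreal (indicator S x * vol_density A g c x))"
    by (auto simp: indicator_def)
  then show ?thesis using vol_density_measurable[OF assms] by simp
qed

lemma chart_vol_change:
  assumes c: "c \<in> A" "c' \<in> A" and B: "B \<in> sets borel" "B \<subseteq> fst c" "B \<subseteq> fst c'"
  shows "chart_vol A g c B = chart_vol A g c' B"
proof -
  let ?\<psi> = "transition c c'"
  let ?D = "\<lambda>x. frechet_derivative ?\<psi> (at x)"
  have im: "?\<psi> ` (snd c ` B) = snd c' ` B"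
    using B by (force simp: image_image transition_chart[OF c])
  have dens: "\<bar>det (matrix (?D x))\<bar> * vol_density A g c' (?\<psi> x) = vol_density A g c x" if "x \<in> snd c ` B" for x
    using that B vol_density_change[OF c] transition_chart[OF c] by (auto simp: subset_iff)
  have inj: "inj_on ?\<psi> (snd c ` B)"
    using B inj_on_subset[OF inj_on_chart[OF c(2)] B(3)]
    by (auto simp: inj_on_def transition_chart[OF c] subset_iff)
  have der: "(?\<psi> has_derivative ?D x) (at x)" if "x \<in> snd c ` B" for x
    using that B transition_has_derivative[OF c] by (auto simp: subset_iff)
  have m1: "(\<lambda>y. indicator (?\<psi> ` (snd c ` B)) y * vol_density A g c' y) \<in> borel_measurable borel"
    unfolding im using B by (intro vol_density_measurable chart_image_borel c image_mono) auto
  have "(\<lambda>x. indicator (snd c ` B) x * (\<bar>det (matrix (?D x))\<bar> * vol_density A g c' (?\<psi> x))) =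
     (\<lambda>x. indicator (snd c ` B) x * vol_density A g c x)"
    using dens by (auto simp: indicator_def)
  moreover have "(\<lambda>x. indicator (snd c ` B) x * vol_density A g c x) \<in> borel_measurable borel"
    using B by (intro vol_density_measurable chart_image_borel c image_mono) auto
  ultimately have m2: "(\<lambda>x. indicator (snd c ` B) x * (\<bar>det (matrix (?D x))\<bar> * vol_density A g c' (?\<psi> x)))
    \<in> borel_measurable borel" by simp
  have nn: "0 \<le> vol_density A g c' y" if "y \<in> ?\<psi> ` (snd c ` B)" for y
    using that B(3) vol_density_pos[OF c(2), of y] unfolding im by fastforce
  have "chart_vol A g c' B =
    (\<integral>\<^sup>+x\<in>snd c ` B. ennreal (\<bar>det (matrix (?D x))\<bar> * vol_density A g c' (?\<psi> x)) \<partial>lborel)"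
    unfolding chart_vol_def im[symmetric]
    by (rule nn_integral_change_of_variables[OF chart_image_borel[OF c(1) B(1,2)] der inj m1 m2 nn])
  also have "\<dots> = chart_vol A g c B"
    unfolding chart_vol_def by (intro nn_integral_cong) (auto simp: indicator_def dens)
  finally show ?thesis by simp
qed

text \<open>Injectivity of the chart keeps the images disjoint, so countable additivity passes to
  coordinates.\<close>

lemma chart_vol_suminf:
  assumes c: "c \<in> A" and B: "\<And>i. B i \<in> sets borel" "\<And>i. B i \<subseteq> fst c" and disj: "disjoint_family B"
  shows "(\<Sum>i. chart_vol A g c (B i)) = chart_vol A g c (\<Union>i. B i)"
proof -
  have disj': "disjoint_family (\<lambda>i. snd c ` B i)"
    using disj B(2) inj_on_chart[OF c] unfolding disjoint_family_on_def inj_on_def by blast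
  have "(\<Sum>i. chart_vol A g c (B i)) =
     (\<integral>\<^sup>+x. (\<Sum>i. ennreal (vol_density A g c x) * indicator (snd c ` B i) x) \<partial>lborel)"
    unfolding chart_vol_def
    by (rule nn_integral_suminf[symmetric])
      (use c B in \<open>intro vol_density_measurable_ennreal chart_image_borel image_mono\<close>)
  also have "\<dots> = chart_vol A g c (\<Union>i. B i)"
    unfolding chart_vol_def image_UN
    by (intro nn_integral_cong) (simp add: suminf_indicator[OF disj'])
  finally show ?thesis .
qed

text \<open>The predicate under the \<open>THE\<close> of \<open>riem_volume\<close>, isolated so
  that existence and uniqueness can be proved for it.\<close>

definition is_volume :: "'a measure \<Rightarrow> bool" where
  "is_volume \<mu> \<longleftrightarrow> sets \<mu> = sets borel \<and>
     (\<forall>c\<in>A. \<forall>B\<in>sets borel. B \<subseteq> fst c \<longrightarrow> emeasure \<mu> B = chart_vol A g c B)"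

text \<open>Every Borel set is a disjoint union of sets that lie in single charts, where the value
  is prescribed. This yields uniqueness, and the right-hand side is the formula that defines the
  measure in the existence proof.\<close>

lemma is_volume_emeasure:
  assumes \<mu>: "is_volume \<mu>" and B: "B \<in> sets borel"
  shows "emeasure \<mu> B = (\<Sum>k. chart_vol A g (cover k) (B \<inter> piece k))"
proof -
  have "(\<Sum>k. emeasure \<mu> (B \<inter> piece k)) = emeasure \<mu> (\<Union>k. B \<inter> piece k)"
  proof (rule suminf_emeasure)
    show "range (\<lambda>k. B \<inter> piece k) \<subseteq> sets \<mu>"
      using \<mu> B piece_borel by (auto simp: is_volume_def)
    show "disjoint_family (\<lambda>k. B \<inter> piece k)"
      using disjoint_pieces by (auto simp: disjoint_family_on_def)
  qed
  moreover have "(\<Union>k. B \<inter> piece k) = B" using piece_UN by blast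
  moreover have "emeasure \<mu> (B \<inter> piece k) = chart_vol A g (cover k) (B \<inter> piece k)" for k
    using \<mu> B cover_in piece_borel piece_subset unfolding is_volume_def by blast
  ultimately show ?thesis by simp
qed

text \<open>The measure is glued together over the partition. By \<open>chart_vol_change\<close> the
  pieces of a set inside some chart \<open>c\<close> may all be evaluated in \<open>c\<close>
  instead of in the charts that come with the pieces.\<close>

lemma ex_volume: "\<exists>\<mu>. is_volume \<mu>"
proof -
  define \<mu>' where "\<mu>' = (\<lambda>B. \<Sum>k. chart_vol A g (cover k) (B \<inter> piece k))"
  define \<mu> where "\<mu> = measure_of UNIV (sets borel) \<mu>'"
  have sets: "sets \<mu> = sets borel"
    unfolding \<mu>_def using sets.sets_measure_of_eq[of "borel :: 'a measure" \<mu>'] by simp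
  have em: "emeasure \<mu> B = \<mu>' B" if "B \<in> sets borel" for B
  proof (rule emeasure_measure_of[OF \<mu>_def])
    show "positive (sets \<mu>) \<mu>'"
      by (auto simp: positive_def \<mu>'_def chart_vol_def)
    show "countably_additive (sets \<mu>) \<mu>'"
    proof (rule countably_additiveI)
      fix B :: "nat \<Rightarrow> 'a set"
      assume B: "range B \<subseteq> sets \<mu>" and disj: "disjoint_family B"
      have "(\<Sum>i. \<mu>' (B i)) = (\<Sum>k. \<Sum>i. chart_vol A g (cover k) (B i \<inter> piece k))"
        unfolding \<mu>'_def by (rule suminf_commute_ennreal)
      also have "\<dots> = (\<Sum>k. chart_vol A g (cover k) (\<Union>i. B i \<inter> piece k))"
      proof (intro suminf_cong chart_vol_suminf cover_in)
        show "B i \<inter> piece k \<in> sets borel" for i k using B piece_borel sets by blast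
        show "B i \<inter> piece k \<subseteq> fst (cover k)" for i k using piece_subset by blast
        show "disjoint_family (\<lambda>i. B i \<inter> piece k)" for k using disj by (auto simp: disjoint_family_on_def)
      qed
      finally show "(\<Sum>i. \<mu>' (B i)) = \<mu>' (\<Union>i. B i)" by (simp add: \<mu>'_def)
    qed
  qed (use that sets in auto)
  have "emeasure \<mu> B = chart_vol A g c B" if c: "c \<in> A" and B: "B \<in> sets borel" "B \<subseteq> fst c" for c B
  proof -
    have "emeasure \<mu> B = (\<Sum>k. chart_vol A g c (B \<inter> piece k))"
      unfolding em[OF B(1)] \<mu>'_def
    proof (intro suminf_cong chart_vol_change cover_in c)
      show "B \<inter> piece k \<in> sets borel" for k using B piece_borel by blast
      show "B \<inter> piece k \<subseteq> fst (cover k)" "B \<inter> piece k \<subseteq> fst c" for k using piece_subset B by blast+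
    qed
    also have "\<dots> = chart_vol A g c (\<Union>k. B \<inter> piece k)"
    proof (intro chart_vol_suminf c)
      show "disjoint_family (\<lambda>k. B \<inter> piece k)"
        using disjoint_pieces unfolding disjoint_family_on_def by blast
    qed (use B piece_borel in auto)
    also have "(\<Union>k. B \<inter> piece k) = B" using piece_UN by blast
    finally show ?thesis .
  qed
  then show ?thesis using sets is_volume_def by blast
qed

abbreviation "V \<equiv> riem_volume A g"

lemma is_volume_V: "is_volume V"
proof -
  have "is_volume (THE \<mu>. is_volume \<mu>)"
  proof -
    obtain \<mu> where \<mu>: "is_volume \<mu>" using ex_volume ..
    show ?thesis
    proof (rule theI[where P = is_volume, OF \<mu>])
      fix \<nu> assume \<nu>: "is_volume \<nu>"
      show "\<nu> = \<mu>"
        by (rule measure_eqI) (use \<mu> \<nu> is_volume_emeasure in \<open>auto simp: is_volume_def\<close>)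
    qed
  qed
  then show ?thesis
    by (simp add: riem_volume_def is_volume_def[abs_def] chart_vol_def vol_density_def)
qed

lemma sets_V [measurable_cong]: "sets V = sets borel"
  using is_volume_V by (simp add: is_volume_def)

lemma space_V [simp]: "space V = UNIV"
  using sets_eq_imp_space_eq[OF sets_V] by simp

lemma emeasure_V_chart: "c \<in> A \<Longrightarrow> B \<in> sets borel \<Longrightarrow> B \<subseteq> fst c \<Longrightarrow> emeasure V B = chart_vol A g c B"
  using is_volume_V by (simp add: is_volume_def)

lemma emeasure_V: "B \<in> sets borel \<Longrightarrow> emeasure V B = (\<Sum>k. chart_vol A g (cover k) (B \<inter> piece k))"
  by (rule is_volume_emeasure[OF is_volume_V])

text \<open>The density may be unbounded on a whole chart, so compactness is applied to
  neighbourhoods that lie inside closed coordinate balls.\<close>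

lemma finite_measure_V: "finite_measure V"
proof -
  have "\<exists>W. open W \<and> p \<in> W \<and> emeasure V W < \<infinity>" for p
  proof -
    obtain c where c: "c \<in> A" "p \<in> fst c" using chart_at .
    obtain r where r: "0 < r" "cball (snd c p) r \<subseteq> snd c ` fst c"
      using open_contains_cball open_chart_image[OF c(1)] c(2) by blast
    define W where "W = fst c \<inter> snd c -` ball (snd c p) r"
    have W: "open W" "p \<in> W" unfolding W_def using c r
      by (auto intro: continuous_open_preimage continuous_on_chart open_chart_domain)
    have sub: "snd c ` W \<subseteq> cball (snd c p) r" unfolding W_def by auto
    have "bounded (vol_density A g c ` cball (snd c p) r)"
      by (intro compact_imp_bounded compact_continuous_image
          continuous_on_subset[OF continuous_on_vol_density[OF c(1)] r(2)] compact_cball)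
    then obtain K where "\<forall>y\<in>vol_density A g c ` cball (snd c p) r. norm y \<le> K"
      unfolding bounded_iff by blast
    then have K: "\<And>x. x \<in> cball (snd c p) r \<Longrightarrow> \<bar>vol_density A g c x\<bar> \<le> K"
      by (metis imageI real_norm_def)
    have "emeasure V W = chart_vol A g c W"
      using W by (intro emeasure_V_chart c) (auto simp: W_def)
    also have "\<dots> \<le> (\<integral>\<^sup>+x. ennreal K * indicator (cball (snd c p) r) x \<partial>lborel)"
      unfolding chart_vol_def using sub K
      by (intro nn_integral_mono) (fastforce simp: indicator_def intro!: ennreal_leI)
    also have "\<dots> = ennreal K * emeasure lborel (cball (snd c p) r)"
      by (rule nn_integral_cmult_indicator) simp
    also have "\<dots> < \<infinity>"
      using emeasure_lborel_cball_finite[of "snd c p" r] by (simp add: ennreal_mult_less_top)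
    finally show ?thesis using W by blast
  qed
  then obtain W where W: "\<And>p. open (W p)" "\<And>p. p \<in> W p" "\<And>p. emeasure V (W p) < \<infinity>" by metis
  obtain F where F: "finite F" "UNIV \<subseteq> (\<Union>p\<in>F. W p)"
  proof (rule compactE_image[OF compact_space])
    show "open (W p)" if "p \<in> UNIV" for p by (rule W)
    show "UNIV \<subseteq> (\<Union>p\<in>UNIV. W p)" using W(2) by blast
  qed
  have "emeasure V UNIV \<le> emeasure V (\<Union>p\<in>F. W p)"
    using F W(1) by (intro emeasure_mono) (auto simp: sets_V)
  also have "\<dots> \<le> (\<Sum>p\<in>F. emeasure V (W p))"
    using F W(1) by (intro emeasure_subadditive_finite) (auto simp: sets_V)
  also have "\<dots> < \<infinity>" using F(1) W(3) by (simp add: less_top[symmetric])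
  finally show ?thesis by (intro finite_measureI) simp
qed

lemma emeasure_V_eq_0:
  assumes c: "c \<in> A" and B: "B \<in> sets borel" "B \<subseteq> fst c"
  shows "emeasure V B = 0 \<longleftrightarrow> emeasure lborel (snd c ` B) = 0"
proof -
  let ?u = "\<lambda>x. ennreal (vol_density A g c x) * indicator (snd c ` B) x"
  have m: "?u \<in> borel_measurable lborel"
    using c B by (intro vol_density_measurable_ennreal chart_image_borel image_mono)
  have "{x \<in> space lborel. ?u x \<noteq> 0} = snd c ` B"
    using B(2) vol_density_pos[OF c] by (fastforce simp: indicator_def ennreal_eq_0_iff)
  then show ?thesis
    unfolding emeasure_V_chart[OF c B] chart_vol_def nn_integral_0_iff[OF m] by simp
qed

text \<open>Positivity of the density identifies the null sets. Both directions are used later: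
  Fubini takes place in coordinates and yields statements on the manifold, while vertices are picked
  in coordinates subject to conditions on the manifold.\<close>

lemma AE_V_chart:
  assumes c: "c \<in> A"
  shows "(AE p in V. p \<in> fst c \<longrightarrow> P (snd c p)) \<longleftrightarrow> (AE x in lborel. x \<in> snd c ` fst c \<longrightarrow> P x)"
proof
  assume "AE p in V. p \<in> fst c \<longrightarrow> P (snd c p)"
  then obtain N where N: "{p \<in> space V. \<not> (p \<in> fst c \<longrightarrow> P (snd c p))} \<subseteq> N" "emeasure V N = 0" "N \<in> sets V"
    by (rule AE_E)
  have N': "N \<inter> fst c \<in> sets borel" using N(3) chart_domain_borel[OF c] by (auto simp: sets_V)
  have "emeasure V (N \<inter> fst c) \<le> emeasure V N" using N(3) by (intro emeasure_mono) auto
  then have "emeasure lborel (snd c ` (N \<inter> fst c)) = 0"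
    using emeasure_V_eq_0[OF c N'] N(2) by simp
  then show "AE x in lborel. x \<in> snd c ` fst c \<longrightarrow> P x"
    using N(1) chart_image_borel[OF c N']
    by (intro AE_I[where N = "snd c ` (N \<inter> fst c)"]) auto
next
  assume "AE x in lborel. x \<in> snd c ` fst c \<longrightarrow> P x"
  then obtain N where N: "{x \<in> space lborel. \<not> (x \<in> snd c ` fst c \<longrightarrow> P x)} \<subseteq> N"
      "emeasure lborel N = 0" "N \<in> sets lborel"
    by (rule AE_E)
  let ?B = "fst c \<inter> snd c -` N"
  have B: "?B \<in> sets borel"
    using N(3) by (intro continuous_on_preimage_borel continuous_on_chart open_chart_domain c) auto
  have "emeasure lborel (snd c ` ?B) \<le> emeasure lborel N"
    using N(3) by (intro emeasure_mono) auto
  then have "emeasure V ?B = 0" using emeasure_V_eq_0[OF c B] N(2) by simp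
  then show "AE p in V. p \<in> fst c \<longrightarrow> P (snd c p)"
    using N(1) B by (intro AE_I[where N = ?B]) (auto simp: sets_V)
qed

end

subsection \<open>Comparison of two metrics\<close>

locale metric_above = base: riemannian_metric A g0 + riemannian_metric A g
  for A :: "('a::{t2_space,second_countable_topology}, 'n::{finite,wellorder}) chart set"
    and g0 g :: "('a, 'n) metric" +
  assumes metric_le: "v \<in> tangent_space A p \<Longrightarrow> g0 p v v \<le> g p v v"
begin

text \<open>The square roots of \<open>det_mono\<close> and \<open>det_ratio_bound\<close>; the
  second is the bound of the \<open>g\<close>-norm by the density ratio times the
  \<open>g0\<close>-norm, written without a division.\<close>

lemma
  assumes c: "c \<in> A" and x: "x \<in> snd c ` fst c"
  shows vol_density_le: "vol_density A g0 c x \<le> vol_density A g c x"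
    and norm_le_density_ratio: "vol_density A g0 c x * sqrt (v \<bullet> (gram_matrix A g c x *v v))
      \<le> vol_density A g c x * sqrt (v \<bullet> (gram_matrix A g0 c x *v v))"
proof -
  have le: "v \<bullet> (gram_matrix A g0 c x *v v) \<le> v \<bullet> (gram_matrix A g c x *v v)" for v
    unfolding local_metric_eq_gram[OF c x, symmetric] base.local_metric_eq_gram[OF c x, symmetric]
      local_metric_def
    by (intro metric_le base.coord_vector_in_tangent_space c base.chart_inv_in x)
  note pd = pd_gram_matrix[OF c x] base.pd_gram_matrix[OF c x]
  show "vol_density A g0 c x \<le> vol_density A g c x"
    unfolding vol_density_def using det_mono[OF pd le] by simp
  show "vol_density A g0 c x * sqrt (v \<bullet> (gram_matrix A g c x *v v))
      \<le> vol_density A g c x * sqrt (v \<bullet> (gram_matrix A g0 c x *v v))"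
    unfolding vol_density_def real_sqrt_mult[symmetric] using det_ratio_bound[OF pd le] by simp
qed

lemma chart_vol_le: "c \<in> A \<Longrightarrow> B \<subseteq> fst c \<Longrightarrow> chart_vol A g0 c B \<le> chart_vol A g c B"
  unfolding chart_vol_def
  by (intro nn_integral_mono) (auto simp: indicator_def intro!: ennreal_leI vol_density_le)

lemma volume_le: "B \<in> sets borel \<Longrightarrow> emeasure (riem_volume A g0) B \<le> emeasure (riem_volume A g) B"
  unfolding emeasure_V base.emeasure_V
  by (intro suminf_le chart_vol_le base.cover_in) (use base.piece_subset in auto)

text \<open>Outside the chart the volume cannot decrease either, so the excess inside the chart is
  at most the total excess.\<close>

lemma nn_integral_density_diff_le:
  assumes c: "c \<in> A"
  shows "(\<integral>\<^sup>+x\<in>snd c ` fst c. ennreal (vol_density A g c x - vol_density A g0 c x) \<partial>lborel)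
    \<le> emeasure (riem_volume A g) UNIV - emeasure (riem_volume A g0) UNIV"
proof -
  let ?S = "snd c ` fst c" and ?V = "riem_volume A g" and ?W = "riem_volume A g0"
  let ?I = "\<integral>\<^sup>+x\<in>?S. ennreal (vol_density A g c x - vol_density A g0 c x) \<partial>lborel"
  have S: "?S \<in> sets borel" using base.open_chart_image[OF c] by simp
  have B: "fst c \<in> sets borel" using base.chart_domain_borel[OF c] .
  have eq: "(\<lambda>x. ennreal (vol_density A g c x - vol_density A g0 c x) * indicator ?S x) =
     (\<lambda>x. ennreal (indicator ?S x * vol_density A g c x - indicator ?S x * vol_density A g0 c x))"
    by (auto simp: indicator_def)
  have m: "(\<lambda>x. ennreal (vol_density A g c x - vol_density A g0 c x) * indicator ?S x) \<in> borel_measurable lborel"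
    unfolding eq using vol_density_measurable[OF c S] base.vol_density_measurable[OF c S] by simp
  have m0: "(\<lambda>x. ennreal (vol_density A g0 c x) * indicator ?S x) \<in> borel_measurable lborel"
    by (rule base.vol_density_measurable_ennreal[OF c S]) simp
  have "emeasure ?W (fst c) + ?I = (\<integral>\<^sup>+x. ennreal (vol_density A g0 c x) * indicator ?S x
     + ennreal (vol_density A g c x - vol_density A g0 c x) * indicator ?S x \<partial>lborel)"
    unfolding base.emeasure_V_chart[OF c B order_refl] chart_vol_def
    by (rule nn_integral_add[symmetric, OF m0 m])
  also have "\<dots> = emeasure ?V (fst c)"
    unfolding emeasure_V_chart[OF c B order_refl] chart_vol_def
  proof (intro nn_integral_cong)
    fix x
    show "ennreal (vol_density A g0 c x) * indicator ?S x
     + ennreal (vol_density A g c x - vol_density A g0 c x) * indicator ?S x =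
      ennreal (vol_density A g c x) * indicator ?S x"
      using vol_density_le[OF c] base.vol_density_pos[OF c, of x]
      by (cases "x \<in> ?S") (simp_all flip: ennreal_plus)
  qed
  finally have 1: "emeasure ?W (fst c) + ?I = emeasure ?V (fst c)" .
  have split: "emeasure ?W (fst c) + emeasure ?W (- fst c) = emeasure ?W UNIV"
    "emeasure ?V (fst c) + emeasure ?V (- fst c) = emeasure ?V UNIV"
    using B by (subst plus_emeasure; auto simp: sets_V base.sets_V)+
  have "emeasure ?W UNIV + ?I = emeasure ?V (fst c) + emeasure ?W (- fst c)"
    unfolding split(1)[symmetric] 1[symmetric] by (simp add: ac_simps)
  also have "\<dots> \<le> emeasure ?V UNIV"
    unfolding split(2)[symmetric] using B by (intro add_left_mono volume_le) auto
  \<comment> \<open>The subtraction on the left cancels because the volume of \<open>g0\<close> is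
    finite.\<close>
  finally have "emeasure ?W UNIV + ?I - emeasure ?W UNIV \<le> emeasure ?V UNIV - emeasure ?W UNIV"
    by (rule ennreal_minus_mono) simp
  moreover have "emeasure ?W UNIV \<noteq> top"
    using base.finite_measure_V finite_measure.emeasure_finite by fastforce
  ultimately show ?thesis by simp
qed

end

subsection \<open>Lengths of piecewise smooth curves\<close>

lemma subdivision_find:
  fixes t :: "nat \<Rightarrow> real"
  assumes "t 0 \<le> s" "s \<le> t m" "0 < m"
  shows "\<exists>i<m. t i \<le> s \<and> s \<le> t (Suc i)"
  using assms(2,3)
proof (induction m)
  case (Suc m)
  show ?case
  proof (cases "s \<le> t m \<and> 0 < m")
    case True
    then show ?thesis using Suc.IH less_Suc_eq by blast
  next
    case False
    then have "t m \<le> s" using assms(1) by (cases m) auto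
    then show ?thesis using Suc.prems by blast
  qed
qed simp

lemma subdivision_mono:
  fixes t :: "nat \<Rightarrow> real"
  assumes "\<forall>i<m. t i < t (Suc i)" "i \<le> j" "j \<le> m"
  shows "t i \<le> t j"
  using assms(2,3)
proof (induction j rule: dec_induct)
  case (step k)
  then show ?case using assms(1) by (smt (verit) Suc_le_lessD Suc_leD)
qed simp

lemma smooth_curve_on_cong:
  assumes "smooth_curve_on A a b C" "\<And>s. s \<in> {a..b} \<Longrightarrow> C s = C' s"
  shows "smooth_curve_on A a b C'"
proof -
  have "(\<forall>s\<in>{a..b}. \<gamma> s = C s) \<longleftrightarrow> (\<forall>s\<in>{a..b}. \<gamma> s = C' s)" for \<gamma>
    using assms(2) by simp
  then show ?thesis using assms(1) unfolding smooth_curve_on_def by simp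
qed

context closed_manifold
begin

lemma open_curve_preimage:
  "open I \<Longrightarrow> continuous_on I \<gamma> \<Longrightarrow> c \<in> A \<Longrightarrow> open {s\<in>I. \<gamma> s \<in> fst c}"
  using continuous_open_preimage[of I \<gamma> "fst c"] open_chart_domain[of c]
  by (simp add: vimage_def Int_def)

lemma smooth_curve_on_affine:
  assumes C: "smooth_curve_on A a b C" and e: "0 < e"
  shows "smooth_curve_on A ((a - d) / e) ((b - d) / e) (\<lambda>s. C (e * s + d))"
proof -
  obtain I \<gamma> where I: "open I" "{a..b} \<subseteq> I" "continuous_on I \<gamma>" "\<forall>s\<in>{a..b}. \<gamma> s = C s"
    and sm: "\<And>c. c \<in> A \<Longrightarrow> smooth_on {s\<in>I. \<gamma> s \<in> fst c} (snd c \<circ> \<gamma>)"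
    using C unfolding smooth_curve_on_def by blast
  define J where "J = (\<lambda>s. e * s + d) -` I"
  define \<delta> where "\<delta> = (\<lambda>s. \<gamma> (e * s + d))"
  have J: "open J" unfolding J_def by (intro open_vimage I continuous_intros)
  have ab: "e * s + d \<in> {a..b}" if "s \<in> {(a - d) / e..(b - d) / e}" for s
    using that e by (auto simp: field_simps)
  have \<delta>: "continuous_on J \<delta>"
    unfolding \<delta>_def J_def by (intro continuous_on_compose2[OF I(3)] continuous_intros) auto
  have "smooth_on {s\<in>J. \<delta> s \<in> fst c} (snd c \<circ> \<delta>)" if c: "c \<in> A" for c
  proof -
    have "smooth_on {s\<in>J. \<delta> s \<in> fst c} (\<lambda>s. (snd c \<circ> \<gamma>) (d + e * s))"
    proof (rule smooth_on_affine[OF bounded_linear_mult_right])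
      show "open {s\<in>J. \<delta> s \<in> fst c}" by (rule open_curve_preimage[OF J \<delta> c])
      show "smooth_on {s\<in>I. \<gamma> s \<in> fst c} (snd c \<circ> \<gamma>)" by (rule sm[OF c])
    qed (auto simp: J_def \<delta>_def add.commute)
    then show ?thesis by (simp add: \<delta>_def o_def add.commute)
  qed
  moreover have "{(a - d) / e..(b - d) / e} \<subseteq> J"
    unfolding J_def using ab I(2) by (meson subsetD subsetI vimageI2)
  moreover have "\<forall>s\<in>{(a - d) / e..(b - d) / e}. \<delta> s = C (e * s + d)"
    using ab I(4) by (auto simp: \<delta>_def)
  ultimately show ?thesis unfolding smooth_curve_on_def using J \<delta> by blast
qed

text \<open>The chain rule through the transition map, combined with uniqueness of derivatives,
  gives the transformation law of tangent vectors.\<close>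

lemma tangent_of_curve:
  assumes I: "open I" "continuous_on I \<gamma>" "s \<in> I"
    and w: "\<And>c. c \<in> A \<Longrightarrow> \<gamma> s \<in> fst c \<Longrightarrow> ((snd c \<circ> \<gamma>) has_vector_derivative w c) (at s)"
    and w0: "\<And>c. c \<notin> charts_at A (\<gamma> s) \<Longrightarrow> w c = 0"
  shows "w \<in> tangent_space A (\<gamma> s)"
  unfolding tangent_space_def
proof (intro CollectI conjI allI impI ballI w0)
  fix c c' assume "c \<in> charts_at A (\<gamma> s)" "c' \<in> charts_at A (\<gamma> s)"
  then have c: "c \<in> A" "c' \<in> A" "\<gamma> s \<in> fst c" "\<gamma> s \<in> fst c'" by (auto simp: charts_at_def)
  let ?D = "frechet_derivative (transition c c') (at (snd c (\<gamma> s)))"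
  have "((\<lambda>r. transition c c' ((snd c \<circ> \<gamma>) r)) has_derivative (\<lambda>h. ?D (h *\<^sub>R w c))) (at s)"
    using has_derivative_compose[of "snd c \<circ> \<gamma>" "\<lambda>h. h *\<^sub>R w c" s UNIV "transition c c'" ?D]
      w[OF c(1,3)] transition_has_derivative[OF c] by (simp add: has_vector_derivative_def)
  moreover have "open {r\<in>I. \<gamma> r \<in> fst c}" by (rule open_curve_preimage[OF I(1,2) c(1)])
  moreover have "s \<in> {r\<in>I. \<gamma> r \<in> fst c}" using I c by simp
  moreover have "transition c c' ((snd c \<circ> \<gamma>) r) = (snd c' \<circ> \<gamma>) r" if "r \<in> {r\<in>I. \<gamma> r \<in> fst c}" for r
    using that by (simp add: transition_chart c)
  ultimately have "((snd c' \<circ> \<gamma>) has_derivative (\<lambda>h. ?D (h *\<^sub>R w c))) (at s)"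
    by (rule has_derivative_transform_within_open)
  then have "(\<lambda>h. ?D (h *\<^sub>R w c)) = (\<lambda>h. h *\<^sub>R w c')"
    using w[OF c(2,4)] has_derivative_unique unfolding has_vector_derivative_def by blast
  from fun_cong[OF this, of 1] show "w c' = ?D (w c)" by simp
qed

lemma tangent_scale:
  assumes "v \<in> tangent_space A p"
  shows "(\<lambda>c. a *\<^sub>R v c) \<in> tangent_space A p"
proof -
  obtain c where c: "c \<in> A" "p \<in> fst c" using chart_at .
  have "coord_vector A c p (a *\<^sub>R v c) = (\<lambda>c'. a *\<^sub>R coord_vector A c p (v c) c')"
    using coord_vector_linear[OF c, of a "v c" 0 0] by simp
  also have "coord_vector A c p (v c) = v"
    using tangent_vector_eq_coord_vector[OF c assms] by (rule sym)
  finally show ?thesis using coord_vector_in_tangent_space[OF c] by metis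
qed

text \<open>At a breakpoint \<open>velocity\<close> need not be a tangent vector, and then nothing
  is known about the value of the metric on it. This predicate singles out the parameters where the
  velocity can be used; for a piecewise smooth curve only finitely many parameters in
  \<open>{0..1}\<close> are excluded.\<close>

definition regular_at :: "(real \<Rightarrow> 'a) \<Rightarrow> real \<Rightarrow> bool" where
  "regular_at C s \<longleftrightarrow> velocity A C s \<in> tangent_space A (C s) \<and>
     (\<forall>c\<in>A. C s \<in> fst c \<longrightarrow> ((snd c \<circ> C) has_vector_derivative velocity A C s c) (at s))"

lemma velocity_eq:
  assumes "0 < s" "s < 1" "c \<in> A" "C s \<in> fst c" "((snd c \<circ> C) has_vector_derivative w) (at s)"
  shows "velocity A C s c = w"
proof -
  have "vector_derivative (snd c \<circ> C) (at s within cbox 0 1) = w"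
    by (rule vector_derivative_within_cbox)
      (use assms(1,2) in \<open>simp_all add: has_vector_derivative_at_within[OF assms(5)]\<close>)
  moreover have "c \<in> charts_at A (C s)" using assms(3,4) by (simp add: charts_at_def)
  ultimately show ?thesis by (simp add: velocity_def)
qed

text \<open>On each smooth piece the curve may be replaced by its extension \<open>\<gamma>\<close>, which also covers the
  end points of the piece.\<close>

lemma smooth_curve_on_velocity:
  assumes I: "open I" "{a..b} \<subseteq> I" "continuous_on I \<gamma>" "\<forall>s\<in>{a..b}. \<gamma> s = C s"
    and sm: "\<And>c. c \<in> A \<Longrightarrow> smooth_on {s\<in>I. \<gamma> s \<in> fst c} (snd c \<circ> \<gamma>)"
    and ab: "{a..b} \<subseteq> {0..1}"
    and w: "\<And>s. w s = (\<lambda>c. if c \<in> charts_at A (\<gamma> s) then frechet_derivative (snd c \<circ> \<gamma>) (at s) 1 else 0)"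
  shows "s \<in> I \<Longrightarrow> w s \<in> tangent_space A (\<gamma> s)"
    and "s \<in> {a<..<b} \<Longrightarrow> velocity A C s = w s"
    and "s \<in> {a<..<b} \<Longrightarrow> regular_at C s"
proof -
  have der: "((snd c \<circ> \<gamma>) has_vector_derivative w s c) (at s)"
    if "s \<in> I" "c \<in> A" "\<gamma> s \<in> fst c" for s c
  proof -
    have "((snd c \<circ> \<gamma>) has_derivative frechet_derivative (snd c \<circ> \<gamma>) (at s)) (at s)"
      by (rule smooth_on_imp_has_derivative[OF sm[OF that(2)]]) (use that in simp)
    moreover have "frechet_derivative (snd c \<circ> \<gamma>) (at s) = (\<lambda>h. h *\<^sub>R w s c)"
    proof
      fix h :: real
      have "frechet_derivative (snd c \<circ> \<gamma>) (at s) (h *\<^sub>R 1) = h *\<^sub>R frechet_derivative (snd c \<circ> \<gamma>) (at s) 1"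
        by (rule linear_scale[OF has_derivative_linear[OF calculation]])
      moreover have "c \<in> charts_at A (\<gamma> s)" using that by (simp add: charts_at_def)
      ultimately show "frechet_derivative (snd c \<circ> \<gamma>) (at s) h = h *\<^sub>R w s c" by (simp add: w)
    qed
    ultimately show ?thesis by (simp add: has_vector_derivative_def)
  qed
  show tan: "w s \<in> tangent_space A (\<gamma> s)" if "s \<in> I" for s
  proof (rule tangent_of_curve[OF I(1,3) that])
    show "w s c = 0" if "c \<notin> charts_at A (\<gamma> s)" for c using that by (simp add: w)
  qed (rule der[OF that])
  have derC: "((snd c \<circ> C) has_vector_derivative w s c) (at s)"
    if s: "s \<in> {a<..<b}" and c: "c \<in> A" "C s \<in> fst c" for s c
  proof (rule has_vector_derivative_transform_within_open[OF der open_greaterThanLessThan s])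
    show "s \<in> I" "c \<in> A" "\<gamma> s \<in> fst c" using s c I by auto
    show "(snd c \<circ> \<gamma>) r = (snd c \<circ> C) r" if "r \<in> {a<..<b}" for r using that I(4) by simp
  qed
  show vel: "velocity A C s = w s" if s: "s \<in> {a<..<b}" for s
  proof
    fix c
    have "a \<in> {a..b}" "b \<in> {a..b}" using s by auto
    then have "a \<in> {0..1}" "b \<in> {0..1}" using ab by blast+
    then have s01: "0 < s" "s < 1" using s by auto
    have Cs: "C s = \<gamma> s" using s I(4) by simp
    show "velocity A C s c = w s c"
    proof (cases "c \<in> charts_at A (C s)")
      case True
      then have c: "c \<in> A" "C s \<in> fst c" by (simp_all add: charts_at_def)
      show ?thesis by (rule velocity_eq[OF s01 c derC[OF s c]])
    next
      case False
      then show ?thesis unfolding velocity_def w Cs by simp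
    qed
  qed
  show "regular_at C s" if s: "s \<in> {a<..<b}"
  proof -
    have Cs: "C s = \<gamma> s" and sI: "s \<in> I" using s I(2,4) by auto
    have "w s \<in> tangent_space A (C s)" unfolding Cs by (rule tan[OF sI])
    then show ?thesis unfolding regular_at_def vel[OF s] using derC[OF s] by blast
  qed
qed

text \<open>\<open>S\<close> consists of the breakpoints. Its containing 0 and 1 ensures that the
  remaining parameters are interior, where one-sided and two-sided derivatives need not be
  distinguished.\<close>

lemma piecewise_smooth_curve_regular:
  assumes "piecewise_smooth_curve A C"
  obtains S where "finite S" "0 \<in> S" "1 \<in> S" "\<And>s. s \<in> {0..1} - S \<Longrightarrow> regular_at C s"
proof -
  obtain m t where t: "t 0 = 0" "t m = 1"
    and sm: "\<forall>i<m. t i < t (Suc i) \<and> smooth_curve_on A (t i) (t (Suc i)) C"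
    using assms unfolding piecewise_smooth_curve_def by blast
  have m: "0 < m" using t by (cases m) auto
  have mono: "\<And>i j. i \<le> j \<Longrightarrow> j \<le> m \<Longrightarrow> t i \<le> t j"
    using subdivision_mono[of m t] sm by blast
  show thesis
  proof (rule that[of "t ` {..m}"])
    show "0 \<in> t ` {..m}" "1 \<in> t ` {..m}" using t by (metis atMost_iff imageI le0 order_refl)+
    fix s assume s: "s \<in> {0..1} - t ` {..m}"
    then obtain i where i: "i < m" "t i \<le> s" "s \<le> t (Suc i)"
      using subdivision_find[of t s m] t m by auto
    then have s': "s \<in> {t i<..<t (Suc i)}" using s by (force simp: less_le)
    have smC: "smooth_curve_on A (t i) (t (Suc i)) C" using sm i(1) by blast
    obtain I \<gamma> where I: "open I" "{t i..t (Suc i)} \<subseteq> I" "continuous_on I \<gamma>" "\<forall>s\<in>{t i..t (Suc i)}. \<gamma> s = C s"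
      and smo: "\<And>c. c \<in> A \<Longrightarrow> smooth_on {s\<in>I. \<gamma> s \<in> fst c} (snd c \<circ> \<gamma>)"
      using smC unfolding smooth_curve_on_def by blast
    have sub01: "{t i..t (Suc i)} \<subseteq> {0..1}"
      using mono[of 0 i] mono[of "Suc i" m] i(1) t by auto
    show "regular_at C s" by (rule smooth_curve_on_velocity(3)[OF I smo sub01 refl s'])
  qed simp
qed

end

context riemannian_metric
begin

definition speed :: "(real \<Rightarrow> 'a) \<Rightarrow> real \<Rightarrow> real" where
  "speed C s = sqrt (g (C s) (velocity A C s) (velocity A C s))"

lemma riem_length_eq: "riem_length A g C = integral {0..1} (speed C)"
  by (simp add: riem_length_def speed_def[abs_def])

lemma g_nonneg: "v \<in> tangent_space A p \<Longrightarrow> 0 \<le> g p v v"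
proof -
  assume v: "v \<in> tangent_space A p"
  obtain c where c: "c \<in> A" "p \<in> fst c" using chart_at .
  have "snd c p \<in> snd c ` fst c" using c by simp
  then show ?thesis unfolding metric_eq_gram[OF c v v]
    using pd_imp_psd[OF pd_gram_matrix[OF c(1)]] unfolding psd_matrix_def by blast
qed

lemma g_scale: "v \<in> tangent_space A p \<Longrightarrow> g p (\<lambda>c. a *\<^sub>R v c) (\<lambda>c. a *\<^sub>R v c) = a\<^sup>2 * g p v v"
  using g_linear[of v p v "\<lambda>c. a *\<^sub>R v c" a 0] g_linear[of v p v v a 0] g_commute[of v p "\<lambda>c. a *\<^sub>R v c"]
    tangent_scale[of v p a] by (simp add: power2_eq_square)

lemma speed_chart:
  assumes "regular_at C s" "c \<in> A" "C s \<in> fst c" "((snd c \<circ> C) has_vector_derivative w) (at s)"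
  shows "speed C s = sqrt (w \<bullet> (gram_matrix A g c (snd c (C s)) *v w))"
proof -
  have "velocity A C s c = w"
    using assms unfolding regular_at_def by (metis vector_derivative_unique_at)
  then show ?thesis
    using assms metric_eq_gram[OF assms(2,3)] unfolding speed_def regular_at_def by simp
qed

text \<open>The extension of the piece has a continuous speed, from which \<open>speed C\<close> can
  differ only at the two end points.\<close>

lemma speed_integrable_piece:
  assumes "smooth_curve_on A a b C" "{a..b} \<subseteq> {0..1}"
  shows "speed C integrable_on {a..b}"
proof -
  obtain I \<gamma> where I: "open I" "{a..b} \<subseteq> I" "continuous_on I \<gamma>" "\<forall>s\<in>{a..b}. \<gamma> s = C s"
    and smo: "\<And>c. c \<in> A \<Longrightarrow> smooth_on {s\<in>I. \<gamma> s \<in> fst c} (snd c \<circ> \<gamma>)"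
    using assms(1) unfolding smooth_curve_on_def by blast
  define w where "w s = (\<lambda>c. if c \<in> charts_at A (\<gamma> s) then frechet_derivative (snd c \<circ> \<gamma>) (at s) 1 else 0)" for s
  note vel = smooth_curve_on_velocity[OF I smo assms(2) w_def]
  define \<sigma> where "\<sigma> = (\<lambda>s. sqrt (g (\<gamma> s) (w s) (w s)))"
  have "isCont \<sigma> s0" if s0: "s0 \<in> I" for s0
  proof -
    obtain c where c: "c \<in> A" "\<gamma> s0 \<in> fst c" using chart_at .
    let ?J = "{s\<in>I. \<gamma> s \<in> fst c}" and ?D = "\<lambda>s. frechet_derivative (snd c \<circ> \<gamma>) (at s) 1"
    have J: "open ?J" by (rule open_curve_preimage[OF I(1,3) c(1)])
    have "continuous_on ?J (\<lambda>s. gram_matrix A g c ((snd c \<circ> \<gamma>) s))"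
      by (rule continuous_on_compose2[OF continuous_on_gram_matrix[OF c(1)]
            smooth_on_imp_continuous_on[OF smo[OF c(1)]]]) auto
    then have "continuous_on ?J (\<lambda>s. sqrt (?D s \<bullet> (gram_matrix A g c ((snd c \<circ> \<gamma>) s) *v ?D s)))"
      by (intro continuous_on_real_sqrt continuous_on_inner continuous_on_matrix_vector_mult
          smooth_on_imp_continuous_on_derivative smo c)
    moreover have "\<sigma> s = sqrt (?D s \<bullet> (gram_matrix A g c ((snd c \<circ> \<gamma>) s) *v ?D s))" if s: "s \<in> ?J" for s
    proof -
      have sI: "s \<in> I" "\<gamma> s \<in> fst c" using s by auto
      have tan: "w s \<in> tangent_space A (\<gamma> s)" by (rule vel(1)[OF _ sI(1)])
      have "c \<in> charts_at A (\<gamma> s)" using sI c by (simp add: charts_at_def)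
      then have wc: "w s c = ?D s" unfolding w_def by simp
      from metric_eq_gram[OF c(1) sI(2) tan tan] show ?thesis unfolding \<sigma>_def wc by simp
    qed
    ultimately have "continuous_on ?J \<sigma>" by (subst continuous_on_cong[OF refl])
    moreover have "s0 \<in> ?J" using s0 c by simp
    ultimately show ?thesis using continuous_on_eq_continuous_at[OF J] by blast
  qed
  then have "continuous_on {a..b} \<sigma>" using I(2) by (meson continuous_at_imp_continuous_on subsetD)
  then have "\<sigma> integrable_on {a..b}" by (rule integrable_continuous_real)
  then show ?thesis
  proof (rule integrable_spike_finite[of "{a, b}", rotated 2])
    show "speed C s = \<sigma> s" if "s \<in> {a..b} - {a, b}" for s
      using vel(2)[of s] that I(4) by (simp add: speed_def \<sigma>_def)
  qed simp
qed

lemma speed_integrable: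
  assumes "piecewise_smooth_curve A C"
  shows "speed C integrable_on {0..1}"
proof -
  obtain m t where t: "t 0 = 0" "t m = 1"
    and sm: "\<forall>i<m. t i < t (Suc i) \<and> smooth_curve_on A (t i) (t (Suc i)) C"
    using assms unfolding piecewise_smooth_curve_def by blast
  have mono: "\<And>i j. i \<le> j \<Longrightarrow> j \<le> m \<Longrightarrow> t i \<le> t j"
    using subdivision_mono[of m t] sm by blast
  have "speed C integrable_on {t 0..t k}" if "k \<le> m" for k
    using that
  proof (induction k)
    case (Suc k)
    have "speed C integrable_on {t k..t (Suc k)}"
      using Suc.prems sm mono[of 0 k] mono[of "Suc k" m] t by (intro speed_integrable_piece) auto
    moreover have "speed C integrable_on {t 0..t k}" using Suc by simp
    moreover have "t 0 \<le> t k" "t k \<le> t (Suc k)" using Suc.prems by (auto intro!: mono)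
    ultimately show ?case using Henstock_Kurzweil_Integration.integrable_combine by blast
  qed (use integrable_on_refl[of "speed C" "t 0"] in simp)
  from this[of m] show ?thesis using t by simp
qed

lemma speed_nonneg: "regular_at C s \<Longrightarrow> 0 \<le> speed C s"
  unfolding speed_def regular_at_def by (simp add: g_nonneg)

text \<open>Serves both halves of a concatenation: the curve is run \<open>e\<close> times as fast
  on an interval of length \<open>1 / e\<close>.\<close>

lemma speed_affine:
  assumes C: "piecewise_smooth_curve A C" and e: "0 < e" and ab: "e * a + d = 0" "e * b + d = 1"
    and sub: "{a..b} \<subseteq> {0..1}" and C': "\<And>s. s \<in> {a..b} \<Longrightarrow> C' s = C (e * s + d)"
  shows "(speed C' has_integral riem_length A g C) {a..b}"
proof -
  obtain S where S: "finite S" "0 \<in> S" "1 \<in> S" "\<And>s. s \<in> {0..1} - S \<Longrightarrow> regular_at C s"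
    using piecewise_smooth_curve_regular[OF C] by blast
  have a: "a = (0 - d) / e" and b: "b = (1 - d) / e" using ab e by (simp_all add: field_simps)
  have "(speed C has_integral riem_length A g C) (cbox 0 1)"
    using speed_integrable[OF C] by (simp add: riem_length_eq integrable_integral)
  from has_integral_affinity'[OF this e, of d]
  have "((\<lambda>s. speed C (e * s + d)) has_integral (riem_length A g C / e)) {a..b}"
    by (simp add: a b divide_inverse mult.commute)
  from has_integral_mult_right[OF this, of e]
  have i: "((\<lambda>s. e * speed C (e * s + d)) has_integral riem_length A g C) {a..b}" using e by simp
  show ?thesis
  proof (rule has_integral_spike_finite[OF _ _ i])
    show "finite ((\<lambda>r. (r - d) / e) ` S)" using S(1) by simp
    fix s assume s: "s \<in> {a..b} - (\<lambda>r. (r - d) / e) ` S"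
    let ?r = "e * s + d"
    have rS: "?r \<notin> S"
    proof
      assume "?r \<in> S"
      then have "(?r - d) / e \<in> (\<lambda>r. (r - d) / e) ` S" by blast
      then show False using s e by simp
    qed
    have "e * a + d \<le> ?r" "?r \<le> e * b + d" using s e by auto
    then have r: "?r \<in> {0..1} - S" using rS ab by auto
    then have r01: "0 < ?r" "?r < 1" using S(2,3) by (auto simp: less_le)
    then have s': "s \<in> {a<..<b}" using e ab by (auto simp: a b field_simps)
    have "a \<in> {a..b}" "b \<in> {a..b}" using s' by auto
    then have "a \<in> {0..1}" "b \<in> {0..1}" using sub by blast+
    then have s01: "0 < s" "s < 1" using s' by auto
    have reg: "regular_at C ?r" by (rule S(4)[OF r])
    have Cs: "C' s = C ?r" using s by (intro C') simp
    have "velocity A C' s c = e *\<^sub>R velocity A C ?r c" for c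
    proof (cases "c \<in> charts_at A (C ?r)")
      case True
      then have c: "c \<in> A" "C ?r \<in> fst c" by (auto simp: charts_at_def)
      have aff: "((\<lambda>s. e * s + d) has_vector_derivative e) (at s)"
        by (auto intro!: derivative_eq_intros simp: has_real_derivative_iff_has_vector_derivative[symmetric])
      have "((snd c \<circ> C) has_vector_derivative velocity A C ?r c) (at ?r)"
        using reg c by (simp add: regular_at_def)
      from vector_diff_chain_at[OF aff this]
      have "((snd c \<circ> C \<circ> (\<lambda>s. e * s + d)) has_vector_derivative e *\<^sub>R velocity A C ?r c) (at s)" .
      then have "((snd c \<circ> C') has_vector_derivative e *\<^sub>R velocity A C ?r c) (at s)"
        by (rule has_vector_derivative_transform_within_open[OF _ open_greaterThanLessThan s'])
          (simp add: C')
      then show ?thesis by (intro velocity_eq s01) (simp_all add: c Cs)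
    next
      case False
      then show ?thesis by (simp add: velocity_def Cs)
    qed
    then have "velocity A C' s = (\<lambda>c. e *\<^sub>R velocity A C ?r c)" by blast
    then show "speed C' s = e * speed C ?r"
      using reg e unfolding speed_def regular_at_def
      by (simp add: Cs g_scale real_sqrt_mult)
  qed
qed

end

section \<open>Concatenated curves and coordinate segments\<close>

lemma segment_point_in:
  fixes x y :: "'b::real_vector"
  assumes "closed_segment x y \<subseteq> S" "s \<in> {0..1}"
  shows "x + s *\<^sub>R (y - x) \<in> S"
  using assms(1)
proof (rule subsetD)
  show "x + s *\<^sub>R (y - x) \<in> closed_segment x y"
    using assms(2) by (auto simp: closed_segment_def algebra_simps intro!: exI[of _ s])
qed

text \<open>At \<open>s = 1/2\<close> the concatenation still follows the first curve; the matching
  end points make the second formula valid there too.\<close>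

lemma joinpaths_right:
  assumes "C1 1 = C2 0" "1/2 \<le> s"
  shows "(C1 +++ C2) s = C2 (2 * s - 1)"
proof (cases "s = 1/2")
  case True
  show ?thesis unfolding True using assms by (simp add: joinpaths_def)
qed (use assms in \<open>simp add: joinpaths_def\<close>)

context closed_manifold
begin

lemma piecewise_smooth_curve_join:
  assumes C1: "piecewise_smooth_curve A C1" and C2: "piecewise_smooth_curve A C2" and eq: "C1 1 = C2 0"
  shows "piecewise_smooth_curve A (C1 +++ C2)"
proof -
  obtain m t where t: "t 0 = 0" "t m = 1"
    and tsm: "\<forall>i<m. t i < t (Suc i) \<and> smooth_curve_on A (t i) (t (Suc i)) C1"
    using C1 unfolding piecewise_smooth_curve_def by blast
  obtain n u where u: "u 0 = 0" "u n = 1"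
    and usm: "\<forall>i<n. u i < u (Suc i) \<and> smooth_curve_on A (u i) (u (Suc i)) C2"
    using C2 unfolding piecewise_smooth_curve_def by blast
  \<comment> \<open>Both subdivisions are compressed into the halves of the unit interval; at
    \<open>i = m\<close> the two formulas agree with value 1/2.\<close>
  define r where "r i = (if i \<le> m then t i / 2 else (u (i - m) + 1) / 2)" for i
  have r2: "r (m + k) = (u k + 1) / 2" for k using t u by (cases k) (auto simp: r_def)
  have "r i < r (Suc i) \<and> smooth_curve_on A (r i) (r (Suc i)) (C1 +++ C2)" if i: "i < m + n" for i
  proof (cases "i < m")
    case True
    have "t (Suc i) \<le> 1" using subdivision_mono[of m t "Suc i" m] tsm t True by auto
    moreover have "smooth_curve_on A (t i / 2) (t (Suc i) / 2) (\<lambda>s. C1 (2 * s))"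
      using smooth_curve_on_affine[of "t i" "t (Suc i)" C1 2 0] tsm True by simp
    ultimately have "smooth_curve_on A (t i / 2) (t (Suc i) / 2) (C1 +++ C2)"
      by (elim smooth_curve_on_cong) (auto simp: joinpaths_def)
    then show ?thesis using True tsm by (simp add: r_def)
  next
    case False
    then obtain k where k: "i = m + k" "k < n" using i by (metis add_less_cancel_left le_Suc_ex not_less)
    have "0 \<le> u k" using subdivision_mono[of n u 0 k] usm u k by auto
    moreover have "smooth_curve_on A ((u k + 1) / 2) ((u (Suc k) + 1) / 2) (\<lambda>s. C2 (2 * s - 1))"
      using smooth_curve_on_affine[of "u k" "u (Suc k)" C2 2 "-1"] usm k by simp
    ultimately have "smooth_curve_on A ((u k + 1) / 2) ((u (Suc k) + 1) / 2) (C1 +++ C2)"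
      using eq by (elim smooth_curve_on_cong) (simp add: joinpaths_right)
    moreover have "u k < u (Suc k)" using usm k by blast
    ultimately show ?thesis unfolding k(1) add_Suc_right[symmetric] r2 by simp
  qed
  moreover have "r 0 = 0" "r (m + n) = 1" using t u r2[of n] by (auto simp: r_def)
  moreover have "continuous_on {0..1} (C1 +++ C2)"
    using path_join_imp[of C1 C2] C1 C2 eq
    by (simp add: path_def pathfinish_def pathstart_def piecewise_smooth_curve_def)
  ultimately show ?thesis unfolding piecewise_smooth_curve_def by blast
qed

definition segment :: "('a, 'n) chart \<Rightarrow> (real, 'n) vec \<Rightarrow> (real, 'n) vec \<Rightarrow> real \<Rightarrow> 'a" where
  "segment c x y s = chart_inv c (x + s *\<^sub>R (y - x))"

text \<open>The parameters for which the line stays in the chart image form the open neighbourhood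
  \<open>I\<close> that \<open>smooth_curve_on\<close> asks for. In any other chart the curve is a
  transition map along an affine line, hence smooth by \<open>smooth_on_affine\<close>.\<close>

lemma
  assumes c: "c \<in> A" and seg: "closed_segment x y \<subseteq> snd c ` fst c"
  shows piecewise_smooth_segment: "piecewise_smooth_curve A (segment c x y)"
    and segment_has_vector_derivative: "0 < s \<Longrightarrow> s < 1 \<Longrightarrow>
      ((snd c \<circ> segment c x y) has_vector_derivative (y - x)) (at s)"
proof -
  let ?\<gamma> = "segment c x y" and ?a = "\<lambda>s. x + s *\<^sub>R (y - x)"
  define I where "I = ?a -` (snd c ` fst c)"
  have I: "open I" unfolding I_def by (intro open_vimage open_chart_image c continuous_intros)
  have sub: "{0..1} \<subseteq> I" unfolding I_def using segment_point_in[OF seg] by blast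
  have cont: "continuous_on I ?\<gamma>" unfolding segment_def I_def
    by (intro continuous_on_compose2[OF continuous_on_chart_inv[OF c]] continuous_intros) auto
  have "smooth_on {s\<in>I. ?\<gamma> s \<in> fst c'} (snd c' \<circ> ?\<gamma>)" if c': "c' \<in> A" for c'
  proof -
    have "smooth_on {s\<in>I. ?\<gamma> s \<in> fst c'} (\<lambda>s. transition c c' (?a s))"
    proof (rule smooth_on_affine[OF bounded_linear_scaleR_left _ smooth_on_transition[OF c c']])
      show "open {s\<in>I. ?\<gamma> s \<in> fst c'}" by (rule open_curve_preimage[OF I cont c'])
      fix s assume "s \<in> {s\<in>I. ?\<gamma> s \<in> fst c'}"
      then have s: "?a s \<in> snd c ` fst c" "chart_inv c (?a s) \<in> fst c'"
        by (auto simp: I_def segment_def)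
      then have "chart_inv c (?a s) \<in> fst c \<inter> fst c'" using chart_inv_in[OF c] by blast
      moreover have "snd c (chart_inv c (?a s)) = ?a s" by (rule chart_chart_inv[OF c s(1)])
      ultimately show "?a s \<in> snd c ` (fst c \<inter> fst c')" by (metis imageI)
    qed
    then show ?thesis by (simp add: o_def transition_def segment_def)
  qed
  then have "smooth_curve_on A 0 1 ?\<gamma>" unfolding smooth_curve_on_def using I sub cont by blast
  then show "piecewise_smooth_curve A ?\<gamma>"
    unfolding piecewise_smooth_curve_def using continuous_on_subset[OF cont sub]
    by (intro conjI exI[of _ "1::nat"] exI[of _ "\<lambda>i::nat. real i"]) auto
  show "((snd c \<circ> ?\<gamma>) has_vector_derivative (y - x)) (at s)" if "0 < s" "s < 1"
  proof (rule has_vector_derivative_transform_within_open[of ?a _ _ I])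
    show "(?a has_vector_derivative (y - x)) (at s)" by (auto intro!: derivative_eq_intros)
    show "s \<in> I" using sub that by auto
    show "?a r = (snd c \<circ> ?\<gamma>) r" if "r \<in> I" for r
      using that chart_chart_inv[OF c] by (simp add: I_def segment_def)
  qed (rule I)
qed

end

context riemannian_metric
begin

lemma riem_length_join:
  assumes "piecewise_smooth_curve A C1" "piecewise_smooth_curve A C2" "C1 1 = C2 0"
  shows "riem_length A g (C1 +++ C2) = riem_length A g C1 + riem_length A g C2"
proof -
  have 1: "(speed (C1 +++ C2) has_integral riem_length A g C1) {0..1/2}"
    by (rule speed_affine[OF assms(1), of 2 _ 0]) (auto simp: joinpaths_def)
  have 2: "(speed (C1 +++ C2) has_integral riem_length A g C2) {1/2..1}"
    by (rule speed_affine[OF assms(2), of 2 _ "-1"]) (use assms(3) in \<open>auto simp: joinpaths_right\<close>)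
  have "(speed (C1 +++ C2) has_integral (riem_length A g C1 + riem_length A g C2)) {0..1}"
    by (rule has_integral_combine[OF _ _ 1 2]) auto
  then show ?thesis by (simp add: riem_length_eq integral_unique)
qed

lemma riem_length_segment:
  assumes c: "c \<in> A" and seg: "closed_segment x y \<subseteq> snd c ` fst c"
  shows "continuous_on {0..1} (\<lambda>s. sqrt ((y - x) \<bullet> (gram_matrix A g c (x + s *\<^sub>R (y - x)) *v (y - x))))"
    and "riem_length A g (segment c x y) =
      integral {0..1} (\<lambda>s. sqrt ((y - x) \<bullet> (gram_matrix A g c (x + s *\<^sub>R (y - x)) *v (y - x))))"
proof -
  have "continuous_on {0..1} (\<lambda>s. gram_matrix A g c (x + s *\<^sub>R (y - x)))"
    using segment_point_in[OF seg]
    by (intro continuous_on_compose2[OF continuous_on_gram_matrix[OF c]] continuous_intros) auto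
  then show "continuous_on {0..1} (\<lambda>s. sqrt ((y - x) \<bullet> (gram_matrix A g c (x + s *\<^sub>R (y - x)) *v (y - x))))"
    by (intro continuous_on_real_sqrt continuous_on_inner continuous_on_matrix_vector_mult continuous_on_const)
  obtain S where S: "finite S" "0 \<in> S" "1 \<in> S" "\<And>s. s \<in> {0..1} - S \<Longrightarrow> regular_at (segment c x y) s"
    using piecewise_smooth_curve_regular[OF piecewise_smooth_segment[OF assms]] by blast
  have "speed (segment c x y) s = sqrt ((y - x) \<bullet> (gram_matrix A g c (x + s *\<^sub>R (y - x)) *v (y - x)))"
    if s: "s \<in> {0..1} - S" for s
  proof -
    have s01: "0 < s" "s < 1" using s S(2,3) by (auto simp: less_le)
    have p: "x + s *\<^sub>R (y - x) \<in> snd c ` fst c" using segment_point_in[OF seg] s by blast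
    have "snd c (segment c x y s) = x + s *\<^sub>R (y - x)" "segment c x y s \<in> fst c"
      unfolding segment_def using chart_chart_inv[OF c p] chart_inv_in[OF c p] by auto
    then show ?thesis
      using speed_chart[OF S(4)[OF s] c _ segment_has_vector_derivative[OF assms s01]] by simp
  qed
  then show "riem_length A g (segment c x y) =
      integral {0..1} (\<lambda>s. sqrt ((y - x) \<bullet> (gram_matrix A g c (x + s *\<^sub>R (y - x)) *v (y - x))))"
    unfolding riem_length_eq by (intro integral_spike[of S]) (use S(1) in \<open>auto simp: negligible_finite\<close>)
qed

lemma riem_length_nonneg:
  assumes "piecewise_smooth_curve A C"
  shows "0 \<le> riem_length A g C"
proof -
  obtain S where S: "finite S" "0 \<in> S" "1 \<in> S" "\<And>s. s \<in> {0..1} - S \<Longrightarrow> regular_at C s"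
    using piecewise_smooth_curve_regular[OF assms] by blast
  \<comment> \<open>On \<open>S\<close> the speed is unspecified and might even be negative, since
    \<open>sqrt\<close> takes negative values at negative arguments; it is replaced by 0
    there.\<close>
  have "((\<lambda>s. if s \<in> S then 0 else speed C s) has_integral riem_length A g C) {0..1}"
    by (rule has_integral_spike_finite[OF S(1) _ integrable_integral[OF speed_integrable[OF assms], folded riem_length_eq]])
      simp
  then show ?thesis
    by (rule has_integral_nonneg) (use S(4) speed_nonneg in \<open>simp\<close>)
qed

end

subsection \<open>Inner products close to a fixed one\<close>

definition matrix_norm :: "real ^ 'n ^ 'n \<Rightarrow> real ^ 'n \<Rightarrow> real" where
  "matrix_norm M v = sqrt (v \<bullet> (M *v v))"

text \<open>A crude estimate of the operator norm by the sum of the components; it is needed only to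
  see that the form is small when \<open>norm M\<close> is.\<close>

lemma quadratic_form_bound:
  fixes M :: "real ^ 'n ^ 'n"
  shows "\<bar>v \<bullet> (M *v v)\<bar> \<le> real CARD('n) * norm M * (v \<bullet> v)"
proof -
  have "norm (M *v v) \<le> (\<Sum>i\<in>UNIV. \<bar>(M *v v) $ i\<bar>)" by (rule norm_le_l1_cart)
  also have "\<dots> \<le> (\<Sum>i\<in>(UNIV::'n set). norm M * norm v)"
  proof (rule sum_mono)
    fix i
    have "\<bar>(M *v v) $ i\<bar> \<le> norm (M $ i) * norm v"
      unfolding matrix_vector_mul_component by (rule Cauchy_Schwarz_ineq2)
    also have "\<dots> \<le> norm M * norm v"
      by (intro mult_right_mono Finite_Cartesian_Product.norm_nth_le) simp
    finally show "\<bar>(M *v v) $ i\<bar> \<le> norm M * norm v" .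
  qed
  finally have "norm (M *v v) \<le> real CARD('n) * (norm M * norm v)" by simp
  then have "norm v * norm (M *v v) \<le> norm v * (real CARD('n) * (norm M * norm v))"
    by (rule mult_left_mono) simp
  then show ?thesis
    using Cauchy_Schwarz_ineq2[of v "M *v v"] unfolding power2_norm_eq_inner[symmetric]
    by (simp add: power2_eq_square mult_ac)
qed

context
  fixes M :: "real ^ 'n ^ 'n"
  assumes M: "psd_matrix M"
begin

lemma matrix_norm_nonneg: "0 \<le> matrix_norm M v"
  using M by (simp add: matrix_norm_def psd_matrix_def)

lemma matrix_norm_cauchy_schwarz: "u \<bullet> (M *v v) \<le> matrix_norm M u * matrix_norm M v"
proof -
  have "\<bar>u \<bullet> (M *v v)\<bar> \<le> sqrt ((u \<bullet> (M *v u)) * (v \<bullet> (M *v v)))"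
    using psd_cauchy_schwarz[OF M, of u v] by (rule real_le_rsqrt[of "\<bar>_\<bar>", unfolded power2_abs])
  then show ?thesis by (simp add: matrix_norm_def real_sqrt_mult)
qed

lemma matrix_norm_square: "matrix_norm M v * matrix_norm M v = v \<bullet> (M *v v)"
  using M by (simp add: matrix_norm_def psd_matrix_def)

lemma matrix_norm_triangle: "matrix_norm M (u + v) \<le> matrix_norm M u + matrix_norm M v"
proof -
  have "matrix_norm M (u + v) * matrix_norm M (u + v) = u \<bullet> (M *v u) + v \<bullet> (M *v v) + u \<bullet> (M *v v) + v \<bullet> (M *v u)"
    unfolding matrix_norm_square by (simp add: matrix_vector_right_distrib inner_add_left inner_add_right)
  also have "\<dots> \<le> (matrix_norm M u + matrix_norm M v) * (matrix_norm M u + matrix_norm M v)"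
    unfolding matrix_norm_square[symmetric]
    using matrix_norm_cauchy_schwarz[of u v] matrix_norm_cauchy_schwarz[of v u]
    by (simp add: algebra_simps)
  finally show ?thesis
    by (rule power2_le_imp_le[unfolded power2_eq_square]) (intro add_nonneg_nonneg matrix_norm_nonneg)
qed

end

lemma matrix_norm_bound:
  fixes M :: "real ^ 'n ^ 'n"
  shows "matrix_norm M v \<le> sqrt (real CARD('n) * norm M) * norm v"
proof -
  have "matrix_norm M v \<le> sqrt (real CARD('n) * norm M * (v \<bullet> v))"
    unfolding matrix_norm_def using quadratic_form_bound[of v M] by (intro real_sqrt_le_mono) linarith
  then show ?thesis by (simp add: real_sqrt_mult norm_eq_sqrt_inner)
qed

lemma matrix_norm_close:
  fixes M N :: "real ^ 'n ^ 'n"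
  assumes e: "\<And>v. e * (v \<bullet> v) \<le> v \<bullet> (M *v v)" and \<epsilon>: "0 < \<epsilon>"
    and close: "real CARD('n) * norm (N - M) \<le> \<epsilon> / (1 + \<epsilon>) * e" and M: "psd_matrix M"
  shows "matrix_norm N v \<le> (1 + \<epsilon>) * matrix_norm M v" and "matrix_norm M v \<le> (1 + \<epsilon>) * matrix_norm N v"
proof -
  \<comment> \<open>Chosen so that \<open>1 - ?\<theta>\<close> is the reciprocal of
    \<open>1 + \<epsilon>\<close>: a relative deviation of this size between the forms costs a
    factor of at most \<open>1 + \<epsilon>\<close> between the norms, in both directions.\<close>
  let ?\<theta> = "\<epsilon> / (1 + \<epsilon>)"
  let ?q = "v \<bullet> (M *v v)" and ?r = "v \<bullet> (N *v v)"
  have \<theta>: "0 \<le> ?\<theta>" "?\<theta> \<le> \<epsilon>" "(1 - ?\<theta>) * (1 + \<epsilon>) = 1" using \<epsilon> by (auto simp: field_simps)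
  have q: "0 \<le> ?q" using M by (simp add: psd_matrix_def)
  have "\<bar>?r - ?q\<bar> \<le> real CARD('n) * norm (N - M) * (v \<bullet> v)"
    using quadratic_form_bound[of v "N - M"] by (simp add: matrix_vector_mult_diff_rdistrib inner_diff_right)
  also have "\<dots> \<le> ?\<theta> * e * (v \<bullet> v)" using close by (rule mult_right_mono) simp
  also have "\<dots> \<le> ?\<theta> * ?q" using mult_left_mono[OF e \<theta>(1)] by (simp add: mult.assoc)
  finally have d: "\<bar>?r - ?q\<bar> \<le> ?\<theta> * ?q" .
  have "?r \<le> (1 + ?\<theta>) * ?q" using d by (simp add: algebra_simps)
  also have "\<dots> \<le> (1 + \<epsilon>)\<^sup>2 * ?q"
  proof (rule mult_right_mono[OF _ q])
    have "1 + ?\<theta> \<le> 1 + \<epsilon>" using \<theta>(2) by simp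
    also have "\<dots> \<le> (1 + \<epsilon>)\<^sup>2" using \<epsilon> by (simp add: power2_eq_square)
    finally show "1 + ?\<theta> \<le> (1 + \<epsilon>)\<^sup>2" .
  qed
  finally have "sqrt ?r \<le> sqrt ((1 + \<epsilon>)\<^sup>2 * ?q)" by (rule real_sqrt_le_mono)
  then show "matrix_norm N v \<le> (1 + \<epsilon>) * matrix_norm M v"
    using \<epsilon> by (simp add: matrix_norm_def real_sqrt_mult)
  have "(1 - ?\<theta>) * ?q \<le> ?r" using d by (simp add: algebra_simps)
  then have "(1 + \<epsilon>) * ((1 - ?\<theta>) * ?q) \<le> (1 + \<epsilon>) * ?r" using \<epsilon> by (intro mult_left_mono) auto
  moreover have "(1 + \<epsilon>) * ((1 - ?\<theta>) * ?q) = ?q" using \<theta>(3) by (metis mult.assoc mult.commute mult_1)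
  ultimately have "?q \<le> (1 + \<epsilon>) * ?r" by simp
  moreover from this have "0 \<le> ?r" using q \<epsilon> by (smt (verit) mult_pos_neg)
  then have "(1 + \<epsilon>) * ?r \<le> (1 + \<epsilon>)\<^sup>2 * ?r"
    using \<epsilon> by (intro mult_right_mono) (auto simp: power2_eq_square)
  ultimately have "sqrt ?q \<le> sqrt ((1 + \<epsilon>)\<^sup>2 * ?r)" by (intro real_sqrt_le_mono) linarith
  then show "matrix_norm M v \<le> (1 + \<epsilon>) * matrix_norm N v"
    using \<epsilon> by (simp add: matrix_norm_def real_sqrt_mult)
qed

text \<open>A null set contains no non-empty open set; all generic vertices of the chains are found
  in this way.\<close>

lemma AE_lborel_open_witness:
  fixes U :: "'a::euclidean_space set"
  assumes "AE x in lborel. P x" "open U" "U \<noteq> {}"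
  obtains x where "x \<in> U" "P x"
proof -
  have "\<exists>x\<in>U. P x"
  proof (rule ccontr)
    assume neg: "\<not> (\<exists>x\<in>U. P x)"
    obtain N where N: "{x \<in> space lborel. \<not> P x} \<subseteq> N" "emeasure lborel N = 0" "N \<in> sets lborel"
      using assms(1) by (rule AE_E)
    then have "N \<in> null_sets lborel" by blast
    then have "negligible N" by (simp add: negligible_iff_null_sets null_sets_completionI)
    moreover have "U \<subseteq> N" using neg N(1) by auto
    ultimately have "negligible U" by (rule negligible_subset)
    then show False using open_not_negligible assms(2,3) by blast
  qed
  then show thesis using that by blast
qed

section \<open>Comparison with a constant inner product on small coordinate balls\<close>

context riemannian_metric
begin

lemma gram_matrix_close:
  assumes c: "c \<in> A" and x0: "x0 \<in> snd c ` fst c" and \<epsilon>: "0 < \<epsilon>"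
  obtains \<delta> where "0 < \<delta>" "ball x0 \<delta> \<subseteq> snd c ` fst c"
    "\<And>x v. x \<in> ball x0 \<delta> \<Longrightarrow> matrix_norm (gram_matrix A g c x) v \<le> (1 + \<epsilon>) * matrix_norm (gram_matrix A g c x0) v"
    "\<And>x v. x \<in> ball x0 \<delta> \<Longrightarrow> matrix_norm (gram_matrix A g c x0) v \<le> (1 + \<epsilon>) * matrix_norm (gram_matrix A g c x) v"
proof -
  let ?G = "gram_matrix A g c" and ?n = "real CARD('n)"
  have pd: "pd_matrix (?G x0)" by (rule pd_gram_matrix[OF c x0])
  obtain e where e: "0 < e" "\<And>v. e * (v \<bullet> v) \<le> v \<bullet> (?G x0 *v v)"
    using pd_matrix_lower_bound[OF pd] by blast
  \<comment> \<open>Multiplied by the dimension, this is the tolerance required by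
    \<open>matrix_norm_close\<close>.\<close>
  define \<kappa> where "\<kappa> = \<epsilon> / (1 + \<epsilon>) * e / ?n"
  have \<kappa>: "0 < \<kappa>" using \<epsilon> e(1) by (simp add: \<kappa>_def)
  have "isCont ?G x0"
    using continuous_on_gram_matrix[OF c] x0
    unfolding continuous_on_eq_continuous_at[OF open_chart_image[OF c]] by blast
  then obtain d where d: "0 < d" "\<And>x. dist x x0 < d \<Longrightarrow> dist (?G x) (?G x0) < \<kappa>"
    using \<kappa> unfolding continuous_at_eps_delta dist_norm by blast
  obtain r where r: "0 < r" "ball x0 r \<subseteq> snd c ` fst c"
    using open_contains_ball open_chart_image[OF c] x0 by blast
  have close: "?n * norm (?G x - ?G x0) \<le> \<epsilon> / (1 + \<epsilon>) * e" if "x \<in> ball x0 (min d r)" for x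
  proof -
    have "dist x x0 < d" using that by (simp add: dist_commute)
    then have "norm (?G x - ?G x0) \<le> \<kappa>" using d(2)[of x] by (simp add: dist_norm)
    then have "?n * norm (?G x - ?G x0) \<le> ?n * \<kappa>" by (intro mult_left_mono) auto
    then show ?thesis by (simp add: \<kappa>_def)
  qed
  show thesis
  proof (rule that[of "min d r"])
    show "0 < min d r" using d r by simp
    show "ball x0 (min d r) \<subseteq> snd c ` fst c" using r(2) by auto
  qed (use matrix_norm_close[OF e(2) \<epsilon> close pd_imp_psd[OF pd]] in blast)+
qed

text \<open>For a constant inner product a straight chord is no longer than the curve. Pairing the
  velocity with the chord vector \<open>w\<close> through \<open>M\<close> and integrating gives the
  square of the \<open>M\<close>-norm of \<open>w\<close>; by Cauchy-Schwarz this is at most that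
  norm times the integral on the right, and one factor cancels.\<close>

lemma chord_le:
  assumes C: "piecewise_smooth_curve A C" and c: "c \<in> A" and ab: "0 \<le> a" "a \<le> b" "b \<le> 1"
    and dom: "\<And>s. s \<in> {a..b} \<Longrightarrow> C s \<in> fst c" and M: "psd_matrix M" and K: "0 \<le> K"
    and le: "\<And>s v. s \<in> {a..b} \<Longrightarrow> matrix_norm M v \<le> K * matrix_norm (gram_matrix A g c (snd c (C s))) v"
  shows "matrix_norm M (snd c (C b) - snd c (C a)) \<le> K * integral {a..b} (speed C)"
proof -
  obtain S where S: "finite S" "0 \<in> S" "1 \<in> S" "\<And>s. s \<in> {0..1} - S \<Longrightarrow> regular_at C s"
    using piecewise_smooth_curve_regular[OF C] by blast
  define w where "w = snd c (C b) - snd c (C a)"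
  define f where "f s = (if s \<in> S then 0 else w \<bullet> (M *v velocity A C s c))" for s
  define h where "h s = (if s \<in> S then 0 else matrix_norm M w * (K * speed C s))" for s
  let ?F = "\<lambda>s. w \<bullet> (M *v (snd c \<circ> C) s)"
  have sub: "{a..b} \<subseteq> {0..1}" using ab by auto
  have contC: "continuous_on {a..b} C"
    using C sub continuous_on_subset unfolding piecewise_smooth_curve_def by blast
  have "continuous_on {a..b} (\<lambda>s. snd c (C s))"
    by (rule continuous_on_compose2[OF continuous_on_chart[OF c] contC]) (use dom in blast)
  then have contF: "continuous_on {a..b} ?F"
    by (simp only: o_def)
      (intro continuous_on_inner continuous_on_matrix_vector_mult continuous_on_const)
  have reg: "regular_at C s" if "s \<in> {a..b} - S" for s using S(4) that sub by blast
  have 1: "(f has_integral (?F b - ?F a)) {a..b}"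
  proof (rule fundamental_theorem_of_calculus_interior_strong[OF S(1) ab(2) _ contF])
    fix s assume s: "s \<in> {a<..<b} - S"
    have "((snd c \<circ> C) has_vector_derivative velocity A C s c) (at s)"
      using reg[of s] s dom[of s] c by (auto simp: regular_at_def)
    moreover have "bounded_linear (\<lambda>x. w \<bullet> (M *v x))"
      by (intro bounded_linear_inner_right_comp matrix_vector_mul_bounded_linear)
    ultimately have "(?F has_vector_derivative w \<bullet> (M *v velocity A C s c)) (at s)"
      by (rule bounded_linear.has_vector_derivative[rotated])
    then show "(?F has_vector_derivative f s) (at s)" using s by (simp add: f_def)
  qed
  have "speed C integrable_on {a..b}"
    using integrable_subinterval_real[OF speed_integrable[OF C] sub] .
  then have "((\<lambda>s. matrix_norm M w * (K * speed C s)) has_integral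
      matrix_norm M w * (K * integral {a..b} (speed C))) {a..b}"
    by (intro has_integral_mult_right integrable_integral)
  then have 2: "(h has_integral matrix_norm M w * (K * integral {a..b} (speed C))) {a..b}"
    by (rule has_integral_spike_finite[OF S(1), rotated]) (simp add: h_def)
  have "f s \<le> h s" if s: "s \<in> {a..b}" for s
  proof (cases "s \<in> S")
    case False
    let ?v = "velocity A C s c"
    have r: "regular_at C s" using reg s False by blast
    then have "((snd c \<circ> C) has_vector_derivative ?v) (at s)"
      using dom[OF s] c by (simp add: regular_at_def)
    then have "speed C s = matrix_norm (gram_matrix A g c (snd c (C s))) ?v"
      unfolding matrix_norm_def by (rule speed_chart[OF r c dom[OF s]])
    then have "matrix_norm M ?v \<le> K * speed C s" using le[OF s] by simp
    then have "matrix_norm M w * matrix_norm M ?v \<le> matrix_norm M w * (K * speed C s)"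
      by (rule mult_left_mono) (rule matrix_norm_nonneg[OF M])
    then show ?thesis
      using matrix_norm_cauchy_schwarz[OF M, of w ?v] False by (simp add: f_def h_def)
  qed (simp add: f_def h_def)
  from has_integral_le[OF 1 2 this]
  have "w \<bullet> (M *v w) \<le> matrix_norm M w * (K * integral {a..b} (speed C))"
    by (simp add: w_def matrix_vector_mult_diff_distrib inner_diff_right)
  then have *: "matrix_norm M w * matrix_norm M w \<le> matrix_norm M w * (K * integral {a..b} (speed C))"
    by (simp add: matrix_norm_square[OF M])
  have "0 \<le> integral {a..b} (speed C)"
  proof -
    have "((\<lambda>s. if s \<in> S then 0 else speed C s) has_integral integral {a..b} (speed C)) {a..b}"
      using integrable_integral[OF \<open>speed C integrable_on {a..b}\<close>]
      by (rule has_integral_spike_finite[OF S(1), rotated]) simp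
    then show ?thesis
      by (rule has_integral_nonneg) (use reg speed_nonneg in simp)
  qed
  then have "0 \<le> K * integral {a..b} (speed C)" using K by simp
  then show ?thesis
    using * matrix_norm_nonneg[OF M, of w] unfolding w_def[symmetric]
    by (cases "matrix_norm M w = 0") (simp_all add: mult_le_cancel_left)
qed

lemma riem_length_segment_le:
  assumes c: "c \<in> A" and seg: "closed_segment x y \<subseteq> snd c ` fst c"
    and le: "\<And>z. z \<in> closed_segment x y \<Longrightarrow> matrix_norm (gram_matrix A g c z) (y - x) \<le> B"
  shows "riem_length A g (segment c x y) \<le> B"
proof -
  have "riem_length A g (segment c x y) \<le> integral {0..1} (\<lambda>s::real. B)"
    unfolding riem_length_segment(2)[OF c seg]
  proof (rule integral_le)
    show "(\<lambda>s. sqrt ((y - x) \<bullet> (gram_matrix A g c (x + s *\<^sub>R (y - x)) *v (y - x)))) integrable_on {0..1}"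
      by (intro integrable_continuous_real riem_length_segment(1)[OF c seg])
    fix s :: real assume "s \<in> {0..1}"
    then have "x + s *\<^sub>R (y - x) \<in> closed_segment x y" by (rule segment_point_in[OF order_refl])
    from le[OF this] show "sqrt ((y - x) \<bullet> (gram_matrix A g c (x + s *\<^sub>R (y - x)) *v (y - x))) \<le> B"
      by (simp add: matrix_norm_def)
  qed auto
  then show ?thesis by simp
qed

end

context metric_above
begin

lemma riem_length_le:
  assumes "piecewise_smooth_curve A C"
  shows "riem_length A g0 C \<le> riem_length A g C"
proof -
  obtain S where S: "finite S" "0 \<in> S" "1 \<in> S" "\<And>s. s \<in> {0..1} - S \<Longrightarrow> base.regular_at C s"
    using base.piecewise_smooth_curve_regular[OF assms] by blast
  have 1: "((\<lambda>s. if s \<in> S then 0 else base.speed C s) has_integral riem_length A g0 C) {0..1}"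
    by (rule has_integral_spike_finite[OF S(1) _ integrable_integral[OF base.speed_integrable[OF assms], folded base.riem_length_eq]])
      simp
  have 2: "((\<lambda>s. if s \<in> S then 0 else speed C s) has_integral riem_length A g C) {0..1}"
    by (rule has_integral_spike_finite[OF S(1) _ integrable_integral[OF speed_integrable[OF assms], folded riem_length_eq]])
      simp
  show ?thesis
  proof (rule has_integral_le[OF 1 2])
    fix s :: real assume s: "s \<in> {0..1}"
    show "(if s \<in> S then 0 else base.speed C s) \<le> (if s \<in> S then 0 else speed C s)"
      using S(4)[of s] s metric_le[of "velocity A C s" "C s"]
      by (simp add: base.speed_def speed_def base.regular_at_def)
  qed
qed

lemma riem_dist_le:
  assumes "\<exists>C. piecewise_smooth_curve A C \<and> C 0 = p \<and> C 1 = q"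
  shows "riem_dist A g0 p q \<le> riem_dist A g p q"
  unfolding riem_dist_def
proof (rule cInf_mono)
  show "{riem_length A g C |C. piecewise_smooth_curve A C \<and> C 0 = p \<and> C 1 = q} \<noteq> {}"
    using assms by blast
  show "bdd_below {riem_length A g0 C |C. piecewise_smooth_curve A C \<and> C 0 = p \<and> C 1 = q}"
    using base.riem_length_nonneg by (intro bdd_belowI[of _ 0]) auto
qed (use riem_length_le in blast)

end

subsection \<open>Segments along which the lengths converge\<close>

text \<open>The sequence stands for the subsequence already extracted. Summable volume excesses,
  instead of excesses merely tending to 0, permit a single function \<open>excess\<close> and hence
  one null set for all \<open>j\<close>.\<close>

locale metrics_above = base: riemannian_metric A g0
  for A :: "('a::{t2_space,second_countable_topology}, 'n::{finite,wellorder}) chart set"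
    and g0 :: "('a, 'n) metric" +
  fixes g :: "nat \<Rightarrow> ('a, 'n) metric"
  assumes above: "metric_above A g0 (g j)"
    and volume_excess: "(\<Sum>j. emeasure (riem_volume A (g j)) UNIV - emeasure (riem_volume A g0) UNIV) < \<infinity>"
begin

lemma metric: "riemannian_metric A (g j)"
  using above by (simp add: metric_above_def)

text \<open>The sum of the \<open>h\<^sub>j - 1\<close>, multiplied by the density of
  \<open>g0\<close>, so that Lebesgue measure in the chart is the right measure to integrate it
  against.\<close>

definition excess :: "('a, 'n) chart \<Rightarrow> (real, 'n) vec \<Rightarrow> ennreal" where
  "excess c x = (\<Sum>j. ennreal (vol_density A (g j) c x - vol_density A g0 c x) * indicator (snd c ` fst c) x)"

lemma excess_term_measurable:
  assumes c: "c \<in> A"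
  shows "(\<lambda>x. ennreal (vol_density A (g j) c x - vol_density A g0 c x) * indicator (snd c ` fst c) x)
    \<in> borel_measurable borel"
proof -
  let ?S = "snd c ` fst c"
  have S: "?S \<in> sets borel" using base.open_chart_image[OF c] by simp
  have eq: "(\<lambda>x. ennreal (vol_density A (g j) c x - vol_density A g0 c x) * indicator ?S x) =
     (\<lambda>x. ennreal (indicator ?S x * vol_density A (g j) c x - indicator ?S x * vol_density A g0 c x))"
    by (auto simp: indicator_def)
  have [measurable]: "(\<lambda>x. indicator ?S x * vol_density A (g j) c x) \<in> borel_measurable borel"
    by (rule riemannian_metric.vol_density_measurable[OF metric c S order_refl])
  have [measurable]: "(\<lambda>x. indicator ?S x * vol_density A g0 c x) \<in> borel_measurable borel"
    by (rule base.vol_density_measurable[OF c S order_refl])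
  show ?thesis unfolding eq by measurable
qed

lemma excess_measurable: "c \<in> A \<Longrightarrow> excess c \<in> borel_measurable borel"
  unfolding excess_def[abs_def] by (intro borel_measurable_suminf_order excess_term_measurable)

lemma nn_integral_excess:
  assumes c: "c \<in> A"
  shows "(\<integral>\<^sup>+x. excess c x \<partial>lborel) < \<infinity>"
proof -
  have "(\<integral>\<^sup>+x. excess c x \<partial>lborel) =
     (\<Sum>j. \<integral>\<^sup>+x\<in>snd c ` fst c. ennreal (vol_density A (g j) c x - vol_density A g0 c x) \<partial>lborel)"
    unfolding excess_def by (rule nn_integral_suminf) (simp add: excess_term_measurable[OF c])
  also have "\<dots> \<le> (\<Sum>j. emeasure (riem_volume A (g j)) UNIV - emeasure (riem_volume A g0) UNIV)"
    by (intro suminf_le metric_above.nn_integral_density_diff_le[OF above c]) auto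
  finally show ?thesis using volume_excess by (rule le_less_trans)
qed

text \<open>On the segment \<open>norm_le_density_ratio\<close> bounds the \<open>g j\<close>-speed
  by the \<open>g0\<close>-speed plus \<open>K\<close> times the difference of the densities, where
  \<open>K\<close> bounds the continuous quotient of \<open>g0\<close>-speed and
  \<open>g0\<close>-density. The integrals of these differences are the terms of a convergent series
  and tend to 0; the lower bound is \<open>riem_length_le\<close>.\<close>

lemma riem_length_segment_tendsto:
  assumes c: "c \<in> A" and seg: "closed_segment x y \<subseteq> snd c ` fst c"
    and fin: "segment_integral (excess c) x y < \<infinity>"
  shows "(\<lambda>j. riem_length A (g j) (base.segment c x y)) \<longlonglongrightarrow> riem_length A g0 (base.segment c x y)"
proof -
  let ?z = "\<lambda>s::real. x + s *\<^sub>R (y - x)"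
  let ?N = "\<lambda>h s. sqrt ((y - x) \<bullet> (gram_matrix A h c (?z s) *v (y - x)))"
  let ?D = "\<lambda>h s. vol_density A h c (?z s)"
  have z: "?z s \<in> snd c ` fst c" if "s \<in> {0..1}" for s using segment_point_in[OF seg that] .
  have contz: "continuous_on {0..1} ?z" by (intro continuous_intros)
  have contD: "continuous_on {0..1} (?D h)" if "riemannian_metric A h" for h
    by (rule continuous_on_compose2[OF riemannian_metric.continuous_on_vol_density[OF that c] contz])
      (use z in blast)
  have contN: "continuous_on {0..1} (?N h)" if "riemannian_metric A h" for h
    by (rule riemannian_metric.riem_length_segment(1)[OF that c seg])
  have D0: "0 < ?D g0 s" if "s \<in> {0..1}" for s by (rule base.vol_density_pos[OF c z[OF that]])
  have "continuous_on {0..1} (\<lambda>s. ?N g0 s / ?D g0 s)"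
    by (intro continuous_on_divide contN contD base.riemannian_metric_axioms) (use D0 in force)
  then have "bounded ((\<lambda>s. ?N g0 s / ?D g0 s) ` {0..1})"
    by (intro compact_imp_bounded compact_continuous_image) auto
  then obtain K where K0: "\<forall>r\<in>(\<lambda>s. ?N g0 s / ?D g0 s) ` {0..1}. norm r \<le> K"
    unfolding bounded_iff by blast
  then have K: "?N g0 s / ?D g0 s \<le> K" if "s \<in> {0..1}" for s
  proof -
    have "norm (?N g0 s / ?D g0 s) \<le> K" by (rule bspec[OF K0 imageI[OF that]])
    then show ?thesis unfolding real_norm_def by linarith
  qed
  define f where "f j s = ?D (g j) s - ?D g0 s" for j s
  have f0: "0 \<le> f j s" if "s \<in> {0..1}" for j s
    unfolding f_def using metric_above.vol_density_le[OF above c z[OF that]] by simp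
  have contf: "continuous_on {0..1} (f j)" for j
    unfolding f_def by (intro continuous_on_diff contD metric base.riemannian_metric_axioms)
  have fint: "f j absolutely_integrable_on {0..1}" for j
    by (rule absolutely_integrable_continuous_real[OF contf])
  define I where "I j = integral {0..1} (f j)" for j
  have I0: "0 \<le> I j" for j unfolding I_def by (rule integral_nonneg)
    (use f0 integrable_continuous_real[OF contf] in auto)
  have Ieq: "(\<integral>\<^sup>+s\<in>{0..1}. ennreal (f j s) \<partial>lborel) = ennreal (I j)" for j
    unfolding I_def
  proof (rule absolutely_integrable_iff_nn_integral(2)[OF _ f0 fint])
    show "(\<lambda>s. indicator {0..1} s * f j s) \<in> borel_measurable borel"
      using borel_measurable_continuous_on_indicator[OF _ contf[of j]] by simp
  qed
  have "segment_integral (excess c) x y = (\<integral>\<^sup>+s. (\<Sum>j. ennreal (f j s) * indicator {0..1} s) \<partial>lborel)"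
    unfolding segment_integral_def
  proof (intro nn_integral_cong)
    fix s :: real
    show "excess c (?z s) * indicator {0..1} s = (\<Sum>j. ennreal (f j s) * indicator {0..1} s)"
      using z[of s] by (cases "s \<in> {0..1}") (simp_all add: excess_def f_def)
  qed
  also have "\<dots> = (\<Sum>j. \<integral>\<^sup>+s\<in>{0..1}. ennreal (f j s) \<partial>lborel)"
  proof (rule nn_integral_suminf)
    fix j
    have "(\<lambda>s. indicator {0..1} s * f j s) \<in> borel_measurable borel"
      using borel_measurable_continuous_on_indicator[OF _ contf[of j]] by simp
    then have "(\<lambda>s. ennreal (indicator {0..1} s * f j s)) \<in> borel_measurable lborel" by simp
    moreover have "(\<lambda>s. ennreal (indicator {0..1} s * f j s)) = (\<lambda>s. ennreal (f j s) * indicator {0..1} s)"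
      by (auto simp: indicator_def)
    ultimately show "(\<lambda>s. ennreal (f j s) * indicator {0..1} s) \<in> borel_measurable lborel" by simp
  qed
  also have "\<dots> = (\<Sum>j. ennreal (I j))" by (simp add: Ieq)
  finally have "(\<Sum>j. ennreal (I j)) \<noteq> top" using fin by (simp add: less_top)
  then have "summable I" by (intro summable_suminf_not_top I0)
  then have "I \<longlonglongrightarrow> 0" by (rule summable_LIMSEQ_zero)
  then have lim: "(\<lambda>j. riem_length A g0 (base.segment c x y) + K * I j) \<longlonglongrightarrow> riem_length A g0 (base.segment c x y) + K * 0"
    by (intro tendsto_intros)
  have le: "riem_length A (g j) (base.segment c x y) \<le> riem_length A g0 (base.segment c x y) + K * I j" for j
  proof -
    have "riem_length A (g j) (base.segment c x y) = integral {0..1} (?N (g j))"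
      by (rule riemannian_metric.riem_length_segment(2)[OF metric c seg])
    also have "\<dots> \<le> integral {0..1} (\<lambda>s. ?N g0 s + K * f j s)"
    proof (rule integral_le)
      show "?N (g j) integrable_on {0..1}" by (intro integrable_continuous_real contN metric)
      show "(\<lambda>s. ?N g0 s + K * f j s) integrable_on {0..1}"
        by (intro integrable_continuous_real continuous_on_add continuous_on_mult continuous_on_const
            contN contf base.riemannian_metric_axioms)
      fix s :: real assume s: "s \<in> {0..1}"
      have "?D g0 s * ?N (g j) s \<le> ?D (g j) s * ?N g0 s"
        by (rule metric_above.norm_le_density_ratio[OF above c z[OF s]])
      then have "?N (g j) s \<le> (?D (g j) s / ?D g0 s) * ?N g0 s"
        using D0[OF s] by (simp add: pos_le_divide_eq mult.commute)
      also have "\<dots> = ?N g0 s + (?N g0 s / ?D g0 s) * f j s"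
        using D0[OF s] by (simp add: f_def field_simps)
      also have "\<dots> \<le> ?N g0 s + K * f j s"
        by (intro add_left_mono mult_right_mono K f0 s)
      finally show "?N (g j) s \<le> ?N g0 s + K * f j s" .
    qed
    also have "\<dots> = integral {0..1} (?N g0) + integral {0..1} (\<lambda>s. K * f j s)"
      by (intro Henstock_Kurzweil_Integration.integral_add integrable_continuous_real continuous_on_mult
          continuous_on_const contN contf base.riemannian_metric_axioms)
    also have "\<dots> = riem_length A g0 (base.segment c x y) + K * I j"
      by (simp add: I_def base.riem_length_segment(2)[OF c seg])
    finally show ?thesis .
  qed
  show ?thesis
  proof (rule tendsto_sandwich[OF _ _ tendsto_const])
    show "(\<lambda>j. riem_length A g0 (base.segment c x y) + K * I j) \<longlonglongrightarrow> riem_length A g0 (base.segment c x y)"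
      using lim by simp
    show "\<forall>\<^sub>F j in sequentially. riem_length A g0 (base.segment c x y) \<le> riem_length A (g j) (base.segment c x y)"
      by (intro always_eventually allI metric_above.riem_length_le[OF above] base.piecewise_smooth_segment c seg)
    show "\<forall>\<^sub>F j in sequentially. riem_length A (g j) (base.segment c x y) \<le> riem_length A g0 (base.segment c x y) + K * I j"
      by (intro always_eventually allI le)
  qed
qed

text \<open>One curve has to serve for all \<open>j\<close>. Its \<open>g j\<close>-length bounds
  the \<open>j\<close>-th distance, so \<open>b\<close> bounds the upper limit of the distances;
  concatenation adds the bounds.\<close>

definition connects :: "'a \<Rightarrow> 'a \<Rightarrow> real \<Rightarrow> bool" where
  "connects p q b \<longleftrightarrow> (\<exists>C. piecewise_smooth_curve A C \<and> C 0 = p \<and> C 1 = q \<and> riem_length A g0 C \<le> b \<and>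
     (\<lambda>j. riem_length A (g j) C) \<longlonglongrightarrow> riem_length A g0 C)"

lemma connects_mono: "connects p q b \<Longrightarrow> b \<le> b' \<Longrightarrow> connects p q b'"
  unfolding connects_def by force

lemma connects_trans:
  assumes "connects p q b" "connects q r b'"
  shows "connects p r (b + b')"
proof -
  obtain C where C: "piecewise_smooth_curve A C" "C 0 = p" "C 1 = q" "riem_length A g0 C \<le> b"
      "(\<lambda>j. riem_length A (g j) C) \<longlonglongrightarrow> riem_length A g0 C"
    using assms(1) unfolding connects_def by blast
  obtain C' where C': "piecewise_smooth_curve A C'" "C' 0 = q" "C' 1 = r" "riem_length A g0 C' \<le> b'"
      "(\<lambda>j. riem_length A (g j) C') \<longlonglongrightarrow> riem_length A g0 C'"
    using assms(2) unfolding connects_def by blast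
  have join: "C 1 = C' 0" using C C' by simp
  show ?thesis unfolding connects_def
  proof (intro exI[of _ "C +++ C'"] conjI)
    show "piecewise_smooth_curve A (C +++ C')"
      by (rule base.piecewise_smooth_curve_join[OF C(1) C'(1) join])
    show "(C +++ C') 0 = p" "(C +++ C') 1 = r" using C C' by (simp_all add: joinpaths_def)
    show "riem_length A g0 (C +++ C') \<le> b + b'"
      using C(4) C'(4) by (simp add: base.riem_length_join[OF C(1) C'(1) join])
    show "(\<lambda>j. riem_length A (g j) (C +++ C')) \<longlonglongrightarrow> riem_length A g0 (C +++ C')"
      unfolding base.riem_length_join[OF C(1) C'(1) join]
        riemannian_metric.riem_length_join[OF metric C(1) C'(1) join]
      by (intro tendsto_add C(5) C'(5))
  qed
qed

lemma connects_segment: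
  assumes c: "c \<in> A" and seg: "closed_segment (snd c p) (snd c q) \<subseteq> snd c ` fst c"
    and pq: "p \<in> fst c" "q \<in> fst c" and fin: "segment_integral (excess c) (snd c p) (snd c q) < \<infinity>"
    and b: "riem_length A g0 (base.segment c (snd c p) (snd c q)) \<le> b"
  shows "connects p q b"
  unfolding connects_def
proof (intro exI conjI)
  show "base.segment c (snd c p) (snd c q) 0 = p" "base.segment c (snd c p) (snd c q) 1 = q"
    using pq by (simp_all add: base.segment_def base.chart_inv_chart[OF c])
qed (intro base.piecewise_smooth_segment riem_length_segment_tendsto assms)+

text \<open>Goodness of a point refers to finitely many charts only, since otherwise the union of the
  exceptional null sets could fail to be null.\<close>

definition subatlas :: "('a, 'n) chart set" where
  "subatlas = (SOME F. finite F \<and> F \<subseteq> A \<and> (\<Union>c\<in>F. fst c) = UNIV)"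

lemma finite_subatlas: "finite subatlas" and subatlas_in: "c \<in> subatlas \<Longrightarrow> c \<in> A"
  and subatlas_UN: "(\<Union>c\<in>subatlas. fst c) = UNIV"
proof -
  obtain F where "finite F" "F \<subseteq> A" "(\<Union>c\<in>F. fst c) = UNIV" using base.finite_subatlas .
  then have "\<exists>F. finite F \<and> F \<subseteq> A \<and> (\<Union>c\<in>F. fst c) = UNIV" by auto
  from someI_ex[OF this] show "finite subatlas" "c \<in> subatlas \<Longrightarrow> c \<in> A" "(\<Union>c\<in>subatlas. fst c) = UNIV"
    unfolding subatlas_def by auto
qed

lemma subatlas_chart_at: obtains c where "c \<in> subatlas" "p \<in> fst c"
  using subatlas_UN by blast

text \<open>A condition on a single end point, to which \<open>segment_integral_AE_finite\<close>
  applies: almost every second end point then gives an admissible segment.\<close>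

definition good :: "'a \<Rightarrow> bool" where
  "good p \<longleftrightarrow> (\<forall>c\<in>subatlas. p \<in> fst c \<longrightarrow> (AE y in lborel. segment_integral (excess c) (snd c p) y < \<infinity>))"

lemma AE_good: "AE p in riem_volume A g0. good p"
  unfolding good_def
proof (rule AE_finite_allI[OF finite_subatlas])
  fix c assume "c \<in> subatlas"
  then have c: "c \<in> A" by (rule subatlas_in)
  have "AE x in lborel. AE y in lborel. segment_integral (excess c) x y < \<infinity>"
    by (rule segment_integral_AE_finite[OF excess_measurable[OF c] nn_integral_excess[OF c]])
  then have "AE x in lborel. x \<in> snd c ` fst c \<longrightarrow> (AE y in lborel. segment_integral (excess c) x y < \<infinity>)"
    by eventually_elim simp
  then show "AE p in riem_volume A g0. p \<in> fst c \<longrightarrow> (AE y in lborel. segment_integral (excess c) (snd c p) y < \<infinity>)"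
    by (rule base.AE_V_chart[OF c, THEN iffD2])
qed

text \<open>In the chart, almost every point satisfies \<open>P\<close> and is admissible as second
  end point from the good point \<open>y\<close>; the open set in question must contain one.
  \<open>P\<close> stays arbitrary because it will be goodness for intermediate vertices, and
  compatibility with the prescribed end point for the last one.\<close>

lemma connects_near:
  assumes c: "c \<in> subatlas" and y: "good y" "y \<in> fst c" and z: "z \<in> fst c"
    and W: "open W" "z \<in> W" and P: "AE p in riem_volume A g0. P p"
    and B: "convex B" "B \<subseteq> snd c ` fst c" "snd c y \<in> B"
    and U: "open U" "U \<subseteq> B" "snd c z \<in> U"
    and len: "\<And>x. x \<in> U \<Longrightarrow> riem_length A g0 (base.segment c (snd c y) x) \<le> b"
  obtains y' where "y' \<in> W" "P y'" "y' \<in> fst c" "snd c y' \<in> U" "connects y y' b"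
proof -
  have cA: "c \<in> A" by (rule subatlas_in[OF c])
  let ?O = "U \<inter> snd c ` (W \<inter> fst c)"
  have op: "open ?O"
    by (intro open_Int U base.open_chart_image_of cA W base.open_chart_domain) auto
  have ne: "?O \<noteq> {}" using U W z by blast
  have "AE x in lborel. x \<in> snd c ` fst c \<longrightarrow> P (chart_inv c x)"
  proof (rule base.AE_V_chart[OF cA, THEN iffD1])
    show "AE p in riem_volume A g0. p \<in> fst c \<longrightarrow> P (chart_inv c (snd c p))"
      using P by eventually_elim (simp add: base.chart_inv_chart[OF cA])
  qed
  moreover have "AE x in lborel. segment_integral (excess c) (snd c y) x < \<infinity>"
    using y c unfolding good_def by blast
  ultimately have "AE x in lborel. (x \<in> snd c ` fst c \<longrightarrow> P (chart_inv c x)) \<and>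
      segment_integral (excess c) (snd c y) x < \<infinity>"
    by (rule AE_conjI)
  then obtain x where x: "x \<in> ?O"
      "(x \<in> snd c ` fst c \<longrightarrow> P (chart_inv c x)) \<and> segment_integral (excess c) (snd c y) x < \<infinity>"
    using op ne by (rule AE_lborel_open_witness)
  from x(1) obtain y' where y': "y' \<in> W" "y' \<in> fst c" "x = snd c y'" by blast
  have yU: "snd c y' \<in> U" using IntD1[OF x(1)] y'(3) by simp
  have seg: "closed_segment (snd c y) (snd c y') \<subseteq> snd c ` fst c"
  proof -
    have "snd c y' \<in> B" using yU U(2) by (rule rev_subsetD)
    from closed_segment_subset[OF B(3) this B(1)] B(2) show ?thesis by (rule order_trans)
  qed
  show thesis
  proof (rule that[of y'])
    show "P y'" using x(2) y'(2) unfolding y'(3) by (simp add: base.chart_inv_chart[OF cA y'(2)])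
    have "segment_integral (excess c) (snd c y) (snd c y') < \<infinity>" using x(2) y'(3) by simp
    then show "connects y y' b"
      by (rule connects_segment[OF cA seg y(2) y'(2)]) (rule len[OF yU])
  qed (rule y' yU)+
qed

end

subsection \<open>Approximation of curves by chains of segments\<close>

context metrics_above
begin

text \<open>On the ball, \<open>g0\<close> is within a factor \<open>1 + \<epsilon>\<close> of the
  constant inner product at its centre. The chart is taken from \<open>subatlas\<close> so that
  goodness applies in it.\<close>

definition almost_flat :: "real \<Rightarrow> ('a, 'n) chart \<Rightarrow> 'a \<Rightarrow> real \<Rightarrow> bool" where
  "almost_flat \<epsilon> c p \<delta> \<longleftrightarrow> c \<in> subatlas \<and> p \<in> fst c \<and> 0 < \<delta> \<and> ball (snd c p) \<delta> \<subseteq> snd c ` fst c \<and>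
     (\<forall>x\<in>ball (snd c p) \<delta>. \<forall>v.
        matrix_norm (gram_matrix A g0 c x) v \<le> (1 + \<epsilon>) * matrix_norm (gram_matrix A g0 c (snd c p)) v \<and>
        matrix_norm (gram_matrix A g0 c (snd c p)) v \<le> (1 + \<epsilon>) * matrix_norm (gram_matrix A g0 c x) v)"

lemma almost_flat_ex:
  assumes "0 < \<epsilon>"
  obtains c \<delta> where "almost_flat \<epsilon> c p \<delta>"
proof -
  obtain c where c: "c \<in> subatlas" "p \<in> fst c" using subatlas_chart_at .
  obtain \<delta> where "0 < \<delta>" "ball (snd c p) \<delta> \<subseteq> snd c ` fst c"
    "\<And>x v. x \<in> ball (snd c p) \<delta> \<Longrightarrow> matrix_norm (gram_matrix A g0 c x) v \<le> (1 + \<epsilon>) * matrix_norm (gram_matrix A g0 c (snd c p)) v"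
    "\<And>x v. x \<in> ball (snd c p) \<delta> \<Longrightarrow> matrix_norm (gram_matrix A g0 c (snd c p)) v \<le> (1 + \<epsilon>) * matrix_norm (gram_matrix A g0 c x) v"
    using base.gram_matrix_close[OF subatlas_in[OF c(1)] imageI[OF c(2)] assms] by blast
  then have "almost_flat \<epsilon> c p \<delta>" using c unfolding almost_flat_def by simp
  then show thesis by (rule that)
qed

context
  fixes \<epsilon> c p0 \<delta>
  assumes flat: "almost_flat \<epsilon> c p0 \<delta>" and \<epsilon>: "0 < \<epsilon>"
begin

private abbreviation "M \<equiv> gram_matrix A g0 c (snd c p0)"
private abbreviation "B \<equiv> ball (snd c p0) \<delta>"

lemma flat_chart: "c \<in> subatlas" "c \<in> A" "p0 \<in> fst c" "0 < \<delta>" "B \<subseteq> snd c ` fst c"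
  using flat subatlas_in unfolding almost_flat_def by blast+

lemma flat_le: "x \<in> B \<Longrightarrow> matrix_norm (gram_matrix A g0 c x) v \<le> (1 + \<epsilon>) * matrix_norm M v"
  and flat_ge: "x \<in> B \<Longrightarrow> matrix_norm M v \<le> (1 + \<epsilon>) * matrix_norm (gram_matrix A g0 c x) v"
  using flat unfolding almost_flat_def by blast+

lemma psd_M: "psd_matrix M"
  by (rule pd_imp_psd[OF base.pd_gram_matrix]) (use flat_chart in auto)

lemma flat_segment_length:
  assumes "x \<in> B" "y \<in> B"
  shows "riem_length A g0 (base.segment c x y) \<le> (1 + \<epsilon>) * matrix_norm M (y - x)"
proof -
  have "closed_segment x y \<subseteq> B" using assms by (intro closed_segment_subset convex_ball)
  then show ?thesis
    using flat_chart flat_le by (intro base.riem_length_segment_le) auto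
qed

lemma flat_scale:
  assumes "0 < \<eta>"
  obtains \<rho> where "0 < \<rho>" "\<And>v. norm v < \<rho> \<Longrightarrow> (1 + \<epsilon>) * matrix_norm M v \<le> \<eta>"
proof -
  define K where "K = sqrt (real CARD('n) * norm M)"
  have K: "0 \<le> K" by (simp add: K_def)
  have pos: "0 < (1 + \<epsilon>) * (K + 1)" using K \<epsilon> by (intro mult_pos_pos) auto
  show thesis
  \<comment> \<open>The added 1 keeps the denominator positive without a lower bound for
    \<open>K\<close>.\<close>
  proof (rule that[of "\<eta> / ((1 + \<epsilon>) * (K + 1))"])
    show "0 < \<eta> / ((1 + \<epsilon>) * (K + 1))" using assms pos by simp
    fix v :: "(real, 'n) vec"
    assume v: "norm v < \<eta> / ((1 + \<epsilon>) * (K + 1))"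
    have "matrix_norm M v \<le> K * norm v" unfolding K_def by (rule matrix_norm_bound)
    also have "\<dots> \<le> (K + 1) * norm v" by (intro mult_right_mono) auto
    finally have "(1 + \<epsilon>) * matrix_norm M v \<le> (1 + \<epsilon>) * ((K + 1) * norm v)"
      using \<epsilon> by (intro mult_left_mono) auto
    also have "\<dots> = norm v * ((1 + \<epsilon>) * (K + 1))" by (simp add: mult_ac)
    also have "\<dots> \<le> \<eta>" using v pos by (simp add: pos_less_divide_eq)
    finally show "(1 + \<epsilon>) * matrix_norm M v \<le> \<eta>" .
  qed
qed

text \<open>The target \<open>z\<close> itself may be inadmissible, so the hop ends at a generic
  point so close to \<open>z\<close> that the triangle inequality costs at most
  \<open>\<eta>\<close>.\<close>

lemma flat_hop:
  assumes y: "good y" "y \<in> fst c" "snd c y \<in> B" and z: "z \<in> fst c" "snd c z \<in> B"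
    and W: "open W" "z \<in> W" and P: "AE p in riem_volume A g0. P p" and \<eta>: "0 < \<eta>"
  obtains y' where "y' \<in> W" "P y'" "connects y y' ((1 + \<epsilon>) * matrix_norm M (snd c z - snd c y) + \<eta>)"
proof -
  obtain \<rho> where \<rho>: "0 < \<rho>" "\<And>v. norm v < \<rho> \<Longrightarrow> (1 + \<epsilon>) * matrix_norm M v \<le> \<eta>"
    using flat_scale[OF \<eta>] by blast
  have len: "riem_length A g0 (base.segment c (snd c y) x) \<le> (1 + \<epsilon>) * matrix_norm M (snd c z - snd c y) + \<eta>"
    if x: "x \<in> ball (snd c z) \<rho> \<inter> B" for x
  proof -
    have "norm (x - snd c z) < \<rho>" using x by (simp add: dist_norm norm_minus_commute)
    from \<rho>(2)[OF this] have 1: "(1 + \<epsilon>) * matrix_norm M (x - snd c z) \<le> \<eta>" .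
    have "riem_length A g0 (base.segment c (snd c y) x) \<le> (1 + \<epsilon>) * matrix_norm M (x - snd c y)"
      using x y(3) by (intro flat_segment_length) auto
    also have "\<dots> = (1 + \<epsilon>) * matrix_norm M ((snd c z - snd c y) + (x - snd c z))" by simp
    also have "\<dots> \<le> (1 + \<epsilon>) * (matrix_norm M (snd c z - snd c y) + matrix_norm M (x - snd c z))"
      using \<epsilon> by (intro mult_left_mono matrix_norm_triangle psd_M) auto
    also have "\<dots> \<le> (1 + \<epsilon>) * matrix_norm M (snd c z - snd c y) + \<eta>"
      using 1 by (simp add: distrib_left)
    finally show ?thesis .
  qed
  show thesis
  proof (rule connects_near[OF flat_chart(1) y(1,2) z(1) W P convex_ball flat_chart(5) y(3) _ _ _ len])
    show "open (ball (snd c z) \<rho> \<inter> B)" by (intro open_Int open_ball)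
    show "ball (snd c z) \<rho> \<inter> B \<subseteq> B" by (rule Int_lower2)
    show "snd c z \<in> ball (snd c z) \<rho> \<inter> B" using z(2) \<rho>(1) by simp
    fix y' assume "y' \<in> W" "P y'" "connects y y' ((1 + \<epsilon>) * matrix_norm M (snd c z - snd c y) + \<eta>)"
    then show thesis by (rule that)
  qed
qed

lemma open_flat_nbhd: "open U \<Longrightarrow> open (fst c \<inter> snd c -` (U \<inter> B))"
  by (intro continuous_open_preimage base.continuous_on_chart base.open_chart_domain open_Int open_ball flat_chart)

end

text \<open>The induction statement along the curve. The vertex near \<open>C t\<close> may be
  required to have any almost sure property, since the next hop dictates which one is needed; and as
  \<open>\<eta>\<close> is arbitrary, each hop can demand a smaller error from the earlier part. One
  factor \<open>1 + \<epsilon>\<close> comes from replacing the curve by chords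
  (\<open>chord_le\<close>), the other from the length of the segments
  (\<open>flat_segment_length\<close>).\<close>

definition reaches :: "real \<Rightarrow> (real \<Rightarrow> 'a) \<Rightarrow> real \<Rightarrow> bool" where
  "reaches \<epsilon> C t \<longleftrightarrow> (\<forall>P W \<eta>. (AE p in riem_volume A g0. P p) \<longrightarrow> open W \<longrightarrow> C t \<in> W \<longrightarrow> 0 < \<eta> \<longrightarrow>
     (\<exists>y. y \<in> W \<and> P y \<and> connects (C 0) y ((1 + \<epsilon>)\<^sup>2 * integral {0..t} (base.speed C) + \<eta>)))"

lemma reachesD:
  assumes "reaches \<epsilon> C t" "AE p in riem_volume A g0. P p" "open W" "C t \<in> W" "0 < \<eta>"
  obtains y where "y \<in> W" "P y" "connects (C 0) y ((1 + \<epsilon>)\<^sup>2 * integral {0..t} (base.speed C) + \<eta>)"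
  using assms unfolding reaches_def by blast

text \<open>\<open>C 0\<close> itself may fail \<open>P\<close>, so even here a hop to a nearby
  generic point is made, at a cost of at most \<open>\<eta>\<close>.\<close>

lemma reaches_0:
  assumes \<epsilon>: "0 < \<epsilon>" and "good (C 0)"
  shows "reaches \<epsilon> C 0"
  unfolding reaches_def
proof (intro allI impI)
  fix P W and \<eta> :: real
  assume P: "AE p in riem_volume A g0. P p" and W: "open W" "C 0 \<in> W" and \<eta>: "0 < \<eta>"
  obtain c \<delta> where flat: "almost_flat \<epsilon> c (C 0) \<delta>" using almost_flat_ex[OF \<epsilon>] by blast
  have 0: "C 0 \<in> fst c" "snd c (C 0) \<in> ball (snd c (C 0)) \<delta>"
    using flat by (simp_all add: almost_flat_def)
  obtain y where y: "y \<in> W" "P y" "connects (C 0) y ((1 + \<epsilon>) *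
      matrix_norm (gram_matrix A g0 c (snd c (C 0))) (snd c (C 0) - snd c (C 0)) + \<eta>)"
    using flat_hop[OF flat \<epsilon> assms(2) 0 0 W P \<eta>] by blast
  then show "\<exists>y. y \<in> W \<and> P y \<and> connects (C 0) y ((1 + \<epsilon>)\<^sup>2 * integral {0..0} (base.speed C) + \<eta>)"
    by (intro exI[of _ y]) (simp add: matrix_norm_def)
qed

lemma reaches_step:
  assumes C: "piecewise_smooth_curve A C" and \<epsilon>: "0 < \<epsilon>" and flat: "almost_flat \<epsilon> c p0 \<delta>"
    and ab: "0 \<le> a" "a \<le> b" "b \<le> 1"
    and dom: "\<And>s. s \<in> {a..b} \<Longrightarrow> C s \<in> fst c \<inter> snd c -` ball (snd c p0) \<delta>"
    and a: "reaches \<epsilon> C a"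
  shows "reaches \<epsilon> C b"
  unfolding reaches_def
proof (intro allI impI)
  fix P W and \<eta> :: real
  assume P: "AE p in riem_volume A g0. P p" and W: "open W" "C b \<in> W" and \<eta>: "0 < \<eta>"
  let ?M = "gram_matrix A g0 c (snd c p0)" and ?B = "ball (snd c p0) \<delta>"
  let ?I = "\<lambda>u v. integral {u..v} (base.speed C)"
  note psd = psd_M[OF flat \<epsilon>]
  \<comment> \<open>One third is for reaching a vertex \<open>y\<close> near \<open>C a\<close>, one
    for the distance from \<open>y\<close> to \<open>C a\<close>, one for missing
    \<open>C b\<close>.\<close>
  have \<eta>3: "0 < \<eta> / 3" using \<eta> by simp
  obtain \<rho> where \<rho>: "0 < \<rho>" "\<And>v. norm v < \<rho> \<Longrightarrow> (1 + \<epsilon>) * matrix_norm ?M v \<le> \<eta> / 3"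
    using flat_scale[OF flat \<epsilon> \<eta>3] by blast
  have Ca: "C a \<in> fst c" "snd c (C a) \<in> ?B" and Cb: "C b \<in> fst c" "snd c (C b) \<in> ?B"
    using dom[of a] dom[of b] ab by auto
  let ?W = "fst c \<inter> snd c -` (ball (snd c (C a)) \<rho> \<inter> ?B)"
  have "C a \<in> ?W" using Ca \<rho>(1) by simp
  \<comment> \<open>Goodness is requested of the vertex, since the next hop has to start at a good
    point.\<close>
  then obtain y where y: "y \<in> ?W" "good y" "connects (C 0) y ((1 + \<epsilon>)\<^sup>2 * ?I 0 a + \<eta> / 3)"
    using reachesD[OF a AE_good open_flat_nbhd[OF flat \<epsilon> open_ball] _ \<eta>3] by blast
  have yc: "y \<in> fst c" "snd c y \<in> ?B" and "snd c y \<in> ball (snd c (C a)) \<rho>" using y(1) by auto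
  then have "norm (snd c (C a) - snd c y) < \<rho>" by (simp add: dist_norm)
  from \<rho>(2)[OF this] have near: "(1 + \<epsilon>) * matrix_norm ?M (snd c (C a) - snd c y) \<le> \<eta> / 3" .
  obtain y' where y': "y' \<in> W" "P y'"
    "connects y y' ((1 + \<epsilon>) * matrix_norm ?M (snd c (C b) - snd c y) + \<eta> / 3)"
    using flat_hop[OF flat \<epsilon> y(2) yc Cb W P \<eta>3] by blast
  have chord: "matrix_norm ?M (snd c (C b) - snd c (C a)) \<le> (1 + \<epsilon>) * ?I a b"
  proof (rule base.chord_le[OF C flat_chart(2)[OF flat \<epsilon>] ab _ psd])
    show "C s \<in> fst c" if "s \<in> {a..b}" for s using dom[OF that] by simp
    show "matrix_norm ?M v \<le> (1 + \<epsilon>) * matrix_norm (gram_matrix A g0 c (snd c (C s))) v"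
      if "s \<in> {a..b}" for s v using flat_ge[OF flat \<epsilon>] dom[OF that] by simp
  qed (use \<epsilon> in simp)
  have "(1 + \<epsilon>) * matrix_norm ?M (snd c (C b) - snd c y) =
      (1 + \<epsilon>) * matrix_norm ?M ((snd c (C b) - snd c (C a)) + (snd c (C a) - snd c y))" by simp
  also have "\<dots> \<le> (1 + \<epsilon>) * (matrix_norm ?M (snd c (C b) - snd c (C a)) + matrix_norm ?M (snd c (C a) - snd c y))"
    using \<epsilon> by (intro mult_left_mono matrix_norm_triangle psd) auto
  also have "\<dots> \<le> (1 + \<epsilon>) * ((1 + \<epsilon>) * ?I a b) + \<eta> / 3"
  proof -
    have "(1 + \<epsilon>) * matrix_norm ?M (snd c (C b) - snd c (C a)) \<le> (1 + \<epsilon>) * ((1 + \<epsilon>) * ?I a b)"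
      using \<epsilon> chord by (intro mult_left_mono) auto
    then show ?thesis using near by (simp add: distrib_left)
  qed
  finally have hop: "(1 + \<epsilon>) * matrix_norm ?M (snd c (C b) - snd c y) \<le> (1 + \<epsilon>)\<^sup>2 * ?I a b + \<eta> / 3"
    by (simp add: power2_eq_square mult.assoc)
  have "?I 0 a + ?I a b = ?I 0 b"
  proof (rule Henstock_Kurzweil_Integration.integral_combine)
    show "base.speed C integrable_on {0..b}"
      by (rule integrable_subinterval_real[OF base.speed_integrable[OF C]]) (use ab in auto)
  qed (use ab in auto)
  then have eq: "(1 + \<epsilon>)\<^sup>2 * ?I 0 b = (1 + \<epsilon>)\<^sup>2 * ?I 0 a + (1 + \<epsilon>)\<^sup>2 * ?I a b"
    by (metis distrib_left)
  have "connects (C 0) y' ((1 + \<epsilon>)\<^sup>2 * ?I 0 b + \<eta>)"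
    by (rule connects_mono[OF connects_trans[OF y(3) y'(3)]]) (use hop eq in simp)
  then show "\<exists>y. y \<in> W \<and> P y \<and> connects (C 0) y ((1 + \<epsilon>)\<^sup>2 * ?I 0 b + \<eta>)"
    using y' by blast
qed

text \<open>\<open>Bolzano\<close> passes from local to global by bisection: the implication from
  \<open>reaches\<close> at \<open>a\<close> to \<open>reaches\<close> at \<open>b\<close> is
  transitive, and around each \<open>t\<close> it holds by \<open>reaches_step\<close> in one almost
  flat ball about \<open>C t\<close>. So no explicit subdivision of the curve is needed.\<close>

lemma reaches_1:
  assumes C: "piecewise_smooth_curve A C" and \<epsilon>: "0 < \<epsilon>" and "good (C 0)"
  shows "reaches \<epsilon> C 1"
proof -
  have "0 \<le> (0::real) \<and> (1::real) \<le> 1 \<longrightarrow> reaches \<epsilon> C 0 \<longrightarrow> reaches \<epsilon> C 1"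
  proof (rule Bolzano[of 0 1 "\<lambda>a b. 0 \<le> a \<and> b \<le> 1 \<longrightarrow> reaches \<epsilon> C a \<longrightarrow> reaches \<epsilon> C b"])
    fix t :: real assume t: "0 \<le> t" "t \<le> 1"
    obtain c \<delta> where flat: "almost_flat \<epsilon> c (C t) \<delta>" using almost_flat_ex[OF \<epsilon>] by blast
    let ?O = "fst c \<inter> snd c -` (UNIV \<inter> ball (snd c (C t)) \<delta>)"
    have "open ?O" by (rule open_flat_nbhd[OF flat \<epsilon> open_UNIV])
    moreover have "C t \<in> ?O" using flat by (simp add: almost_flat_def)
    moreover have "continuous_on {0..1} C" using C by (simp add: piecewise_smooth_curve_def)
    ultimately obtain T where T: "open T" "t \<in> T" "\<And>s. s \<in> {0..1} \<Longrightarrow> s \<in> T \<Longrightarrow> C s \<in> ?O"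
      unfolding continuous_on_topological using t by (meson atLeastAtMost_iff)
    obtain d where d: "0 < d" "ball t d \<subseteq> T" using T(1,2) open_contains_ball by blast
    have "reaches \<epsilon> C b" if ab: "a \<le> t" "t \<le> b" "b - a < d" "0 \<le> a" "b \<le> 1" and a: "reaches \<epsilon> C a" for a b
    proof (rule reaches_step[OF C \<epsilon> flat _ _ _ _ a])
      fix s assume "s \<in> {a..b}"
      then have "s \<in> {0..1}" "s \<in> ball t d" using ab by (auto simp: dist_real_def)
      then show "C s \<in> fst c \<inter> snd c -` ball (snd c (C t)) \<delta>" using T(3)[of s] d(2) by blast
    qed (use ab in auto)
    then show "\<exists>d>0. \<forall>a b. a \<le> t \<and> t \<le> b \<and> b - a < d \<longrightarrow>
        0 \<le> a \<and> b \<le> 1 \<longrightarrow> reaches \<epsilon> C a \<longrightarrow> reaches \<epsilon> C b"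
      using d(1) by blast
  qed auto
  then show ?thesis using reaches_0[of \<epsilon> C] \<epsilon> assms(3) by simp
qed

text \<open>The last segment must end at \<open>C 1\<close>. Goodness of \<open>C 1\<close> and
  symmetry of the segment integral show that almost every \<open>y\<close> in the chart is an
  admissible starting point; this property is handed to \<open>reaches\<close> as
  \<open>P\<close>.\<close>

lemma connects_along_curve:
  assumes C: "piecewise_smooth_curve A C" and good: "good (C 0)" "good (C 1)" and \<epsilon>: "0 < \<epsilon>" and \<eta>: "0 < \<eta>"
  shows "connects (C 0) (C 1) ((1 + \<epsilon>)\<^sup>2 * riem_length A g0 C + \<eta>)"
proof -
  obtain c \<delta> where flat: "almost_flat \<epsilon> c (C 1) \<delta>" using almost_flat_ex[OF \<epsilon>] by blast
  let ?q = "snd c (C 1)"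
  note c = flat_chart[OF flat \<epsilon>]
  have \<eta>2: "0 < \<eta> / 2" using \<eta> by simp
  obtain \<rho> where \<rho>: "0 < \<rho>" "\<And>v. norm v < \<rho> \<Longrightarrow> (1 + \<epsilon>) * matrix_norm (gram_matrix A g0 c ?q) v \<le> \<eta> / 2"
    using flat_scale[OF flat \<epsilon> \<eta>2] by blast
  let ?P = "\<lambda>y. y \<in> fst c \<longrightarrow> segment_integral (excess c) (snd c y) ?q < \<infinity>"
  have "AE x in lborel. segment_integral (excess c) ?q x < \<infinity>"
    using good(2) c(1,3) unfolding good_def by blast
  then have "AE x in lborel. x \<in> snd c ` fst c \<longrightarrow> segment_integral (excess c) x ?q < \<infinity>"
    by eventually_elim (simp add: segment_integral_commute[OF excess_measurable[OF c(2)], of ?q])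
  then have P: "AE y in riem_volume A g0. ?P y"
    by (rule base.AE_V_chart[OF c(2), THEN iffD2])
  let ?W = "fst c \<inter> snd c -` (ball ?q \<rho> \<inter> ball ?q \<delta>)"
  have "C 1 \<in> ?W" using c(3,4) \<rho>(1) by simp
  then obtain y where y: "y \<in> ?W" "?P y"
      "connects (C 0) y ((1 + \<epsilon>)\<^sup>2 * integral {0..1} (base.speed C) + \<eta> / 2)"
    using reachesD[OF reaches_1[OF C \<epsilon> good(1)] P open_flat_nbhd[OF flat \<epsilon> open_ball] _ \<eta>2] by blast
  have yc: "y \<in> fst c" "snd c y \<in> ball ?q \<delta>" and "snd c y \<in> ball ?q \<rho>" using y(1) by auto
  then have "norm (?q - snd c y) < \<rho>" by (simp add: dist_norm)
  note near = \<rho>(2)[OF this]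
  have qB: "?q \<in> ball ?q \<delta>" using c(4) by simp
  have "connects y (C 1) (\<eta> / 2)"
  proof (rule connects_segment[OF c(2) _ yc(1) c(3)])
    have "closed_segment (snd c y) ?q \<subseteq> ball ?q \<delta>"
      by (intro closed_segment_subset convex_ball yc qB)
    then show "closed_segment (snd c y) ?q \<subseteq> snd c ` fst c" using c(5) by (rule order_trans)
    show "segment_integral (excess c) (snd c y) ?q < \<infinity>" using y(2) yc(1) by blast
    show "riem_length A g0 (base.segment c (snd c y) ?q) \<le> \<eta> / 2"
      using flat_segment_length[OF flat \<epsilon> yc(2) qB] near by (rule order_trans)
  qed
  from connects_trans[OF y(3) this] show ?thesis
    by (rule connects_mono) (simp add: base.riem_length_eq)
qed

lemma riem_dist_tendsto:
  assumes good: "good p" "good q"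
  shows "(\<lambda>j. riem_dist A (g j) p q) \<longlonglongrightarrow> riem_dist A g0 p q"
proof (cases "\<exists>C. piecewise_smooth_curve A C \<and> C 0 = p \<and> C 1 = q")
  case False
  then have "{riem_length A h C |C. piecewise_smooth_curve A C \<and> C 0 = p \<and> C 1 = q} = {}" for h by blast
  \<comment> \<open>Without a connecting curve every metric gives the same default value, so the
    sequence is constant.\<close>
  then have "riem_dist A h p q = Inf {}" for h unfolding riem_dist_def by (rule arg_cong)
  then show ?thesis by simp
next
  case True
  let ?L = "\<lambda>h. {riem_length A h C |C. piecewise_smooth_curve A C \<and> C 0 = p \<and> C 1 = q}"
  have bdd: "bdd_below (?L (g j))" for j
    using riemannian_metric.riem_length_nonneg[OF metric] by (intro bdd_belowI[of _ 0]) auto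
  show ?thesis
  proof (rule order_tendstoI)
    fix l assume l: "l < riem_dist A g0 p q"
    have "l < riem_dist A (g j) p q" for j
      using l metric_above.riem_dist_le[OF above True, of j] by linarith
    then show "\<forall>\<^sub>F j in sequentially. l < riem_dist A (g j) p q" by simp
  next
    fix u assume u: "riem_dist A g0 p q < u"
    then have "\<exists>r\<in>?L g0. r < u"
      unfolding riem_dist_def using True by (intro cInf_lessD) auto
    then obtain C where C: "piecewise_smooth_curve A C" "C 0 = p" "C 1 = q" "riem_length A g0 C < u"
      by blast
    \<comment> \<open>A single parameter serves as relative and as additive error; as it tends to 0,
      the bound tends to the length of \<open>C\<close>, which is below \<open>u\<close>.\<close>
    have "((\<lambda>\<epsilon>. (1 + \<epsilon>)\<^sup>2 * riem_length A g0 C + \<epsilon>) \<longlongrightarrow> (1 + 0)\<^sup>2 * riem_length A g0 C + 0) (at_right 0)"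
      by (intro tendsto_intros)
    then have "((\<lambda>\<epsilon>. (1 + \<epsilon>)\<^sup>2 * riem_length A g0 C + \<epsilon>) \<longlongrightarrow> riem_length A g0 C) (at_right 0)" by simp
    from order_tendstoD(2)[OF this C(4)]
    have "\<forall>\<^sub>F \<epsilon> in at_right 0. 0 < \<epsilon> \<and> (1 + \<epsilon>)\<^sup>2 * riem_length A g0 C + \<epsilon> < u"
      by (intro eventually_conj eventually_at_right_less)
    then obtain \<epsilon> where \<epsilon>: "0 < \<epsilon>" "(1 + \<epsilon>)\<^sup>2 * riem_length A g0 C + \<epsilon> < u"
      using eventually_happens'[OF trivial_limit_at_right_real] by blast
    have "connects p q ((1 + \<epsilon>)\<^sup>2 * riem_length A g0 C + \<epsilon>)"
      using connects_along_curve[OF C(1) _ _ \<epsilon>(1) \<epsilon>(1)] good C(2,3) by simp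
    then obtain D where D: "piecewise_smooth_curve A D" "D 0 = p" "D 1 = q"
        "riem_length A g0 D \<le> (1 + \<epsilon>)\<^sup>2 * riem_length A g0 C + \<epsilon>"
        "(\<lambda>j. riem_length A (g j) D) \<longlonglongrightarrow> riem_length A g0 D"
      unfolding connects_def by blast
    have "riem_length A g0 D < u" using D(4) \<epsilon>(2) by linarith
    from order_tendstoD(2)[OF D(5) this]
    show "\<forall>\<^sub>F j in sequentially. riem_dist A (g j) p q < u"
    proof eventually_elim
      case (elim j)
      have "riem_dist A (g j) p q \<le> riem_length A (g j) D"
        unfolding riem_dist_def using D(1-3) by (intro cInf_lower bdd) auto
      then show ?case using elim by simp
    qed
  qed
qed

end

section \<open>Almost all pairs, and the extraction of the subsequence\<close>

lemma AE_pair_both: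
  assumes "finite_measure M" "AE x in M. P x"
  shows "AE x in M \<Otimes>\<^sub>M M. P (fst x) \<and> P (snd x)"
proof -
  interpret finite_measure M by fact
  obtain N where N: "{x \<in> space M. \<not> P x} \<subseteq> N" "emeasure M N = 0" "N \<in> sets M"
    using assms(2) by (rule AE_E)
  have 1: "emeasure (M \<Otimes>\<^sub>M M) (N \<times> space M) = 0" and 2: "emeasure (M \<Otimes>\<^sub>M M) (space M \<times> N) = 0"
    using N(2,3) by (simp_all add: emeasure_pair_measure_Times)
  then have "N \<times> space M \<union> space M \<times> N \<in> null_sets (M \<Otimes>\<^sub>M M)"
    using N(3) by (intro null_sets.Un null_setsI pair_measureI) auto
  then show ?thesis
    by (rule AE_I') (use N(1) in \<open>auto simp: space_pair_measure\<close>)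
qed

lemma strict_mono_subseq_ex:
  assumes "\<And>k. \<forall>\<^sub>F j in sequentially. P k j"
  obtains r :: "nat \<Rightarrow> nat" where "strict_mono r" "\<And>k. P k (r k)"
proof -
  have "\<exists>m > n. P k m" for n k
    using eventually_conj[OF assms[of k] eventually_gt_at_top[of n]]
    by (auto simp: eventually_sequentially)
  then have "\<exists>r. \<forall>k. P k (r k) \<and> r k < r (Suc k)"
    by (intro dependent_nat_choice) blast+
  then show thesis using that by (auto simp: strict_mono_Suc_iff)
qed

lemma smooth_imp_continuous_riemannian_metric:
  "smooth_riemannian_metric A g \<Longrightarrow> continuous_riemannian_metric A g"
  unfolding smooth_riemannian_metric_def continuous_riemannian_metric_def
  using smooth_on_imp_continuous_on by blast

theorem theorem4p4:
  fixes A :: "('a::{t2_space,second_countable_topology}, 'n::{finite,wellorder}) chart set"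
    and g :: "nat \<Rightarrow> ('a, 'n) metric"
    and g0 :: "('a, 'n) metric"
  assumes "smooth_atlas A"
    and "compact (UNIV :: 'a set)"
    and "connected (UNIV :: 'a set)"
    and "smooth_riemannian_metric A g0"
    and "\<And>j. continuous_riemannian_metric A (g j)"
    and "\<And>j p v. v \<in> tangent_space A p \<Longrightarrow> g0 p v v \<le> g j p v v"
    and "(\<lambda>j. emeasure (riem_volume A (g j)) UNIV) \<longlonglongrightarrow> emeasure (riem_volume A g0) UNIV"
  shows "\<exists>r. strict_mono (r :: nat \<Rightarrow> nat) \<and>
    (AE x in riem_volume A g0 \<Otimes>\<^sub>M riem_volume A g0.
       (\<lambda>j. riem_dist A (g (r j)) (fst x) (snd x)) \<longlonglongrightarrow> riem_dist A g0 (fst x) (snd x))"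
proof -
  interpret base: riemannian_metric A g0
    by unfold_locales (intro assms(1,2) smooth_imp_continuous_riemannian_metric[OF assms(4)])+
  have above: "metric_above A g0 (g j)" for j
    by unfold_locales (auto intro: assms(5,6))
  let ?v = "\<lambda>h. emeasure (riem_volume A h) UNIV"
  have fin: "?v g0 \<noteq> top"
    using finite_measure.emeasure_finite[OF base.finite_measure_V, of UNIV] by simp
  \<comment> \<open>Finiteness of the limit volume makes the right-hand side strictly larger than
    the limit. The tolerances are geometric so that the excesses along the subsequence have a finite
    sum.\<close>
  have ev: "\<forall>\<^sub>F j in sequentially. ?v (g j) < ?v g0 + ennreal ((1/2) ^ k)" for k
  proof (rule order_tendstoD(2)[OF assms(7)])
    have "?v g0 + 0 < ?v g0 + ennreal ((1/2) ^ k)"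
      using fin by (intro ennreal_add_left_cancel_less[THEN iffD2]) auto
    then show "?v g0 < ?v g0 + ennreal ((1/2) ^ k)" by simp
  qed
  obtain r :: "nat \<Rightarrow> nat" where r: "strict_mono r" "\<And>k. ?v (g (r k)) < ?v g0 + ennreal ((1/2) ^ k)"
    using strict_mono_subseq_ex[of "\<lambda>k j. ?v (g j) < ?v g0 + ennreal ((1/2) ^ k)", OF ev] by blast
  have "?v (g (r k)) - ?v g0 \<le> ennreal ((1/2) ^ k)" for k
  proof -
    have "?v (g (r k)) - ?v g0 \<le> ?v g0 + ennreal ((1/2) ^ k) - ?v g0"
      using r(2)[of k] by (intro ennreal_minus_mono) auto
    then show ?thesis using fin by simp
  qed
  then have "(\<Sum>k. ?v (g (r k)) - ?v g0) \<le> (\<Sum>k. ennreal ((1/2) ^ k))"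
    by (intro suminf_le) auto
  also have "\<dots> = ennreal (\<Sum>k. (1/2) ^ k)"
    by (intro suminf_ennreal2 summable_geometric) auto
  also have "\<dots> < \<infinity>" by simp
  finally have "metrics_above A g0 (\<lambda>j. g (r j))"
    using above by (intro metrics_above.intro metrics_above_axioms.intro base.riemannian_metric_axioms)
  then interpret metrics_above A g0 "\<lambda>j. g (r j)" .
  have "AE x in riem_volume A g0 \<Otimes>\<^sub>M riem_volume A g0. good (fst x) \<and> good (snd x)"
    by (rule AE_pair_both[OF base.finite_measure_V AE_good])
  then have "AE x in riem_volume A g0 \<Otimes>\<^sub>M riem_volume A g0.
      (\<lambda>j. riem_dist A (g (r j)) (fst x) (snd x)) \<longlonglongrightarrow> riem_dist A g0 (fst x) (snd x)"
    by eventually_elim (simp add: riem_dist_tendsto)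
  then show ?thesis using r(1) by blast
qed

end
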